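(* Let $\boldsymbol\omega\in\boldsymbol\Omega_\alpha$, $\theta\in\mathcal C^2_{\boldsymbol\omega,\boldsymbol\alpha}(\tilde E)$, $g\in\mathcal C^{2,3}_{\omega,\boldsymbol\alpha,loc}(\tilde E,E)$ and $\eta_t:=g(t,\theta_t)$. Put $a:=(\partial_\omega\theta)^*$, $b:=D^{\boldsymbol\omega}_t\theta+\frac12\partial_\omega a$, $h:=(\partial_\omega g)^*$, $f:=D^{\boldsymbol\omega}_tg+\frac12\partial_\omega h$, so that $d\theta_t=a_t\cdot d\boldsymbol\omega_t+b_t:d\langle\boldsymbol\omega\rangle_t$ and $dg(t,y)=h(t,y)\cdot d\boldsymbol\omega_t+f(t,y):d\langle\boldsymbol\omega\rangle_t$. The chain rule of path derivatives, $$\partial_\omega\eta_t=(\partial_\omega g)(t,\theta_t)+\sum_k\partial_{y_k}g(t,\theta_t)\partial_\omega\theta^k_t,\qquad D^{\boldsymbol\omega}_t\eta_t=(D^{\boldsymbol\omega}_tg)(t,\theta_t)+\sum_k\partial_{y_k}g(t,\theta_t)D^{\boldsymbol\omega}_t\theta^k_t\ \text{ (for appropriate } D^{\boldsymbol\omega}_t),$$ is equivalent to the pathwise Itô–Ventzell formula. Indeed, $\partial_\omega\partial_yg=(\partial_yh)^*$ and, for $1\le p,q\le d$, $$(\partial_\omega\eta_t)_p=h_p(t,\theta_t)+\sum_k\partial_{y_k}g(t,\theta_t)a^k_{p,t},$$ $$(\partial^2_{\omega\omega}\eta_t)_{pq}=\Big[(\partial_\omega h)_{pq}+\sum_k\partial_{y_k}h_p\,a^k_{q,t}+\sum_k\partial_{y_k}h_q\,a^k_{p,t}+\sum_{k,l}\partial^2_{y_ky_l}g\,a^k_{p,t}a^l_{q,t}+\sum_k\partial_{y_k}g\,(\partial_\omega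 a^k_t)_{pq}\Big](t,\theta_t),$$ $$D^{\boldsymbol\omega}_t\eta_t=\tfrac12\Big[(f-\tfrac12\partial_\omega h)+(f-\tfrac12\partial_\omega h)^*+\sum_k\partial_{y_k}g\,\big[(b^k_t-\tfrac12\partial_\omega a^k_t)+(b^k_t-\tfrac12\partial_\omega a^k_t)^*\big]\Big](t,\theta_t),$$ and these imply the pathwise Itô–Ventzell formula $$d[g(t,\theta_t)]=\Big[h(t,\theta_t)+\Big(\sum_k\partial_{y_k}g(t,\theta_t)a^k_{p,t}\Big)_{1\le p\le d}\Big]\cdot d\boldsymbol\omega_t+\sum_{p,q=1}^d\Big[f_{pq}+\sum_k\partial_{y_k}g\,b^k_{pq,t}+\tfrac12\sum_{k,l}\partial^2_{y_ky_l}g\,a^k_{p,t}a^l_{q,t}+\sum_k\partial_{y_k}h_p\,a^k_{q,t}\Big](t,\theta_t)\,d\langle\boldsymbol\omega\rangle^{pq}_t .$$ Here $k,l$ run over $1,\dots,|\tilde E|$ and $a^k_p$ is the $k$-th coordinate of the $p$-th entry of $a\in\tilde E^d$ (similarly $b^k_{pq}$).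
   Context: Fix $T>0$, $\mathbb T=[0,T]$, $\mathbb T^2=\{(s,t):0\le s<t\le T\}$, $d\ge1$; $E,\tilde E$ are Euclidean spaces; $\varphi_{s,t}:=\varphi_t-\varphi_s$ for a path $\varphi$; $A:\tilde A:=\mathrm{Trace}(A\tilde A^* )$. Fix $\boldsymbol\alpha=(\alpha,\beta)$ with $\alpha\in(\frac13,\frac12)$, $\beta\in(1-2\alpha,\alpha]$. For $\gamma>0$, $\Omega_\gamma(E)$ is the set of continuous $\omega:\mathbb T\to E$ with $\|\omega\|_\gamma:=\sup_{\mathbb T^2}|\omega_{s,t}|/|t-s|^\gamma<\infty$; $\underline\Omega_\gamma(E)$ is the set of continuous $\underline\omega:\mathbb T^2\to E$ with $\|\underline\omega\|_\gamma:=\sup_{\mathbb T^2}|\underline\omega_{s,t}|/|t-s|^\gamma<\infty$. Rough paths: $\boldsymbol\Omega^0_\alpha$ is the set of $\boldsymbol\omega=(\omega,\underline\omega)\in\Omega_\alpha(\mathbb R^d)\times\underline\Omega_{2\alpha}(\mathbb R^{d\times d})$ with $\underline\omega_{s,t}-\underline\omega_{s,r}-\underline\omega_{r,t}=\omega_{s,r}\omega_{r,t}^*$ for $s<r<t$. $\boldsymbol\Omega_\alpha$ is the set of $\boldsymbol\omega\in\boldsymbol\Omega^0_\alpha$ for which there is a dense $A\subset[0,T)$ with $\limsup_{t\downarrow s}|v\cdot\omega_{s,t}|/(t-s)^{2\alpha}=\infty$ for all $s\in A$, $v\in\mathbb R^d\setminus\{0\}$. Bracket: $\langle\boldsymbol\omega\rangle_t:=\omega_{0,t}\omega_{0,t}^*-\underline\omega_{0,t}-\underline\omega_{0,t}^*$,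 a symmetric-matrix valued path. Controlled paths: $\mathcal C^1_{\omega,\boldsymbol\alpha}(E)$ is the set of $\theta\in\Omega_\beta(E)$ for which there is a (row-vector valued) $\partial_\omega\theta\in\Omega_\beta(E^{1\times d})$ with $R^{\omega,\theta}_{s,t}:=\theta_{s,t}-\partial_\omega\theta_s\,\omega_{s,t}$ in $\underline\Omega_{\alpha+\beta}(E)$. For $\boldsymbol\omega\in\boldsymbol\Omega_\alpha$, $\partial_\omega\theta$ is taken to be unique. $\|\theta\|_{\omega,\boldsymbol\alpha}:=\|\partial_\omega\theta\|_\beta+\|R^{\omega,\theta}\|_{\alpha+\beta}$, $|||\theta|||_{\omega,\boldsymbol\alpha}:=\|\theta\|_{\omega,\boldsymbol\alpha}+|\partial_\omega\theta_0|$. For $\theta=(\theta_1,\dots,\theta_d)^*\in\mathcal C^1_{\omega,\boldsymbol\alpha}(E^d)$, $\partial_\omega\theta\in E^{d\times d}$ has $i$-th row $\partial_\omega\theta_i$. Integrals: for $\theta\in\mathcal C^1_{\omega,\boldsymbol\alpha}(E^d)$, $\int_0^t\theta_s\cdot d\boldsymbol\omega_s$ is the limit, as the mesh of partitions $0=t_0<\dots<t_n=T$ tends to $0$, of $\sum_i\big[\theta_{t_i\wedge t}\cdot\omega_{t_i\wedge t,t_{i+1}\wedge t}+\partial_\omega\theta_{t_i\wedge t}:\underline\omega_{t_i\wedge t,t_{i+1}\wedge t}\big]$. For $c\in\Omega_\beta(E^{d\times d})$, $\int c:d\langle\boldsymbol\omega\rangle$ is the Young integral. $\mathcal C^2_{\boldsymbol\omega,\boldsymbol\alpha}(E)$: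 the set of $\theta\in\mathcal C^1_{\omega,\boldsymbol\alpha}(E)$ with $\partial_\omega\theta\in\mathcal C^1_{\omega,\boldsymbol\alpha}(E^{1\times d})$ for which there is a symmetric $D^{\boldsymbol\omega}_t\theta\in\Omega_\beta(E^{d\times d})$ (in general not unique) with $d\theta_t=\partial_\omega\theta_t\,d\boldsymbol\omega_t+[D^{\boldsymbol\omega}_t\theta_t+\frac12\partial^2_{\omega\omega}\theta_t]:d\langle\boldsymbol\omega\rangle_t$, where $\partial^2_{\omega\omega}\theta:=\partial_\omega[(\partial_\omega\theta)^*]$. Function spaces ($g:\mathbb T\times\tilde E\to E$; path derivatives are taken in $t$ for fixed $y$): $\mathcal C^k_{loc}$: $g$ is $k$ times differentiable in $y$. $\mathcal C^k_{\beta,loc}$: $g\in\mathcal C^k_{loc}$ and, for $0\le i\le k$, $\partial_y^{(i)}g$ is Hölder-$\beta$ continuous in $t$ and $y\mapsto\partial^{(i)}_yg(\cdot,y)$ is continuous under $\|\cdot\|_\beta$. $\mathcal C^{1,2}_{\omega,\boldsymbol\alpha,loc}(\tilde E,E)$: $g\in\mathcal C^2_{loc}$, $g(\cdot,y)\in\mathcal C^1_{\omega,\boldsymbol\alpha}(E)$ and $\partial_yg(\cdot,y)\in\mathcal C^1_{\omega,\boldsymbol\alpha}(E^{1\times|\tilde E|})$ for each $y$, both maps $y\mapsto g(\cdot,y)$, $y\mapsto\partial_yg(\cdot,y)$ are continuous under $|||\cdot|||_{\omega,\boldsymbol\alpha}$, and $\partial_\omega g\in\mathcal C^1_{\beta,loc}(\tilde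 E,E^{1\times d})$. $\mathcal C^{2,3}_{\omega,\boldsymbol\alpha,loc}(\tilde E,E)$: $g\in\mathcal C^{1,2}_{\omega,\boldsymbol\alpha,loc}$ with $\partial_\omega g$ and $\partial_yg$ in $\mathcal C^{1,2}_{\omega,\boldsymbol\alpha,loc}$ (with values in $E^{1\times d}$, $E^{1\times|\tilde E|}$), $g(\cdot,y)\in\mathcal C^2_{\boldsymbol\omega,\boldsymbol\alpha}(E)$ for every $y$, and there exists $D^{\boldsymbol\omega}_tg\in\mathcal C^1_{\beta,loc}(\tilde E,E^{d\times d})$.
   Formalization: Differentiability in y is read as C^k with derivatives jointly continuous in (t,y) (plain differentiability makes the claim false), and the rough integral pairs ∂_ωθ with the transpose of the second-order increment (as printed, its sums need not converge). *)

theory Defs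
  imports "HOL-Analysis.Analysis"
begin

text \<open>
  Paths are functions of type \<open>real \<Rightarrow> 'e\<close> of which only the values on \<open>{0..T}\<close> matter;
  two-parameter functions matter only on \<open>time_simplex T\<close>.  \<open>\<real>\<^sup>d\<close> is \<open>real^'d\<close>, and both the rows
  \<open>E\<^bsup>1\<times>d\<^esup>\<close> and the columns \<open>E\<^bsup>d\<^esup>\<close> are \<open>'e^'d\<close>, so that the transposition between rows and
  columns is the identity.  A matrix \<open>M :: 'e^'d^'d\<close> has the entries \<open>M $ row $ column\<close>.
  In all definitions \<open>\<omega>\<close> is the path and \<open>W\<close> the second-order part of the rough path.
\<close>

section \<open>Hoelder spaces\<close>

definition time_simplex :: "real \<Rightarrow> (real \<times> real) set" where
  "time_simplex T = {(s, t). 0 \<le> s \<and> s < t \<and> t \<le> T}"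

definition hoelder2_norm :: "real \<Rightarrow> real \<Rightarrow> (real \<Rightarrow> real \<Rightarrow> 'e::euclidean_space) \<Rightarrow> real" where
  "hoelder2_norm T \<gamma> R = (SUP (s, t) \<in> time_simplex T. norm (R s t) / (t - s) powr \<gamma>)"

definition hoelder2 :: "real \<Rightarrow> real \<Rightarrow> (real \<Rightarrow> real \<Rightarrow> 'e::euclidean_space) \<Rightarrow> bool" where
  "hoelder2 T \<gamma> R \<longleftrightarrow> continuous_on (time_simplex T) (\<lambda>(s, t). R s t) \<and>
     bdd_above ((\<lambda>(s, t). norm (R s t) / (t - s) powr \<gamma>) ` time_simplex T)"

definition hoelder_norm :: "real \<Rightarrow> real \<Rightarrow> (real \<Rightarrow> 'e::euclidean_space) \<Rightarrow> real" where
  "hoelder_norm T \<gamma> \<phi> = (SUP (s, t) \<in> time_simplex T. norm (\<phi> t - \<phi> s) / (t - s) powr \<gamma>)"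

definition hoelder :: "real \<Rightarrow> real \<Rightarrow> (real \<Rightarrow> 'e::euclidean_space) \<Rightarrow> bool" where
  "hoelder T \<gamma> \<phi> \<longleftrightarrow> continuous_on {0..T} \<phi> \<and>
     bdd_above ((\<lambda>(s, t). norm (\<phi> t - \<phi> s) / (t - s) powr \<gamma>) ` time_simplex T)"

section \<open>Products\<close>

text \<open>The product of a row (or the transpose of a column) with entries in \<open>E\<close> and a vector.\<close>

definition vdot :: "'e::euclidean_space ^ 'd \<Rightarrow> real ^ 'd \<Rightarrow> 'e" where
  "vdot c v = (\<Sum>i\<in>UNIV. v $ i *\<^sub>R c $ i)"

text \<open>\<open>A : B = Trace (A B\<^sup>*)\<close>.\<close>

definition ddot :: "'e::euclidean_space ^ 'd ^ 'd \<Rightarrow> real ^ 'd ^ 'd \<Rightarrow> 'e" where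
  "ddot A B = (\<Sum>i\<in>UNIV. \<Sum>j\<in>UNIV. B $ i $ j *\<^sub>R A $ i $ j)"

definition outer :: "real ^ 'd \<Rightarrow> real ^ 'd \<Rightarrow> real ^ 'd ^ 'd" where
  "outer u v = (\<chi> i j. u $ i * v $ j)"

section \<open>Rough paths\<close>

definition rough_path0 ::
  "real \<Rightarrow> real \<Rightarrow> (real \<Rightarrow> real ^ 'd) \<Rightarrow> (real \<Rightarrow> real \<Rightarrow> real ^ 'd ^ 'd) \<Rightarrow> bool" where
  "rough_path0 T \<alpha> \<omega> W \<longleftrightarrow> hoelder T \<alpha> \<omega> \<and> hoelder2 T (2 * \<alpha>) W \<and>
     (\<forall>s r t. 0 \<le> s \<and> s < r \<and> r < t \<and> t \<le> T \<longrightarrow>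
        W s t - W s r - W r t = outer (\<omega> r - \<omega> s) (\<omega> t - \<omega> r))"

definition rough_path ::
  "real \<Rightarrow> real \<Rightarrow> (real \<Rightarrow> real ^ 'd) \<Rightarrow> (real \<Rightarrow> real \<Rightarrow> real ^ 'd ^ 'd) \<Rightarrow> bool" where
  "rough_path T \<alpha> \<omega> W \<longleftrightarrow> rough_path0 T \<alpha> \<omega> W \<and>
     (\<exists>A. A \<subseteq> {0..<T} \<and> {0..<T} \<subseteq> closure A \<and>
        (\<forall>s\<in>A. \<forall>v. v \<noteq> 0 \<longrightarrow>
           Limsup (at_right s)
             (\<lambda>t. ereal (\<bar>v \<bullet> (\<omega> t - \<omega> s)\<bar> / (t - s) powr (2 * \<alpha>))) = \<infinity>))"

text \<open>\<open>W\<close> carries no information on the diagonal, where the second-order increment is \<open>0\<close>.\<close>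

definition area :: "(real \<Rightarrow> real \<Rightarrow> real ^ 'd ^ 'd) \<Rightarrow> real \<Rightarrow> real \<Rightarrow> real ^ 'd ^ 'd" where
  "area W s t = (if s < t then W s t else 0)"

definition bracket ::
  "(real \<Rightarrow> real ^ 'd) \<Rightarrow> (real \<Rightarrow> real \<Rightarrow> real ^ 'd ^ 'd) \<Rightarrow> real \<Rightarrow> real ^ 'd ^ 'd" where
  "bracket \<omega> W t = outer (\<omega> t - \<omega> 0) (\<omega> t - \<omega> 0) - area W 0 t - transpose (area W 0 t)"

section \<open>Controlled paths\<close>

definition path_remainder ::
  "(real \<Rightarrow> real ^ 'd) \<Rightarrow> (real \<Rightarrow> 'e::euclidean_space) \<Rightarrow> (real \<Rightarrow> 'e ^ 'd)
     \<Rightarrow> real \<Rightarrow> real \<Rightarrow> 'e" where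
  "path_remainder \<omega> \<theta> \<theta>' s t = \<theta> t - \<theta> s - vdot (\<theta>' s) (\<omega> t - \<omega> s)"

definition has_path_deriv ::
  "real \<Rightarrow> real \<Rightarrow> real \<Rightarrow> (real \<Rightarrow> real ^ 'd) \<Rightarrow> (real \<Rightarrow> 'e::euclidean_space)
     \<Rightarrow> (real \<Rightarrow> 'e ^ 'd) \<Rightarrow> bool" where
  "has_path_deriv T \<alpha> \<beta> \<omega> \<theta> \<theta>' \<longleftrightarrow> hoelder T \<beta> \<theta> \<and> hoelder T \<beta> \<theta>' \<and>
     hoelder2 T (\<alpha> + \<beta>) (path_remainder \<omega> \<theta> \<theta>')"

definition C1_path ::
  "real \<Rightarrow> real \<Rightarrow> real \<Rightarrow> (real \<Rightarrow> real ^ 'd) \<Rightarrow> (real \<Rightarrow> 'e::euclidean_space) \<Rightarrow> bool" where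
  "C1_path T \<alpha> \<beta> \<omega> \<theta> \<longleftrightarrow> (\<exists>\<theta>'. has_path_deriv T \<alpha> \<beta> \<omega> \<theta> \<theta>')"

text \<open>
  The standing convention that path derivatives with respect to \<open>\<omega>\<close> are unique.  It is stated for
  real-valued paths; uniqueness for paths in any Euclidean space follows coordinatewise.  For
  \<open>\<beta> = \<alpha>\<close> it is a consequence of \<open>rough_path\<close>, for \<open>\<beta> < \<alpha>\<close> it is not: the exponent
  \<open>\<alpha> + \<beta>\<close> of the remainder is then smaller than the exponent \<open>2\<alpha>\<close> of true roughness.
\<close>

definition unique_path_deriv :: "real \<Rightarrow> real \<Rightarrow> real \<Rightarrow> (real \<Rightarrow> real ^ 'd) \<Rightarrow> bool" where
  "unique_path_deriv T \<alpha> \<beta> \<omega> \<longleftrightarrow>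
     (\<forall>(\<theta> :: real \<Rightarrow> real) \<theta>' \<theta>''.
        has_path_deriv T \<alpha> \<beta> \<omega> \<theta> \<theta>' \<and> has_path_deriv T \<alpha> \<beta> \<omega> \<theta> \<theta>''
          \<longrightarrow> (\<forall>t\<in>{0..T}. \<theta>' t = \<theta>'' t))"

text \<open>The path derivative \<open>\<partial>\<^sub>\<omega>\<theta>\<close>; it is determined on \<open>{0..T}\<close> only.\<close>

definition path_deriv ::
  "real \<Rightarrow> real \<Rightarrow> real \<Rightarrow> (real \<Rightarrow> real ^ 'd) \<Rightarrow> (real \<Rightarrow> 'e::euclidean_space)
     \<Rightarrow> real \<Rightarrow> 'e ^ 'd" where
  "path_deriv T \<alpha> \<beta> \<omega> \<theta> = (SOME \<theta>'. has_path_deriv T \<alpha> \<beta> \<omega> \<theta> \<theta>')"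

text \<open>
  For \<open>\<theta>\<close> with values in \<open>E\<^sup>d\<close>, the matrix whose \<open>i\<close>-th row is \<open>\<partial>\<^sub>\<omega>\<theta>\<^sub>i\<close>.  The transposition is
  needed because the outer index of \<open>path_deriv\<close> is the direction of differentiation.
\<close>

definition path_deriv_mat ::
  "real \<Rightarrow> real \<Rightarrow> real \<Rightarrow> (real \<Rightarrow> real ^ 'd) \<Rightarrow> (real \<Rightarrow> 'e::euclidean_space ^ 'd)
     \<Rightarrow> real \<Rightarrow> 'e ^ 'd ^ 'd" where
  "path_deriv_mat T \<alpha> \<beta> \<omega> \<theta> t = transpose (path_deriv T \<alpha> \<beta> \<omega> \<theta> t)"

text \<open>The norm \<open>|||\<theta>|||\<close>.\<close>

definition ctrl_norm ::
  "real \<Rightarrow> real \<Rightarrow> real \<Rightarrow> (real \<Rightarrow> real ^ 'd) \<Rightarrow> (real \<Rightarrow> 'e::euclidean_space) \<Rightarrow> real" where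
  "ctrl_norm T \<alpha> \<beta> \<omega> \<theta> =
     hoelder_norm T \<beta> (path_deriv T \<alpha> \<beta> \<omega> \<theta>)
     + hoelder2_norm T (\<alpha> + \<beta>) (path_remainder \<omega> \<theta> (path_deriv T \<alpha> \<beta> \<omega> \<theta>))
     + norm (path_deriv T \<alpha> \<beta> \<omega> \<theta> 0)"

section \<open>Integrals\<close>

definition is_partition :: "real \<Rightarrow> nat \<Rightarrow> (nat \<Rightarrow> real) \<Rightarrow> bool" where
  "is_partition T n p \<longleftrightarrow> p 0 = 0 \<and> p n = T \<and> (\<forall>i<n. p i < p (Suc i))"

definition has_mesh_limit ::
  "real \<Rightarrow> (real \<Rightarrow> real \<Rightarrow> 'e::euclidean_space) \<Rightarrow> real \<Rightarrow> 'e \<Rightarrow> bool" where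
  "has_mesh_limit T \<Xi> t I \<longleftrightarrow>
     (\<forall>\<epsilon>>0. \<exists>\<delta>>0. \<forall>n p. is_partition T n p \<and> (\<forall>i<n. p (Suc i) - p i < \<delta>) \<longrightarrow>
        norm ((\<Sum>i<n. \<Xi> (min (p i) t) (min (p (Suc i)) t)) - I) < \<epsilon>)"

text \<open>
  The value at \<open>t\<close> of \<open>\<integral> \<theta> \<cdot> d\<omega>\<close>.  With the conventions in force for Chen's relation (whose
  \<open>(i, j)\<close> entry makes \<open>W\<^sup>i\<^sup>j\<close> the integral of \<open>\<omega>\<^sup>i\<close> against \<open>\<omega>\<^sup>j\<close>) and for the rows of
  \<open>\<partial>\<^sub>\<omega>\<theta>\<close>, the entry \<open>(\<partial>\<^sub>\<omega>\<theta>)\<^sub>i\<^sub>j\<close> has to be paired with \<open>W\<^sup>j\<^sup>i\<close>: only then do the terms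
  \<open>\<partial>\<^sub>\<omega>\<theta>\<^sub>s \<omega>\<^sub>s\<^sub>r \<cdot> \<omega>\<^sub>r\<^sub>t\<close> cancel under refinement of the partition, so that the sums converge for every
  controlled \<open>\<theta>\<close>.  Both pairings agree if \<open>\<partial>\<^sub>\<omega>\<theta>\<close> is symmetric, in particular for \<open>d = 1\<close>.
\<close>

definition has_rough_integral ::
  "real \<Rightarrow> real \<Rightarrow> real \<Rightarrow> (real \<Rightarrow> real ^ 'd) \<Rightarrow> (real \<Rightarrow> real \<Rightarrow> real ^ 'd ^ 'd)
     \<Rightarrow> (real \<Rightarrow> 'e::euclidean_space ^ 'd) \<Rightarrow> real \<Rightarrow> 'e \<Rightarrow> bool" where
  "has_rough_integral T \<alpha> \<beta> \<omega> W \<theta> t I \<longleftrightarrow>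
     has_mesh_limit T
       (\<lambda>u v. vdot (\<theta> u) (\<omega> v - \<omega> u)
              + ddot (path_deriv_mat T \<alpha> \<beta> \<omega> \<theta> u) (transpose (area W u v))) t I"

text \<open>The value at \<open>t\<close> of the Young integral \<open>\<integral> c : d\<langle>\<omega>\<rangle>\<close>.\<close>

definition has_bracket_integral ::
  "real \<Rightarrow> (real \<Rightarrow> real ^ 'd) \<Rightarrow> (real \<Rightarrow> real \<Rightarrow> real ^ 'd ^ 'd)
     \<Rightarrow> (real \<Rightarrow> 'e::euclidean_space ^ 'd ^ 'd) \<Rightarrow> real \<Rightarrow> 'e \<Rightarrow> bool" where
  "has_bracket_integral T \<omega> W c t J \<longleftrightarrow>
     has_mesh_limit T (\<lambda>u v. ddot (c u) (bracket \<omega> W v - bracket \<omega> W u)) t J"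

text \<open>\<open>d\<theta>\<^sub>t = a\<^sub>t \<cdot> d\<omega>\<^sub>t + b\<^sub>t : d\<langle>\<omega>\<rangle>\<^sub>t\<close> on \<open>{0..T}\<close>.\<close>

definition rough_differential ::
  "real \<Rightarrow> real \<Rightarrow> real \<Rightarrow> (real \<Rightarrow> real ^ 'd) \<Rightarrow> (real \<Rightarrow> real \<Rightarrow> real ^ 'd ^ 'd)
     \<Rightarrow> (real \<Rightarrow> 'e::euclidean_space) \<Rightarrow> (real \<Rightarrow> 'e ^ 'd) \<Rightarrow> (real \<Rightarrow> 'e ^ 'd ^ 'd)
     \<Rightarrow> bool" where
  "rough_differential T \<alpha> \<beta> \<omega> W \<theta> a b \<longleftrightarrow> C1_path T \<alpha> \<beta> \<omega> a \<and> hoelder T \<beta> b \<and>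
     (\<forall>t\<in>{0..T}. \<exists>I J. has_rough_integral T \<alpha> \<beta> \<omega> W a t I \<and>
        has_bracket_integral T \<omega> W b t J \<and> \<theta> t - \<theta> 0 = I + J)"

section \<open>Second-order path derivatives\<close>

definition path_deriv2 ::
  "real \<Rightarrow> real \<Rightarrow> real \<Rightarrow> (real \<Rightarrow> real ^ 'd) \<Rightarrow> (real \<Rightarrow> 'e::euclidean_space)
     \<Rightarrow> real \<Rightarrow> 'e ^ 'd ^ 'd" where
  "path_deriv2 T \<alpha> \<beta> \<omega> \<theta> = path_deriv_mat T \<alpha> \<beta> \<omega> (path_deriv T \<alpha> \<beta> \<omega> \<theta>)"

text \<open>\<open>D\<close> is an admissible choice of the (in general not unique) time derivative of \<open>\<theta>\<close>.\<close>

definition has_time_deriv ::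
  "real \<Rightarrow> real \<Rightarrow> real \<Rightarrow> (real \<Rightarrow> real ^ 'd) \<Rightarrow> (real \<Rightarrow> real \<Rightarrow> real ^ 'd ^ 'd)
     \<Rightarrow> (real \<Rightarrow> 'e::euclidean_space) \<Rightarrow> (real \<Rightarrow> 'e ^ 'd ^ 'd) \<Rightarrow> bool" where
  "has_time_deriv T \<alpha> \<beta> \<omega> W \<theta> D \<longleftrightarrow> hoelder T \<beta> D \<and>
     (\<forall>t\<in>{0..T}. transpose (D t) = D t) \<and>
     rough_differential T \<alpha> \<beta> \<omega> W \<theta> (path_deriv T \<alpha> \<beta> \<omega> \<theta>)
       (\<lambda>t. D t + (1/2) *\<^sub>R path_deriv2 T \<alpha> \<beta> \<omega> \<theta> t)"

definition C2_path ::
  "real \<Rightarrow> real \<Rightarrow> real \<Rightarrow> (real \<Rightarrow> real ^ 'd) \<Rightarrow> (real \<Rightarrow> real \<Rightarrow> real ^ 'd ^ 'd)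
     \<Rightarrow> (real \<Rightarrow> 'e::euclidean_space) \<Rightarrow> bool" where
  "C2_path T \<alpha> \<beta> \<omega> W \<theta> \<longleftrightarrow> C1_path T \<alpha> \<beta> \<omega> \<theta> \<and>
     C1_path T \<alpha> \<beta> \<omega> (path_deriv T \<alpha> \<beta> \<omega> \<theta>) \<and> (\<exists>D. has_time_deriv T \<alpha> \<beta> \<omega> W \<theta> D)"

section \<open>Functions of time and space\<close>

text \<open>\<open>\<partial>\<^sub>yg\<close>, whose \<open>k\<close>-th entry is \<open>\<partial>g/\<partial>y\<^sub>k\<close>.\<close>

definition dy ::
  "(real \<Rightarrow> real ^ 'm \<Rightarrow> 'e::euclidean_space) \<Rightarrow> real \<Rightarrow> real ^ 'm \<Rightarrow> 'e ^ 'm" where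
  "dy g t y = (\<chi> k. frechet_derivative (g t) (at y) (axis k 1))"

definition d\<omega> ::
  "real \<Rightarrow> real \<Rightarrow> real \<Rightarrow> (real \<Rightarrow> real ^ 'd) \<Rightarrow> (real \<Rightarrow> real ^ 'm \<Rightarrow> 'e::euclidean_space)
     \<Rightarrow> real \<Rightarrow> real ^ 'm \<Rightarrow> 'e ^ 'd" where
  "d\<omega> T \<alpha> \<beta> \<omega> g t y = path_deriv T \<alpha> \<beta> \<omega> (\<lambda>s. g s y) t"

definition d\<omega>_mat ::
  "real \<Rightarrow> real \<Rightarrow> real \<Rightarrow> (real \<Rightarrow> real ^ 'd) \<Rightarrow> (real \<Rightarrow> real ^ 'm \<Rightarrow> 'e::euclidean_space ^ 'd)
     \<Rightarrow> real \<Rightarrow> real ^ 'm \<Rightarrow> 'e ^ 'd ^ 'd" where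
  "d\<omega>_mat T \<alpha> \<beta> \<omega> h t y = path_deriv_mat T \<alpha> \<beta> \<omega> (\<lambda>s. h s y) t"

text \<open>
  As usual for classes denoted by \<open>C\<^sup>k\<close>, the derivatives in \<open>y\<close> up to order \<open>k\<close> are required to be
  continuous on \<open>{0..T} \<times> \<real>\<^sup>m\<close>.  Bare existence would not give local bounds for the derivatives of
  highest order, and composition with a controlled path would leave the class of controlled paths.
\<close>

definition C0_loc :: "real \<Rightarrow> (real \<Rightarrow> real ^ 'm \<Rightarrow> 'e::euclidean_space) \<Rightarrow> bool" where
  "C0_loc T g \<longleftrightarrow> continuous_on ({0..T} \<times> UNIV) (\<lambda>(t, y). g t y)"

definition C1_loc :: "real \<Rightarrow> (real \<Rightarrow> real ^ 'm \<Rightarrow> 'e::euclidean_space) \<Rightarrow> bool" where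
  "C1_loc T g \<longleftrightarrow> C0_loc T g \<and> (\<forall>t\<in>{0..T}. \<forall>y. g t differentiable (at y)) \<and> C0_loc T (dy g)"

definition C2_loc :: "real \<Rightarrow> (real \<Rightarrow> real ^ 'm \<Rightarrow> 'e::euclidean_space) \<Rightarrow> bool" where
  "C2_loc T g \<longleftrightarrow> C1_loc T g \<and> C1_loc T (dy g)"

definition hoelder_cont ::
  "real \<Rightarrow> real \<Rightarrow> (real \<Rightarrow> real ^ 'm \<Rightarrow> 'e::euclidean_space) \<Rightarrow> bool" where
  "hoelder_cont T \<beta> g \<longleftrightarrow> (\<forall>y. ((\<lambda>z. hoelder_norm T \<beta> (\<lambda>t. g t z - g t y)) \<longlongrightarrow> 0) (at y))"

definition ctrl_cont ::
  "real \<Rightarrow> real \<Rightarrow> real \<Rightarrow> (real \<Rightarrow> real ^ 'd) \<Rightarrow> (real \<Rightarrow> real ^ 'm \<Rightarrow> 'e::euclidean_space)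
     \<Rightarrow> bool" where
  "ctrl_cont T \<alpha> \<beta> \<omega> g \<longleftrightarrow>
     (\<forall>y. ((\<lambda>z. ctrl_norm T \<alpha> \<beta> \<omega> (\<lambda>t. g t z - g t y)) \<longlongrightarrow> 0) (at y))"

definition C1_beta_loc ::
  "real \<Rightarrow> real \<Rightarrow> (real \<Rightarrow> real ^ 'm \<Rightarrow> 'e::euclidean_space) \<Rightarrow> bool" where
  "C1_beta_loc T \<beta> g \<longleftrightarrow> C1_loc T g \<and>
     (\<forall>y. hoelder T \<beta> (\<lambda>t. g t y)) \<and> (\<forall>y. hoelder T \<beta> (\<lambda>t. dy g t y)) \<and>
     hoelder_cont T \<beta> g \<and> hoelder_cont T \<beta> (dy g)"

definition C12_loc ::
  "real \<Rightarrow> real \<Rightarrow> real \<Rightarrow> (real \<Rightarrow> real ^ 'd) \<Rightarrow> (real \<Rightarrow> real ^ 'm \<Rightarrow> 'e::euclidean_space)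
     \<Rightarrow> bool" where
  "C12_loc T \<alpha> \<beta> \<omega> g \<longleftrightarrow> C2_loc T g \<and>
     (\<forall>y. C1_path T \<alpha> \<beta> \<omega> (\<lambda>t. g t y)) \<and> (\<forall>y. C1_path T \<alpha> \<beta> \<omega> (\<lambda>t. dy g t y)) \<and>
     ctrl_cont T \<alpha> \<beta> \<omega> g \<and> ctrl_cont T \<alpha> \<beta> \<omega> (dy g) \<and>
     C1_beta_loc T \<beta> (d\<omega> T \<alpha> \<beta> \<omega> g)"

definition has_time_deriv_loc ::
  "real \<Rightarrow> real \<Rightarrow> real \<Rightarrow> (real \<Rightarrow> real ^ 'd) \<Rightarrow> (real \<Rightarrow> real \<Rightarrow> real ^ 'd ^ 'd)
     \<Rightarrow> (real \<Rightarrow> real ^ 'm \<Rightarrow> 'e::euclidean_space) \<Rightarrow> (real \<Rightarrow> real ^ 'm \<Rightarrow> 'e ^ 'd ^ 'd)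
     \<Rightarrow> bool" where
  "has_time_deriv_loc T \<alpha> \<beta> \<omega> W g D \<longleftrightarrow> C1_beta_loc T \<beta> D \<and>
     (\<forall>y. has_time_deriv T \<alpha> \<beta> \<omega> W (\<lambda>t. g t y) (\<lambda>t. D t y))"

definition C23_loc ::
  "real \<Rightarrow> real \<Rightarrow> real \<Rightarrow> (real \<Rightarrow> real ^ 'd) \<Rightarrow> (real \<Rightarrow> real \<Rightarrow> real ^ 'd ^ 'd)
     \<Rightarrow> (real \<Rightarrow> real ^ 'm \<Rightarrow> 'e::euclidean_space) \<Rightarrow> bool" where
  "C23_loc T \<alpha> \<beta> \<omega> W g \<longleftrightarrow> C12_loc T \<alpha> \<beta> \<omega> g \<and>
     C12_loc T \<alpha> \<beta> \<omega> (d\<omega> T \<alpha> \<beta> \<omega> g) \<and> C12_loc T \<alpha> \<beta> \<omega> (dy g) \<and>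
     (\<forall>y. C2_path T \<alpha> \<beta> \<omega> W (\<lambda>t. g t y)) \<and> (\<exists>D. has_time_deriv_loc T \<alpha> \<beta> \<omega> W g D)"

section \<open>The chain rule and the Ito--Ventzell formula\<close>

text \<open>
  \<open>D\<theta>\<close> and \<open>Dg\<close> are the chosen time derivatives of \<open>\<theta>\<close> and \<open>g\<close>.
\<close>

definition path_chain_rule ::
  "real \<Rightarrow> real \<Rightarrow> real \<Rightarrow> (real \<Rightarrow> real ^ 'd) \<Rightarrow> (real \<Rightarrow> real \<Rightarrow> real ^ 'd ^ 'd)
     \<Rightarrow> (real \<Rightarrow> real ^ 'm) \<Rightarrow> (real \<Rightarrow> (real ^ 'm) ^ 'd ^ 'd)
     \<Rightarrow> (real \<Rightarrow> real ^ 'm \<Rightarrow> 'e::euclidean_space) \<Rightarrow> (real \<Rightarrow> real ^ 'm \<Rightarrow> 'e ^ 'd ^ 'd)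
     \<Rightarrow> bool" where
  "path_chain_rule T \<alpha> \<beta> \<omega> W \<theta> D\<theta> g Dg \<longleftrightarrow>
     C2_path T \<alpha> \<beta> \<omega> W (\<lambda>t. g t (\<theta> t)) \<and>
     (\<forall>t\<in>{0..T}. path_deriv T \<alpha> \<beta> \<omega> (\<lambda>t. g t (\<theta> t)) t =
        d\<omega> T \<alpha> \<beta> \<omega> g t (\<theta> t)
        + (\<chi> p. \<Sum>k\<in>UNIV. path_deriv T \<alpha> \<beta> \<omega> \<theta> t $ p $ k *\<^sub>R dy g t (\<theta> t) $ k)) \<and>
     has_time_deriv T \<alpha> \<beta> \<omega> W (\<lambda>t. g t (\<theta> t))
       (\<lambda>t. Dg t (\<theta> t) + (\<chi> p q. \<Sum>k\<in>UNIV. D\<theta> t $ p $ q $ k *\<^sub>R dy g t (\<theta> t) $ k))"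

text \<open>\<open>\<partial>\<^sup>2g/\<partial>y\<^sub>k\<partial>y\<^sub>l\<close> is the entry \<open>l, k\<close> of \<open>dy (dy g)\<close>.\<close>

definition ito_ventzell ::
  "real \<Rightarrow> real \<Rightarrow> real \<Rightarrow> (real \<Rightarrow> real ^ 'd) \<Rightarrow> (real \<Rightarrow> real \<Rightarrow> real ^ 'd ^ 'd)
     \<Rightarrow> (real \<Rightarrow> real ^ 'm) \<Rightarrow> (real \<Rightarrow> (real ^ 'm) ^ 'd) \<Rightarrow> (real \<Rightarrow> (real ^ 'm) ^ 'd ^ 'd)
     \<Rightarrow> (real \<Rightarrow> real ^ 'm \<Rightarrow> 'e::euclidean_space) \<Rightarrow> (real \<Rightarrow> real ^ 'm \<Rightarrow> 'e ^ 'd)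
     \<Rightarrow> (real \<Rightarrow> real ^ 'm \<Rightarrow> 'e ^ 'd ^ 'd) \<Rightarrow> bool" where
  "ito_ventzell T \<alpha> \<beta> \<omega> W \<theta> a b g h f \<longleftrightarrow>
     rough_differential T \<alpha> \<beta> \<omega> W (\<lambda>t. g t (\<theta> t))
       (\<lambda>t. h t (\<theta> t) + (\<chi> p. \<Sum>k\<in>UNIV. a t $ p $ k *\<^sub>R dy g t (\<theta> t) $ k))
       (\<lambda>t. \<chi> p q.
          f t (\<theta> t) $ p $ q
          + (\<Sum>k\<in>UNIV. b t $ p $ q $ k *\<^sub>R dy g t (\<theta> t) $ k)
          + (1/2) *\<^sub>R (\<Sum>k\<in>UNIV. \<Sum>l\<in>UNIV.
              (a t $ p $ k * a t $ q $ l) *\<^sub>R dy (dy g) t (\<theta> t) $ l $ k)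
          + (\<Sum>k\<in>UNIV. a t $ q $ k *\<^sub>R dy h t (\<theta> t) $ k $ p))"

end

theory Submission
  imports Defs
begin

text \<open>
  By the sewing lemma, \<open>d\<theta> = a \<cdot> d\<omega> + b : d\<langle>\<omega>\<rangle>\<close> is equivalent to the local expansion of \<open>\<theta>\<^sub>s\<^sub>t\<close> by
  the germs of the two integrals up to an error of order \<open>|t - s|\<^sup>2\<^sup>\<alpha>\<^sup>+\<^sup>\<beta>\<close>, where \<open>2\<alpha> + \<beta> > 1\<close>, and the
  constant depends only on the Hoelder norms of \<open>a\<close>, \<open>\<partial>\<^sub>\<omega>a\<close>, \<open>R\<^sup>\<omega>\<^sup>a\<close> and \<open>b\<close>.  Hence the expansion of
  \<open>g(\<cdot>, y)\<close> is uniform for \<open>y\<close> in a compact set and may be used at \<open>y = \<theta>\<^sub>s\<close>.  The increment of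
  \<open>g(t, \<theta>\<^sub>t)\<close> is the increment of \<open>g(\<cdot>, \<theta>\<^sub>s)\<close> plus that of \<open>g(t, \<cdot>)\<close>.  In the latter, Taylor's formula
  of second order leaves an error of order \<open>3\<alpha>\<close>, its coefficients are moved from time \<open>t\<close> to time \<open>s\<close>
  by their own controlled expansions, and \<open>\<theta>\<^sub>s\<^sub>t\<close> is expanded in turn.  Collecting terms gives the germ
  of the Ito--Ventzell formula.  Symmetrizing its bracket coefficient does not change the integral,
  since the bracket is symmetric; this gives the chain rule for the time derivative.
\<close>

section \<open>Uniform bounds on the simplex\<close>

text \<open>The base point \<open>\<theta> s\<close> moves with \<open>s\<close>, so estimates for a
  single \<open>y\<close> do not suffice. Bounds are therefore stated for families, and continuity
  in \<open>y\<close> under the Hoelder and controlled norms is converted by compactness into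
  constants common to a ball that contains the path. The order to be reached is
  \<open>2 * \<alpha> + \<beta>\<close>. As \<beta> \<le> \<alpha>, three increments of order
  \<alpha> reach it, and so does a remainder of order \<open>\<alpha> + \<beta>\<close> times one
  increment; this decides how precisely each coefficient has to be expanded. Moving the space
  gradient of \<open>g\<close> from \<open>t\<close> to \<open>s\<close> produces its path
  derivative, which fits the germ only after it has been identified with the transposed gradient of
  \<open>h\<close>; that identity is extracted from uniqueness of path derivatives. The mixed term
  enters the Ito--Ventzell coefficient unsymmetrized, whereas half of the second path derivative
  contains its symmetric part; the two bracket coefficients thus differ by an antisymmetric matrix.
  The equivalence of the two rules is obtained by proving both.\<close>

text \<open>
  The constant is uniform over the index set \<open>I\<close>; single functions are families over \<open>{()}\<close>.  As the
  diagonal is excluded, exponent \<open>0\<close> expresses boundedness.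
\<close>

definition incO :: "real \<Rightarrow> real \<Rightarrow> 'i set \<Rightarrow> ('i \<Rightarrow> real \<Rightarrow> real \<Rightarrow> 'e::real_normed_vector) \<Rightarrow> bool" where
  "incO T \<gamma> I R \<longleftrightarrow> (\<exists>C. \<forall>i\<in>I. \<forall>s t. 0 \<le> s \<and> s < t \<and> t \<le> T \<longrightarrow> norm (R i s t) \<le> C * (t - s) powr \<gamma>)"

lemma incOI:
  assumes "\<And>i s t. \<lbrakk>i \<in> I; 0 \<le> s; s < t; t \<le> T\<rbrakk> \<Longrightarrow> norm (R i s t) \<le> C * (t - s) powr \<gamma>"
  shows "incO T \<gamma> I R"
  using assms unfolding incO_def by blast

lemma incOE:
  assumes "incO T \<gamma> I R"
  obtains C where "C \<ge> 0"
    "\<And>i s t. \<lbrakk>i \<in> I; 0 \<le> s; s < t; t \<le> T\<rbrakk> \<Longrightarrow> norm (R i s t) \<le> C * (t - s) powr \<gamma>"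
proof -
  obtain C where C: "\<And>i s t. \<lbrakk>i \<in> I; 0 \<le> s; s < t; t \<le> T\<rbrakk> \<Longrightarrow> norm (R i s t) \<le> C * (t - s) powr \<gamma>"
    using assms unfolding incO_def by blast
  have "norm (R i s t) \<le> max C 0 * (t - s) powr \<gamma>" if "i \<in> I" "0 \<le> s" "s < t" "t \<le> T" for i s t
    using C[OF that] mult_right_mono[of C "max C 0" "(t - s) powr \<gamma>"] by simp
  then show thesis using that[of "max C 0"] by simp
qed

lemma incO_cong:
  assumes "\<And>i s t. \<lbrakk>i \<in> I; 0 \<le> s; s < t; t \<le> T\<rbrakk> \<Longrightarrow> R i s t = R' i s t"
  shows "incO T \<gamma> I R \<longleftrightarrow> incO T \<gamma> I R'"
  using assms unfolding incO_def by (intro ex_cong1) auto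

lemma incO_le:
  assumes "incO T \<gamma> I A"
    and "\<And>i s t. \<lbrakk>i \<in> I; 0 \<le> s; s < t; t \<le> T\<rbrakk> \<Longrightarrow> norm (R i s t) \<le> norm (A i s t)"
  shows "incO T \<gamma> I R"
  using assms unfolding incO_def by (meson order_trans)

lemma incO_mono:
  assumes "incO T \<gamma> I R" "\<gamma>' \<le> \<gamma>" "0 < T"
  shows "incO T \<gamma>' I R"
proof -
  obtain C where C: "C \<ge> 0" "\<And>i s t. \<lbrakk>i \<in> I; 0 \<le> s; s < t; t \<le> T\<rbrakk> \<Longrightarrow> norm (R i s t) \<le> C * (t - s) powr \<gamma>"
    using incOE[OF assms(1)] by metis
  show ?thesis
  proof (rule incOI)
    fix i s t assume a: "i \<in> I" "0 \<le> s" "s < t" "t \<le> T"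
    have "(t - s) powr \<gamma> = (t - s) powr (\<gamma> - \<gamma>') * (t - s) powr \<gamma>'"
      by (simp flip: powr_add)
    also have "\<dots> \<le> T powr (\<gamma> - \<gamma>') * (t - s) powr \<gamma>'"
      using a assms by (intro mult_right_mono powr_mono2) auto
    finally show "norm (R i s t) \<le> (C * T powr (\<gamma> - \<gamma>')) * (t - s) powr \<gamma>'"
      using C(2)[OF a] mult_left_mono[OF _ C(1)] by (fastforce simp: mult.assoc)
  qed
qed

lemma incO_add:
  assumes "incO T \<gamma> I A" "incO T \<gamma> I B"
  shows "incO T \<gamma> I (\<lambda>i s t. A i s t + B i s t)"
proof -
  obtain C where C: "\<And>i s t. \<lbrakk>i \<in> I; 0 \<le> s; s < t; t \<le> T\<rbrakk> \<Longrightarrow> norm (A i s t) \<le> C * (t - s) powr \<gamma>"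
    using incOE[OF assms(1)] by metis
  obtain D where D: "\<And>i s t. \<lbrakk>i \<in> I; 0 \<le> s; s < t; t \<le> T\<rbrakk> \<Longrightarrow> norm (B i s t) \<le> D * (t - s) powr \<gamma>"
    using incOE[OF assms(2)] by metis
  show ?thesis
    by (rule incOI[where C = "C + D"])
      (smt (verit, best) C D norm_triangle_ineq distrib_right)
qed

lemma incO_bilinear:
  assumes bil: "bounded_bilinear bl" and "incO T \<gamma> I A" "incO T \<gamma>' I B"
  shows "incO T (\<gamma> + \<gamma>') I (\<lambda>i s t. bl (A i s t) (B i s t))"
proof -
  interpret bounded_bilinear bl by fact
  obtain C where C: "C \<ge> 0" "\<And>i s t. \<lbrakk>i \<in> I; 0 \<le> s; s < t; t \<le> T\<rbrakk> \<Longrightarrow> norm (A i s t) \<le> C * (t - s) powr \<gamma>"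
    using incOE[OF assms(2)] by metis
  obtain D where D: "D \<ge> 0" "\<And>i s t. \<lbrakk>i \<in> I; 0 \<le> s; s < t; t \<le> T\<rbrakk> \<Longrightarrow> norm (B i s t) \<le> D * (t - s) powr \<gamma>'"
    using incOE[OF assms(3)] by metis
  obtain K where K: "K \<ge> 0" "\<And>a b. norm (bl a b) \<le> norm a * norm b * K"
    using nonneg_bounded by blast
  show ?thesis
  proof (rule incOI)
    fix i s t assume a: "i \<in> I" "0 \<le> s" "s < t" "t \<le> T"
    have "norm (bl (A i s t) (B i s t)) \<le> norm (A i s t) * norm (B i s t) * K"
      by (rule K)
    also have "\<dots> \<le> (C * (t - s) powr \<gamma>) * (D * (t - s) powr \<gamma>') * K"
      using C(2)[OF a] D(2)[OF a] C(1) D(1) K(1) by (intro mult_right_mono mult_mono) auto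
    finally show "norm (bl (A i s t) (B i s t)) \<le> (C * D * K) * (t - s) powr (\<gamma> + \<gamma>')"
      by (simp add: powr_add mult_ac)
  qed
qed

lemma incO_bounded_linear:
  assumes "bounded_linear f" and "incO T \<gamma> I A"
  shows "incO T \<gamma> I (\<lambda>i s t. f (A i s t))"
proof -
  interpret bounded_linear f by fact
  obtain C where C: "C \<ge> 0" "\<And>i s t. \<lbrakk>i \<in> I; 0 \<le> s; s < t; t \<le> T\<rbrakk> \<Longrightarrow> norm (A i s t) \<le> C * (t - s) powr \<gamma>"
    using incOE[OF assms(2)] by metis
  obtain K where K: "K \<ge> 0" "\<And>a. norm (f a) \<le> norm a * K"
    using nonneg_bounded by blast
  show ?thesis
  proof (rule incOI)
    fix i s t assume a: "i \<in> I" "0 \<le> s" "s < t" "t \<le> T"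
    have "norm (f (A i s t)) \<le> norm (A i s t) * K" by (rule K)
    also have "\<dots> \<le> (C * (t - s) powr \<gamma>) * K"
      using C(2)[OF a] K(1) by (intro mult_right_mono)
    finally show "norm (f (A i s t)) \<le> (C * K) * (t - s) powr \<gamma>"
      by (simp add: mult_ac)
  qed
qed

lemmas incO_uminus = incO_bounded_linear[OF bounded_linear_minus[OF bounded_linear_ident]]

lemma incO_diff:
  assumes "incO T \<gamma> I A" "incO T \<gamma> I B"
  shows "incO T \<gamma> I (\<lambda>i s t. A i s t - B i s t)"
  using incO_add[OF assms(1) incO_uminus[OF assms(2)]] by simp

lemma incO_zero: "incO T \<gamma> I (\<lambda>i s t. 0)"
  by (rule incOI[where C = 0]) simp

lemma incO_sum:
  assumes "\<And>p. p \<in> P \<Longrightarrow> incO T \<gamma> I (\<lambda>i s t. A p i s t)"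
  shows "incO T \<gamma> I (\<lambda>i s t. \<Sum>p\<in>P. A p i s t)"
  using assms
proof (induction P rule: infinite_finite_induct)
  case (insert x F)
  then show ?case using incO_add[of T \<gamma> I "\<lambda>i s t. A x i s t" "\<lambda>i s t. \<Sum>p\<in>F. A p i s t"] by simp
qed (simp_all add: incO_zero)

lemma incO_bounded_mult:
  assumes "bounded_bilinear bl" and "incO T 0 I A" "incO T \<gamma> I B"
  shows "incO T \<gamma> I (\<lambda>i s t. bl (A i s t) (B i s t))"
  using incO_bilinear[OF assms] by simp

lemma incO_vec:
  fixes R :: "'i \<Rightarrow> real \<Rightarrow> real \<Rightarrow> 'e::euclidean_space ^ 'n"
  shows "incO T \<gamma> I R \<longleftrightarrow> (\<forall>p. incO T \<gamma> I (\<lambda>i s t. R i s t $ p))"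
proof
  assume "incO T \<gamma> I R"
  then show "\<forall>p. incO T \<gamma> I (\<lambda>i s t. R i s t $ p)"
    using incO_bounded_linear[OF bounded_linear_vec_nth] by blast
next
  assume *: "\<forall>p. incO T \<gamma> I (\<lambda>i s t. R i s t $ p)"
  have "incO T \<gamma> I (\<lambda>i s t. \<Sum>p\<in>UNIV. norm (R i s t $ p))"
    using * by (intro incO_sum) (simp add: incO_def)
  moreover have "norm (R i s t) \<le> norm (\<Sum>p\<in>UNIV. norm (R i s t $ p))" for i s t
    unfolding norm_vec_def by (rule order_trans[OF L2_set_le_sum]) (auto simp: sum_nonneg)
  ultimately show "incO T \<gamma> I R"
    by (rule incO_le)
qed

text \<open>The parameter may move with \<open>s\<close> and \<open>t\<close>: an expansion that is
  uniform over a compact set is thereby evaluated at the running base point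
  \<open>\<theta> s\<close>.\<close>

lemma incO_subst:
  assumes "incO T \<gamma> K R" and "\<And>i s t. \<lbrakk>i \<in> I; 0 \<le> s; s < t; t \<le> T\<rbrakk> \<Longrightarrow> \<theta> i s t \<in> K"
  shows "incO T \<gamma> I (\<lambda>i s t. R (\<theta> i s t) s t)"
  using assms unfolding incO_def by meson

text \<open>Continuity under a norm gives a common constant only near each point. A finite subcover
  makes it global; the sum of the absolute constants dominates each of them.\<close>

lemma incO_locally_uniform:
  assumes "compact K"
    and loc: "\<And>y. y \<in> K \<Longrightarrow> \<exists>d>0. incO T \<gamma> (ball y d) R"
  shows "incO T \<gamma> K R"
proof -
  obtain d where d: "\<And>y. y \<in> K \<Longrightarrow> d y > 0" "\<And>y. y \<in> K \<Longrightarrow> incO T \<gamma> (ball y (d y)) R"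
    using loc by metis
  have "K \<subseteq> (\<Union>y\<in>K. ball y (d y))"
    using d(1) by force
  then obtain F where F: "F \<subseteq> K" "finite F" "K \<subseteq> (\<Union>y\<in>F. ball y (d y))"
    using compactE_image[OF assms(1), of K "\<lambda>y. ball y (d y)"] by (metis open_ball)
  obtain C where C: "\<And>y i s t. \<lbrakk>y \<in> F; i \<in> ball y (d y); 0 \<le> s; s < t; t \<le> T\<rbrakk>
      \<Longrightarrow> norm (R i s t) \<le> C y * (t - s) powr \<gamma>"
    using d(2) F(1) unfolding incO_def by (metis subset_iff)
  show ?thesis
  proof (rule incOI)
    fix i s t assume a: "i \<in> K" "0 \<le> s" "s < t" "t \<le> T"
    then obtain y where y: "y \<in> F" "i \<in> ball y (d y)" using F(3) by blast
    have "C y \<le> (\<Sum>y\<in>F. \<bar>C y\<bar>)"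
      using member_le_sum[of y F "\<lambda>y. \<bar>C y\<bar>"] y F(2) by auto
    then show "norm (R i s t) \<le> (\<Sum>y\<in>F. \<bar>C y\<bar>) * (t - s) powr \<gamma>"
      using C[OF y a(2-)] mult_right_mono[of "C y" _ "(t - s) powr \<gamma>"] by fastforce
  qed
qed

text \<open>Both increments live on subintervals of \<open>[u, v]\<close>, so with nonnegative
  exponents each is bounded by a power of the full length. The defects of germs have this
  shape.\<close>

lemma incO_mult_increments:
  fixes A :: "'i \<Rightarrow> real \<Rightarrow> real \<Rightarrow> 'a::real_normed_vector"
  assumes bil: "bounded_bilinear bl" and "incO T \<gamma> I A" "incO T \<gamma>' I B" "\<gamma> \<ge> 0" "\<gamma>' \<ge> 0"
  shows "\<exists>C\<ge>0. \<forall>i\<in>I. \<forall>u r v. 0 \<le> u \<and> u < r \<and> r < v \<and> v \<le> T \<longrightarrow>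
    norm (bl (A i u r) (B i r v)) \<le> C * (v - u) powr (\<gamma> + \<gamma>')"
proof -
  interpret bounded_bilinear bl by fact
  obtain C where C: "C \<ge> 0" "\<And>i s t. \<lbrakk>i \<in> I; 0 \<le> s; s < t; t \<le> T\<rbrakk> \<Longrightarrow> norm (A i s t) \<le> C * (t - s) powr \<gamma>"
    using incOE[OF assms(2)] by metis
  obtain D where D: "D \<ge> 0" "\<And>i s t. \<lbrakk>i \<in> I; 0 \<le> s; s < t; t \<le> T\<rbrakk> \<Longrightarrow> norm (B i s t) \<le> D * (t - s) powr \<gamma>'"
    using incOE[OF assms(3)] by metis
  obtain K where K: "K \<ge> 0" "\<And>a b. norm (bl a b) \<le> norm a * norm b * K"
    using nonneg_bounded by blast
  have "norm (bl (A i u r) (B i r v)) \<le> (C * D * K) * (v - u) powr (\<gamma> + \<gamma>')"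
    if a: "i \<in> I" "0 \<le> u" "u < r" "r < v" "v \<le> T" for i u r v
  proof -
    have "norm (A i u r) \<le> C * (r - u) powr \<gamma>" "norm (B i r v) \<le> D * (v - r) powr \<gamma>'"
      using C(2) D(2) a by auto
    moreover have "C * (r - u) powr \<gamma> \<le> C * (v - u) powr \<gamma>" "D * (v - r) powr \<gamma>' \<le> D * (v - u) powr \<gamma>'"
      using a C(1) D(1) assms(4,5) by (auto intro!: mult_left_mono powr_mono2)
    ultimately have "norm (A i u r) * norm (B i r v) * K \<le> (C * (v - u) powr \<gamma>) * (D * (v - u) powr \<gamma>') * K"
      using C(1) D(1) K(1) by (intro mult_right_mono mult_mono) auto
    then show ?thesis
      using K(2)[of "A i u r" "B i r v"] by (simp add: powr_add mult_ac)
  qed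
  then show ?thesis
    using C(1) D(1) K(1) by (intro exI[of _ "C * D * K"]) auto
qed

subsection \<open>Paths\<close>

text \<open>\<open>incO\<close> over a one-element index set is the division-free form of a finite
  Hoelder seminorm; it allows estimates to be combined by adding exponents.\<close>

lemma bdd_above_simplex_iff:
  "bdd_above ((\<lambda>(s, t). norm (R s t) / (t - s) powr \<gamma>) ` time_simplex T) \<longleftrightarrow> incO T \<gamma> {()} (\<lambda>_. R)"
proof -
  have *: "(norm (R s t) / (t - s) powr \<gamma> \<le> C) = (norm (R s t) \<le> C * (t - s) powr \<gamma>)" if "s < t" for s t C
    using that by (simp add: divide_le_eq)
  show ?thesis
    unfolding bdd_above_def incO_def time_simplex_def by (intro ex_cong1) (auto simp: *)
qed

lemma hoelder2_iff:
  "hoelder2 T \<gamma> R \<longleftrightarrow> continuous_on (time_simplex T) (\<lambda>(s, t). R s t) \<and> incO T \<gamma> {()} (\<lambda>_. R)"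
  unfolding hoelder2_def by (simp add: bdd_above_simplex_iff)

lemma incO_imp_continuous:
  fixes \<phi> :: "real \<Rightarrow> 'e::real_normed_vector"
  assumes "\<gamma> > 0" and "incO T \<gamma> {()} (\<lambda>_ s t. \<phi> t - \<phi> s)"
  shows "continuous_on {0..T} \<phi>"
proof -
  obtain C where C: "C \<ge> 0" "\<And>s t. \<lbrakk>0 \<le> s; s < t; t \<le> T\<rbrakk> \<Longrightarrow> norm (\<phi> t - \<phi> s) \<le> C * (t - s) powr \<gamma>"
    using incOE[OF assms(2)] by (metis insertI1)
  have *: "dist (\<phi> t) (\<phi> s) \<le> C * \<bar>t - s\<bar> powr \<gamma>" if "s \<in> {0..T}" "t \<in> {0..T}" for s t
    using C(2)[of s t] C(2)[of t s] that
    by (cases s t rule: linorder_cases) (auto simp: dist_norm norm_minus_commute)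
  show ?thesis
    unfolding continuous_on_def
  proof
    fix s assume s: "s \<in> {0..T}"
    have "((\<lambda>t. C * \<bar>t - s\<bar> powr \<gamma>) \<longlongrightarrow> C * \<bar>s - s\<bar> powr \<gamma>) (at s within {0..T})"
      using assms(1) by (intro tendsto_intros tendsto_powr2) (auto simp: eventually_at_filter)
    then have "((\<lambda>t. C * \<bar>t - s\<bar> powr \<gamma>) \<longlongrightarrow> 0) (at s within {0..T})" by simp
    moreover have "\<forall>\<^sub>F t in at s within {0..T}. norm (dist (\<phi> t) (\<phi> s)) \<le> C * \<bar>t - s\<bar> powr \<gamma>"
      unfolding eventually_at_filter by (intro always_eventually allI impI) (simp add: *[OF s])
    ultimately have "((\<lambda>t. dist (\<phi> t) (\<phi> s)) \<longlongrightarrow> 0) (at s within {0..T})"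
      by (rule Lim_null_comparison[rotated])
    then show "(\<phi> \<longlongrightarrow> \<phi> s) (at s within {0..T})"
      by (simp add: tendsto_dist_iff[of \<phi>])
  qed
qed

lemma hoelder_iff:
  "\<gamma> > 0 \<Longrightarrow> hoelder T \<gamma> \<phi> \<longleftrightarrow> incO T \<gamma> {()} (\<lambda>_ s t. \<phi> t - \<phi> s)"
  unfolding hoelder_def bdd_above_simplex_iff[of "\<lambda>s t. \<phi> t - \<phi> s" \<gamma> T]
  by (auto dest: incO_imp_continuous)

lemma hoelder_cong:
  assumes "\<And>t. t \<in> {0..T} \<Longrightarrow> \<phi> t = \<psi> t" and "\<gamma> > 0"
  shows "hoelder T \<gamma> \<phi> \<longleftrightarrow> hoelder T \<gamma> \<psi>"
  unfolding hoelder_iff[OF assms(2)] using assms(1) by (intro incO_cong) auto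

text \<open>A supremum dominates its terms only if they are bounded above, which the first
  hypothesis supplies. Used where all that is known about a difference of paths is that its norm is
  small.\<close>

lemma incO_norm_leD:
  fixes R :: "real \<Rightarrow> real \<Rightarrow> 'e::euclidean_space"
  assumes "incO T \<gamma> {()} (\<lambda>_. R)" "0 \<le> s" "s < t" "t \<le> T"
  shows "norm (R s t) \<le> hoelder2_norm T \<gamma> R * (t - s) powr \<gamma>" "0 \<le> hoelder2_norm T \<gamma> R"
proof -
  have "(\<lambda>(s, t). norm (R s t) / (t - s) powr \<gamma>) (s, t) \<le> hoelder2_norm T \<gamma> R"
    unfolding hoelder2_norm_def using assms
    by (intro cSUP_upper iffD2[OF bdd_above_simplex_iff]) (auto simp: time_simplex_def)
  then show 1: "norm (R s t) \<le> hoelder2_norm T \<gamma> R * (t - s) powr \<gamma>"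
    using assms by (simp add: divide_le_eq)
  then show "0 \<le> hoelder2_norm T \<gamma> R"
    using assms by (smt (verit) norm_ge_zero powr_gt_zero zero_le_mult_iff)
qed

text \<open>Increments from time \<open>0\<close> are at most \<open>C * T powr \<gamma>\<close>, so
  one bound at time \<open>0\<close> suffices. For path derivatives of a family it comes from the
  last summand of \<open>ctrl_norm\<close>.\<close>

lemma incO_bounded_paths:
  assumes "incO T \<gamma> I (\<lambda>i s t. \<phi> i t - \<phi> i s)" "\<gamma> \<ge> 0" "\<And>i. i \<in> I \<Longrightarrow> norm (\<phi> i 0) \<le> B" "0 < T"
  shows "incO T 0 I (\<lambda>i s t. \<phi> i s)" "incO T 0 I (\<lambda>i s t. \<phi> i t)"
proof -
  obtain C where C: "C \<ge> 0" "\<And>i s t. \<lbrakk>i \<in> I; 0 \<le> s; s < t; t \<le> T\<rbrakk> \<Longrightarrow> norm (\<phi> i t - \<phi> i s) \<le> C * (t - s) powr \<gamma>"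
    using incOE[OF assms(1)] by metis
  have b: "norm (\<phi> i s) \<le> C * T powr \<gamma> + B" if "i \<in> I" "0 \<le> s" "s \<le> T" for i s
  proof (cases "s = 0")
    case True
    then show ?thesis using assms(3)[OF that(1)] C(1) by (simp add: add_increasing)
  next
    case False
    then have "norm (\<phi> i s - \<phi> i 0) \<le> C * (s - 0) powr \<gamma>" using C(2)[of i 0 s] that by auto
    also have "\<dots> \<le> C * T powr \<gamma>"
      using that C(1) assms(2) by (intro mult_left_mono powr_mono2) auto
    finally show ?thesis
      using assms(3)[OF that(1)] norm_triangle_sub[of "\<phi> i s" "\<phi> i 0"] by linarith
  qed
  show "incO T 0 I (\<lambda>i s t. \<phi> i s)" "incO T 0 I (\<lambda>i s t. \<phi> i t)"
    by (rule incOI[where C = "C * T powr \<gamma> + B"], use b in force)+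
qed

text \<open>The increment splits into \<open>bl (\<phi> t) (\<psi> t - \<psi> s)\<close> and
  \<open>bl (\<phi> t - \<phi> s) (\<psi> s)\<close>, which is why the first factor has to be
  bounded at \<open>t\<close> and the second at \<open>s\<close>.\<close>

lemma incO_bilinear_paths:
  assumes bil: "bounded_bilinear bl"
    and "incO T \<gamma> I (\<lambda>i s t. \<phi> i t - \<phi> i s)" "incO T \<gamma> I (\<lambda>i s t. \<psi> i t - \<psi> i s)"
    and "incO T 0 I (\<lambda>i s t. \<phi> i t)" "incO T 0 I (\<lambda>i s t. \<psi> i s)"
  shows "incO T \<gamma> I (\<lambda>i s t. bl (\<phi> i t) (\<psi> i t) - bl (\<phi> i s) (\<psi> i s))"
proof -
  interpret bounded_bilinear bl by fact
  have "incO T \<gamma> I (\<lambda>i s t. bl (\<phi> i t) (\<psi> i t - \<psi> i s) + bl (\<phi> i t - \<phi> i s) (\<psi> i s))"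
    using incO_bilinear[OF bil assms(4,3)] incO_bilinear[OF bil assms(2,5)] by (intro incO_add) simp_all
  then show ?thesis by (simp add: diff_left diff_right)
qed

section \<open>Sewing\<close>

text \<open>Clipping a partition at \<open>t\<close> produces intervals of length zero; the diagonal
  condition makes them contribute nothing.\<close>

definition almost_additive :: "real \<Rightarrow> real \<Rightarrow> real \<Rightarrow> (real \<Rightarrow> real \<Rightarrow> 'e::euclidean_space) \<Rightarrow> bool" where
  "almost_additive T \<zeta> C \<Xi> \<longleftrightarrow> C \<ge> 0 \<and> (\<forall>u. \<Xi> u u = 0) \<and>
     (\<forall>u r v. 0 \<le> u \<and> u < r \<and> r < v \<and> v \<le> T \<longrightarrow> norm (\<Xi> u v - \<Xi> u r - \<Xi> r v) \<le> C * (v - u) powr \<zeta>)"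

lemma almost_additiveD:
  assumes "almost_additive T \<zeta> C \<Xi>" "0 \<le> u" "u \<le> r" "r \<le> v" "v \<le> T"
  shows "norm (\<Xi> u v - \<Xi> u r - \<Xi> r v) \<le> C * (v - u) powr \<zeta>"
proof (cases "u = r \<or> r = v")
  case True
  with assms show ?thesis unfolding almost_additive_def by auto
next
  case False
  with assms show ?thesis unfolding almost_additive_def by auto
qed

text \<open>The constant of the sewing bound, the solution \<open>K\<close> of \<open>K = 2 K 2\<^sup>-\<^sup>\<zeta> + 2 C\<close>.\<close>

definition sewing_const :: "real \<Rightarrow> real \<Rightarrow> real" where
  "sewing_const \<zeta> C = 2 * C / (1 - 2 powr (1 - \<zeta>))"

lemma sewing_const:
  assumes "\<zeta> > 1" "C \<ge> 0"
  shows "sewing_const \<zeta> C \<ge> 0" "2 * sewing_const \<zeta> C * (1/2) powr \<zeta> + 2 * C = sewing_const \<zeta> C"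
proof -
  have *: "(2::real) powr (1 - \<zeta>) < 1"
    using assms(1) by (metis powr_less_one less_minus_iff diff_less_0_iff_less one_less_numeral_iff semiring_norm(76))
  then show "sewing_const \<zeta> C \<ge> 0"
    using assms unfolding sewing_const_def by auto
  have "(1/2::real) powr \<zeta> = 2 powr (1 - \<zeta>) / 2"
    by (simp add: powr_diff powr_divide)
  then show "2 * sewing_const \<zeta> C * (1/2) powr \<zeta> + 2 * C = sewing_const \<zeta> C"
    using * unfolding sewing_const_def by (simp only:) (use assms in \<open>simp add: divide_simps; simp add: algebra_simps\<close>)
qed

lemma sum_lessThan_add:
  "(\<Sum>j<m + n. f j) = (\<Sum>j<m. f j) + (\<Sum>j<n. f (m + j))" for f :: "nat \<Rightarrow> 'a::comm_monoid_add"
  by (induction n) (simp_all add: add.assoc)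

text \<open>Splitting at the subinterval that contains the midpoint leaves two pieces of at most half the
  length, so that the constant of the induction hypothesis is reproduced.\<close>

lemma sewing_bound:
  assumes aa: "almost_additive T \<zeta> C \<Xi>" and "\<zeta> > 1"
  shows "\<lbrakk>\<forall>i<n. p i \<le> p (Suc i); 0 \<le> p 0; p n \<le> T\<rbrakk> \<Longrightarrow>
    norm ((\<Sum>i<n. \<Xi> (p i) (p (Suc i))) - \<Xi> (p 0) (p n)) \<le> sewing_const \<zeta> C * (p n - p 0) powr \<zeta>"
proof (induction n arbitrary: p rule: less_induct)
  case (less n)
  define K where "K = sewing_const \<zeta> C"
  have C: "C \<ge> 0" using aa unfolding almost_additive_def by simp
  have K: "K \<ge> 0" "2 * K * (1/2) powr \<zeta> + 2 * C = K"
    using sewing_const[OF assms(2) C] unfolding K_def by auto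
  have mono: "p i \<le> p j" if "i \<le> j" "j \<le> n" for i j
    using that(1)
  proof (rule inc_induct)
    fix k assume "i \<le> k" "k < j" "p (Suc k) \<le> p j"
    then show "p k \<le> p j" using less.prems(1) that(2) by (meson order_less_le_trans order_trans)
  qed simp
  show ?case
  proof (cases "n = 0")
    case True
    then show ?thesis using aa unfolding almost_additive_def by simp
  next
    case False
    define m where "m = (p 0 + p n) / 2"
    define l where "l = p n - p 0"
    have l: "l \<ge> 0" using mono[of 0 n] unfolding l_def by simp
    have m0: "p 0 \<le> m" "m \<le> p n" using l unfolding m_def l_def by auto
    define i where "i = Max {j. j < n \<and> p j \<le> m}"
    have fin: "finite {j. j < n \<and> p j \<le> m}" "{j. j < n \<and> p j \<le> m} \<noteq> {}"
      using False m0 by auto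
    have i: "i < n" "p i \<le> m" using Max_in[OF fin] unfolding i_def by auto
    have i1: "m \<le> p (Suc i)"
    proof (cases "Suc i < n")
      case True
      then show ?thesis
        using Max_ge[OF fin(1), of "Suc i"] unfolding i_def[symmetric] by force
    next
      case False
      then have "Suc i = n" using i(1) by simp
      then show ?thesis using m0 by simp
    qed
    have half: "K * x powr \<zeta> \<le> K * ((1/2) powr \<zeta> * l powr \<zeta>)" if "0 \<le> x" "x \<le> l / 2" for x
    proof -
      have "x powr \<zeta> \<le> (1 / 2 * l) powr \<zeta>" using that assms(2) by (intro powr_mono2) auto
      also have "\<dots> = (1/2) powr \<zeta> * l powr \<zeta>" by (rule powr_mult)
      finally show ?thesis using K(1) by (intro mult_left_mono)
    qed
    define A where "A = (\<Sum>j<i. \<Xi> (p j) (p (Suc j)))"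
    define B where "B = (\<Sum>j<n - Suc i. \<Xi> (p (Suc i + j)) (p (Suc i + Suc j)))"
    have A: "norm (A - \<Xi> (p 0) (p i)) \<le> K * ((1/2) powr \<zeta> * l powr \<zeta>)"
    proof -
      have "norm (A - \<Xi> (p 0) (p i)) \<le> K * (p i - p 0) powr \<zeta>"
        unfolding A_def K_def using less.prems i mono[of i n] by (intro less.IH) auto
      also have "\<dots> \<le> K * ((1/2) powr \<zeta> * l powr \<zeta>)"
        using mono[of 0 i] i unfolding m_def l_def by (intro half[unfolded l_def]) (auto simp: field_simps)
      finally show ?thesis .
    qed
    have B: "norm (B - \<Xi> (p (Suc i)) (p n)) \<le> K * ((1/2) powr \<zeta> * l powr \<zeta>)"
    proof -
      \<comment> \<open>The endpoints stay in the form \<open>Suc i + _\<close> to match the shifted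
        sequence to which the induction hypothesis is applied.\<close>
      have "norm (B - \<Xi> (p (Suc i + 0)) (p (Suc i + (n - Suc i)))) \<le> K * (p (Suc i + (n - Suc i)) - p (Suc i + 0)) powr \<zeta>"
        unfolding B_def K_def using less.prems i mono[of 0 "Suc i"]
        by (intro less.IH[where p = "\<lambda>j. p (Suc i + j)"]) auto
      also have "p (Suc i + (n - Suc i)) = p n" using i by simp
      also have "K * (p n - p (Suc i + 0)) powr \<zeta> \<le> K * ((1/2) powr \<zeta> * l powr \<zeta>)"
        using mono[of "Suc i" n] i i1 unfolding m_def l_def by (intro half[unfolded l_def]) (auto simp: field_simps)
      finally show ?thesis by simp
    qed
    have split: "(\<Sum>i<n. \<Xi> (p i) (p (Suc i))) = A + \<Xi> (p i) (p (Suc i)) + B"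
    proof -
      have "n = Suc i + (n - Suc i)" using i by simp
      then have "(\<Sum>i<n. \<Xi> (p i) (p (Suc i))) = (\<Sum>j<Suc i + (n - Suc i). \<Xi> (p j) (p (Suc j)))" by simp
      also have "\<dots> = (\<Sum>j<Suc i. \<Xi> (p j) (p (Suc j))) + B"
        unfolding B_def sum_lessThan_add by simp
      finally show ?thesis unfolding A_def by simp
    qed
    \<comment> \<open>Two defects remain: inserting \<open>p i\<close> into the whole interval and
      then \<open>p (Suc i)\<close> into the right part. Each is at most
      \<open>C * l powr \<zeta>\<close>, whence the summand \<open>2 * C\<close> in the equation for
      \<open>K\<close>.\<close>
    have e1: "norm (\<Xi> (p 0) (p n) - \<Xi> (p 0) (p i) - \<Xi> (p i) (p n)) \<le> C * l powr \<zeta>"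
      unfolding l_def using less.prems i mono[of 0 i] mono[of i n] by (intro almost_additiveD[OF aa]) auto
    have e2: "norm (\<Xi> (p i) (p n) - \<Xi> (p i) (p (Suc i)) - \<Xi> (p (Suc i)) (p n)) \<le> C * l powr \<zeta>"
    proof -
      have "norm (\<Xi> (p i) (p n) - \<Xi> (p i) (p (Suc i)) - \<Xi> (p (Suc i)) (p n)) \<le> C * (p n - p i) powr \<zeta>"
        using less.prems i mono[of 0 i] mono[of i "Suc i"] mono[of "Suc i" n] by (intro almost_additiveD[OF aa]) auto
      also have "\<dots> \<le> C * l powr \<zeta>"
        unfolding l_def using mono[of 0 i] mono[of i n] i C assms(2) by (intro mult_left_mono powr_mono2) auto
      finally show ?thesis .
    qed
    have "(\<Sum>i<n. \<Xi> (p i) (p (Suc i))) - \<Xi> (p 0) (p n) =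
        (A - \<Xi> (p 0) (p i)) + (B - \<Xi> (p (Suc i)) (p n))
        - (\<Xi> (p 0) (p n) - \<Xi> (p 0) (p i) - \<Xi> (p i) (p n))
        - (\<Xi> (p i) (p n) - \<Xi> (p i) (p (Suc i)) - \<Xi> (p (Suc i)) (p n))"
      unfolding split by simp
    also have "norm \<dots> \<le> K * ((1/2) powr \<zeta> * l powr \<zeta>) + K * ((1/2) powr \<zeta> * l powr \<zeta>) + C * l powr \<zeta> + C * l powr \<zeta>"
      by (intro norm_triangle_le_diff norm_triangle_le add_mono A B e1 e2)
    also have "\<dots> = (2 * K * (1/2) powr \<zeta> + 2 * C) * l powr \<zeta>" by (simp add: algebra_simps)
    finally show ?thesis unfolding K(2) unfolding K_def l_def .
  qed
qed

section \<open>Mesh limits and local expansions\<close>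

lemma is_partition_mono:
  assumes "is_partition T n p" "i \<le> j" "j \<le> n"
  shows "p i \<le> p j"
  using assms(2)
proof (rule inc_induct)
  fix k assume "i \<le> k" "k < j" "p (Suc k) \<le> p j"
  then show "p k \<le> p j" using assms(1,3) unfolding is_partition_def by (meson less_eq_real_def order_less_le_trans order_trans)
qed simp

lemma is_partition_range:
  assumes "is_partition T n p" "i \<le> n"
  shows "0 \<le> p i" "p i \<le> T"
  using is_partition_mono[OF assms(1), of 0 i] is_partition_mono[OF assms(1), of i n] assms
  unfolding is_partition_def by auto

text \<open>The clipped increments of \<open>\<phi>\<close> telescope to
  \<open>\<phi> t - \<phi> 0\<close>, and an interval shorter than \<delta> contributes an error of
  at most \<open>K * \<delta> powr (\<zeta> - 1)\<close> times its length.\<close>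

lemma local_imp_mesh_limit:
  fixes \<Xi> :: "real \<Rightarrow> real \<Rightarrow> 'e::euclidean_space"
  assumes loc: "\<And>s t. \<lbrakk>0 \<le> s; s < t; t \<le> T\<rbrakk> \<Longrightarrow> norm (\<phi> t - \<phi> s - \<Xi> s t) \<le> K * (t - s) powr \<zeta>"
    and diag: "\<And>u. \<Xi> u u = 0" and "\<zeta> > 1" "K \<ge> 0" "T > 0" and t: "t \<in> {0..T}"
  shows "has_mesh_limit T \<Xi> t (\<phi> t - \<phi> 0)"
  unfolding has_mesh_limit_def
proof (intro allI impI)
  fix \<epsilon> :: real assume \<epsilon>: "\<epsilon> > 0"
  \<comment> \<open>Solves \<open>\<delta> powr (\<zeta> - 1) = \<epsilon> / (K * T + 1)\<close>;
    the added \<open>1\<close> keeps the quotient defined for \<open>K = 0\<close> and the final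
    inequality strict.\<close>
  define \<delta> where "\<delta> = (\<epsilon> / (K * T + 1)) powr (1 / (\<zeta> - 1))"
  have KT: "K * T + 1 > 0" using assms by (simp add: add_nonneg_pos)
  have \<delta>: "\<delta> > 0" "\<delta> powr (\<zeta> - 1) = \<epsilon> / (K * T + 1)"
    using \<epsilon> KT assms(3) unfolding \<delta>_def by (auto simp: powr_powr)
  show "\<exists>\<delta>>0. \<forall>n p. is_partition T n p \<and> (\<forall>i<n. p (Suc i) - p i < \<delta>) \<longrightarrow>
        norm ((\<Sum>i<n. \<Xi> (min (p i) t) (min (p (Suc i)) t)) - (\<phi> t - \<phi> 0)) < \<epsilon>"
  proof (intro exI[of _ \<delta>] conjI \<delta>(1) allI impI, elim conjE)
    fix n p assume p: "is_partition T n p" and mesh: "\<forall>i<n. p (Suc i) - p i < \<delta>"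
    have step: "norm (\<Xi> (min (p i) t) (min (p (Suc i)) t) - (\<phi> (min (p (Suc i)) t) - \<phi> (min (p i) t)))
      \<le> K * \<delta> powr (\<zeta> - 1) * (p (Suc i) - p i)" if i: "i < n" for i
    proof -
      define x y where "x = min (p i) t" "y = min (p (Suc i)) t"
      have pp: "p i < p (Suc i)" "0 \<le> p i" "p (Suc i) \<le> T"
        using p i is_partition_range[OF p] unfolding is_partition_def by auto
      show ?thesis
      proof (cases "x < y")
        case True
        have xy: "0 \<le> x" "y \<le> T" "y - x \<le> p (Suc i) - p i"
          using pp t unfolding x_y_def by (auto simp: min_def)
        have "norm (\<Xi> x y - (\<phi> y - \<phi> x)) \<le> K * (y - x) powr \<zeta>"
          using loc[OF xy(1) True xy(2)] by (simp add: norm_minus_commute)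
        also have "\<dots> = K * ((y - x) powr (\<zeta> - 1) * (y - x))"
          using True by (simp add: powr_diff)
        also have "\<dots> \<le> K * (\<delta> powr (\<zeta> - 1) * (p (Suc i) - p i))"
          using True xy assms(3,4) mesh[rule_format, OF i] by (intro mult_left_mono mult_mono powr_mono2) auto
        finally show ?thesis unfolding x_y_def by (simp add: mult.assoc)
      next
        case False
        then have "x = y" using pp unfolding x_y_def by (auto simp: min_def split: if_splits)
        then show ?thesis unfolding x_y_def[symmetric] using diag pp assms(4) by simp
      qed
    qed
    have tel: "(\<Sum>i<n. \<phi> (min (p (Suc i)) t) - \<phi> (min (p i) t)) = \<phi> t - \<phi> 0"
      using sum_lessThan_telescope[of "\<lambda>i. \<phi> (min (p i) t)" n] p t unfolding is_partition_def
      by (simp add: min_absorb1 min_absorb2)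
    have "norm ((\<Sum>i<n. \<Xi> (min (p i) t) (min (p (Suc i)) t)) - (\<phi> t - \<phi> 0))
       \<le> (\<Sum>i<n. K * \<delta> powr (\<zeta> - 1) * (p (Suc i) - p i))"
      unfolding tel[symmetric] sum_subtractf[symmetric] by (rule sum_norm_le) (use step in auto)
    also have "\<dots> = K * T * (\<epsilon> / (K * T + 1))"
      unfolding sum_distrib_left[symmetric] sum_lessThan_telescope \<delta>(2)
      using p unfolding is_partition_def by simp
    also have "\<dots> < \<epsilon>" using \<epsilon> KT by (simp add: field_simps)
    finally show "norm ((\<Sum>i<n. \<Xi> (min (p i) t) (min (p (Suc i)) t)) - (\<phi> t - \<phi> 0)) < \<epsilon>" .
  qed
qed

text \<open>The sums clipped at \<open>t\<close> and at \<open>s\<close> differ by the sum over the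
  partition clamped to \<open>[s, t]\<close>, except on an interval that straddles \<open>s\<close>,
  where one defect occurs. The bound adds the defect estimates of all intervals, which still vanish
  with the mesh as \<zeta> > 1.\<close>

lemma clipped_sums:
  assumes aa: "almost_additive T \<zeta> C \<Xi>" and "\<zeta> > 1" and p: "is_partition T n p"
    and st: "0 \<le> s" "s \<le> t" "t \<le> T"
  shows "norm ((\<Sum>i<n. \<Xi> (min (p i) t) (min (p (Suc i)) t)) - (\<Sum>i<n. \<Xi> (min (p i) s) (min (p (Suc i)) s)) - \<Xi> s t)
    \<le> sewing_const \<zeta> C * (t - s) powr \<zeta> + (\<Sum>i<n. C * (p (Suc i) - p i) powr \<zeta>)"
proof -
  define q where "q = (\<lambda>i. max s (min (p i) t))"
  have diag: "\<And>u. \<Xi> u u = 0" and C: "C \<ge> 0" using aa unfolding almost_additive_def by auto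
  have q: "q 0 = s" "q n = t" "\<forall>i<n. q i \<le> q (Suc i)"
  proof -
    have p': "p 0 = 0" "p n = T" "\<And>i. i < n \<Longrightarrow> p i \<le> p (Suc i)"
      using p unfolding is_partition_def by (auto simp: less_imp_le)
    show "q 0 = s" "q n = t" using p'(1,2) st unfolding q_def by auto
    show "\<forall>i<n. q i \<le> q (Suc i)"
      using p'(3) unfolding q_def by (intro allI impI max.mono min.mono) auto
  qed
  have main: "norm ((\<Sum>i<n. \<Xi> (q i) (q (Suc i))) - \<Xi> s t) \<le> sewing_const \<zeta> C * (t - s) powr \<zeta>"
    using sewing_bound[OF aa assms(2), of n q] q st by simp
  have step: "norm (\<Xi> (min (p i) t) (min (p (Suc i)) t) - \<Xi> (min (p i) s) (min (p (Suc i)) s) - \<Xi> (q i) (q (Suc i)))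
      \<le> C * (p (Suc i) - p i) powr \<zeta>" if i: "i < n" for i
  proof -
    have pp: "p i < p (Suc i)" "0 \<le> p i" "p (Suc i) \<le> T"
      using p i is_partition_range[OF p] unfolding is_partition_def by auto
    \<comment> \<open>Right of \<open>s\<close> and left of \<open>s\<close> the three terms cancel
      exactly; only the straddling interval uses almost additivity.\<close>
    consider "s \<le> p i" | "p (Suc i) \<le> s" | "p i < s" "s < p (Suc i)" by linarith
    then show ?thesis
    proof cases
      case 1
      then have "min (p i) s = s" "min (p (Suc i)) s = s" "q i = min (p i) t" "q (Suc i) = min (p (Suc i)) t"
        using pp st unfolding q_def by (auto simp: min_def)
      then show ?thesis using diag C by simp
    next
      case 2
      then have "min (p i) t = p i" "min (p (Suc i)) t = p (Suc i)" "min (p i) s = p i" "min (p (Suc i)) s = p (Suc i)"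
        "q i = s" "q (Suc i) = s"
        using pp st unfolding q_def by (auto simp: min_def)
      then show ?thesis using diag C by simp
    next
      case 3
      then have eq: "min (p i) t = p i" "min (p i) s = p i" "min (p (Suc i)) s = s" "q i = s" "q (Suc i) = min (p (Suc i)) t"
        using pp st unfolding q_def by (auto simp: min_def)
      have "norm (\<Xi> (p i) (min (p (Suc i)) t) - \<Xi> (p i) s - \<Xi> s (min (p (Suc i)) t)) \<le> C * (min (p (Suc i)) t - p i) powr \<zeta>"
        using 3 pp st by (intro almost_additiveD[OF aa]) auto
      also have "\<dots> \<le> C * (p (Suc i) - p i) powr \<zeta>"
        using 3 pp st C assms(2) by (intro mult_left_mono powr_mono2) auto
      finally show ?thesis unfolding eq .
    qed
  qed
  have "norm (\<Sum>i<n. \<Xi> (min (p i) t) (min (p (Suc i)) t) - \<Xi> (min (p i) s) (min (p (Suc i)) s) - \<Xi> (q i) (q (Suc i)))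
     \<le> (\<Sum>i<n. C * (p (Suc i) - p i) powr \<zeta>)"
    by (rule sum_norm_le) (use step in auto)
  from norm_triangle_mono[OF this main] show ?thesis
    unfolding sum_subtractf by (simp add: algebra_simps)
qed

text \<open>Equidistant partitions serve twice: every mesh limit is the limit along them, and those
  with \<open>2 ^ N\<close> intervals are refined by halving, which constructs a limit in the first
  place.\<close>

definition uniform_sum :: "real \<Rightarrow> (real \<Rightarrow> real \<Rightarrow> 'e::euclidean_space) \<Rightarrow> real \<Rightarrow> nat \<Rightarrow> 'e" where
  "uniform_sum T \<Xi> t n = (\<Sum>i<n. \<Xi> (min (real i * T / real n) t) (min (real (Suc i) * T / real n) t))"

lemma uniform_partition:
  assumes "n > 0" "T > 0"
  shows "is_partition T n (\<lambda>i. real i * T / real n)"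
  using assms unfolding is_partition_def by (auto simp: divide_strict_right_mono)

text \<open>The defect estimates of \<open>n\<close> intervals of length \<open>T / n\<close> add up
  to \<open>n * C * (T / n) powr \<zeta>\<close>, hence the factor
  \<open>real n powr (1 - \<zeta>)\<close>.\<close>

lemma uniform_sum_local:
  assumes aa: "almost_additive T \<zeta> C \<Xi>" and "\<zeta> > 1" and "T > 0" "n > 0"
    and st: "0 \<le> s" "s \<le> t" "t \<le> T"
  shows "norm (uniform_sum T \<Xi> t n - uniform_sum T \<Xi> s n - \<Xi> s t)
    \<le> sewing_const \<zeta> C * (t - s) powr \<zeta> + C * T powr \<zeta> * real n powr (1 - \<zeta>)"
proof -
  have "(\<Sum>i<n. C * (real (Suc i) * T / real n - real i * T / real n) powr \<zeta>) = (\<Sum>i<n. C * (T / real n) powr \<zeta>)"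
    by (intro sum.cong refl arg_cong2[where f = "(*)"] arg_cong2[where f = "(powr)"])
      (auto simp: field_simps)
  also have "\<dots> = C * T powr \<zeta> * real n powr (1 - \<zeta>)"
    using assms(3,4) by (simp add: powr_divide powr_diff)
  finally show ?thesis
    using clipped_sums[OF aa assms(2) uniform_partition[OF assms(4,3)] st] unfolding uniform_sum_def by simp
qed

lemma vanishing_mesh_error:
  assumes "\<zeta> > 1"
  shows "(\<lambda>n. A + c * real n powr (1 - \<zeta>)) \<longlonglongrightarrow> (A::real)"
proof -
  have "(\<lambda>n. real n powr (1 - \<zeta>)) \<longlonglongrightarrow> 0"
    using assms by (intro tendsto_neg_powr filterlim_real_sequentially) auto
  then have "(\<lambda>n. A + c * real n powr (1 - \<zeta>)) \<longlonglongrightarrow> A + c * 0" by (intro tendsto_intros)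
  then show ?thesis by simp
qed

lemma mesh_limit_imp_uniform_sum:
  assumes "has_mesh_limit T \<Xi> t I" "T > 0"
  shows "uniform_sum T \<Xi> t \<longlonglongrightarrow> I"
proof (rule LIMSEQ_I)
  fix \<epsilon> :: real assume "\<epsilon> > 0"
  then obtain \<delta> where \<delta>: "\<delta> > 0" "\<And>n p. \<lbrakk>is_partition T n p; \<forall>i<n. p (Suc i) - p i < \<delta>\<rbrakk> \<Longrightarrow>
        norm ((\<Sum>i<n. \<Xi> (min (p i) t) (min (p (Suc i)) t)) - I) < \<epsilon>"
    using assms(1) unfolding has_mesh_limit_def by meson
  obtain N :: nat where N: "T / \<delta> < real N" using reals_Archimedean2 by blast
  have "norm (uniform_sum T \<Xi> t n - I) < \<epsilon>" if "n \<ge> Suc N" for n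
  proof -
    have n: "n > 0" "T / \<delta> < real n" using that N by auto
    have "real (Suc i) * T / real n - real i * T / real n = T / real n" for i
      using n by (simp add: field_simps)
    moreover have "T / real n < \<delta>"
      using n \<delta>(1) by (simp add: field_simps)
    ultimately show ?thesis
      unfolding uniform_sum_def using uniform_partition[OF n(1) assms(2)] by (intro \<delta>(2)) auto
  qed
  then show "\<exists>no. \<forall>n\<ge>no. norm (uniform_sum T \<Xi> t n - I) < \<epsilon>" by blast
qed

text \<open>The bound for equidistant sums passes to the limit. Its constant involves only \<zeta>
  and \<open>C\<close>, so a family of germs with a common \<open>C\<close> has a common error
  bound.\<close>

lemma mesh_limit_imp_local:
  assumes aa: "almost_additive T \<zeta> C \<Xi>" and "\<zeta> > 1" and "T > 0"
    and st: "0 \<le> s" "s \<le> t" "t \<le> T"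
    and lim: "has_mesh_limit T \<Xi> s I" "has_mesh_limit T \<Xi> t J"
  shows "norm (J - I - \<Xi> s t) \<le> sewing_const \<zeta> C * (t - s) powr \<zeta>"
proof (rule LIMSEQ_le)
  show "(\<lambda>n. norm (uniform_sum T \<Xi> t n - uniform_sum T \<Xi> s n - \<Xi> s t)) \<longlonglongrightarrow> norm (J - I - \<Xi> s t)"
    using mesh_limit_imp_uniform_sum lim assms(3) by (intro tendsto_intros) auto
  show "(\<lambda>n. sewing_const \<zeta> C * (t - s) powr \<zeta> + C * T powr \<zeta> * real n powr (1 - \<zeta>))
      \<longlonglongrightarrow> sewing_const \<zeta> C * (t - s) powr \<zeta>"
    by (rule vanishing_mesh_error[OF assms(2)])
  show "\<exists>N. \<forall>n\<ge>N. norm (uniform_sum T \<Xi> t n - uniform_sum T \<Xi> s n - \<Xi> s t)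
      \<le> sewing_const \<zeta> C * (t - s) powr \<zeta> + C * T powr \<zeta> * real n powr (1 - \<zeta>)"
    using uniform_sum_local[OF aa assms(2,3) _ st] by (intro exI[of _ 1]) auto
qed

lemma sum_lessThan_double:
  "(\<Sum>j<2 * n. f j) = (\<Sum>i<n. f (2 * i) + f (Suc (2 * i)))" for f :: "nat \<Rightarrow> 'a::comm_monoid_add"
  by (induction n) (simp_all add: add.assoc)

text \<open>Halving every interval changes the sum by \<open>2 ^ N\<close> defects of size
  \<open>C * (T / 2 ^ N) powr \<zeta>\<close>, which form a geometric series in \<open>N\<close>.
  The limit inherits the local bound.\<close>

lemma sewing_exists:
  assumes aa: "almost_additive T \<zeta> C \<Xi>" and "\<zeta> > 1" and "T > 0"
  obtains \<phi> where "\<And>s t. \<lbrakk>0 \<le> s; s < t; t \<le> T\<rbrakk> \<Longrightarrow> norm (\<phi> t - \<phi> s - \<Xi> s t) \<le> sewing_const \<zeta> C * (t - s) powr \<zeta>"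
proof -
  define S where "S = (\<lambda>t N. uniform_sum T \<Xi> t (2 ^ N))"
  have C: "C \<ge> 0" using aa unfolding almost_additive_def by simp
  \<comment> \<open>The ratio of that series: doubling \<open>n\<close> multiplies
    \<open>n powr (1 - \<zeta>)\<close> by \<open>q\<close>.\<close>
  define q where "q = 2 powr (1 - \<zeta>)"
  have q: "0 \<le> q" "q < 1"
    using assms(2) unfolding q_def
    by (auto, metis powr_less_one less_minus_iff diff_less_0_iff_less one_less_numeral_iff semiring_norm(76))
  have qN: "real (2 ^ N) powr (1 - \<zeta>) = q ^ N" for N
    unfolding q_def by (simp add: powr_realpow[symmetric] powr_powr mult.commute powr_power)
  have step: "norm (S t (Suc N) - S t N) \<le> C * T powr \<zeta> * q ^ N" if t: "t \<in> {0..T}" for t N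
  proof -
    define n where "n = (2::nat) ^ N"
    have n: "n > 0" unfolding n_def by simp
    define x y z where "x = (\<lambda>i. min (real i * T / real n) t)"
      "y = (\<lambda>i. min (real (2 * i + 1) * T / real (2 * n)) t)"
      "z = (\<lambda>i. min (real (Suc i) * T / real n) t)"
    have e: "real (2 * i) * T / real (2 * n) = real i * T / real n"
      "real (Suc (Suc (2 * i))) * T / real (2 * n) = real (Suc i) * T / real n" for i
      using n by (auto simp: field_simps)
    have 1: "S t (Suc N) = (\<Sum>i<n. \<Xi> (x i) (y i) + \<Xi> (y i) (z i))"
      unfolding S_def uniform_sum_def power_Suc n_def[symmetric] sum_lessThan_double e x_y_z_def by simp
    have 2: "S t N = (\<Sum>i<n. \<Xi> (x i) (z i))"
      unfolding S_def uniform_sum_def n_def[symmetric] x_y_z_def by simp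
    have "norm (\<Xi> (x i) (y i) + \<Xi> (y i) (z i) - \<Xi> (x i) (z i)) \<le> C * (T / real n) powr \<zeta>" for i
    proof -
      have o: "real i * T / real n \<le> real (2 * i + 1) * T / real (2 * n)"
        "real (2 * i + 1) * T / real (2 * n) \<le> real (Suc i) * T / real n"
        using n assms(3) by (auto simp: field_simps)
      have d: "real (Suc i) * T / real n - real i * T / real n = T / real n"
        using n by (simp add: field_simps)
      have x0: "0 \<le> real i * T / real n" using assms(3) by simp
      have xyz: "0 \<le> x i" "x i \<le> y i" "y i \<le> z i" "z i \<le> T" "z i - x i \<le> T / real n"
        using o d x0 t unfolding x_y_z_def by (auto simp: min_def)
      have "norm (\<Xi> (x i) (z i) - \<Xi> (x i) (y i) - \<Xi> (y i) (z i)) \<le> C * (z i - x i) powr \<zeta>"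
        by (rule almost_additiveD[OF aa xyz(1-4)])
      also have "\<dots> \<le> C * (T / real n) powr \<zeta>"
        using xyz C assms(2) by (intro mult_left_mono powr_mono2) auto
      finally show ?thesis
        by (metis (no_types, lifting) diff_diff_eq norm_minus_commute)
    qed
    then have "norm (S t (Suc N) - S t N) \<le> (\<Sum>i<n. C * (T / real n) powr \<zeta>)"
      unfolding 1 2 sum_subtractf[symmetric] by (intro sum_norm_le)
    also have "\<dots> = C * T powr \<zeta> * real n powr (1 - \<zeta>)"
      using assms(3) n by (simp add: powr_divide powr_diff)
    finally show ?thesis unfolding n_def qN .
  qed
  have conv: "convergent (S t)" if t: "t \<in> {0..T}" for t
  proof -
    have "summable (\<lambda>N. C * T powr \<zeta> * q ^ N)"
      using q by (intro summable_mult summable_geometric) simp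
    then have "summable (\<lambda>N. S t (Suc N) - S t N)"
      by (rule summable_comparison_test') (use step[OF t] in simp)
    then have "convergent (\<lambda>N. S t 0 + (\<Sum>i<N. S t (Suc i) - S t i))"
      by (intro convergent_add convergent_const) (simp add: summable_iff_convergent)
    then show ?thesis unfolding sum_lessThan_telescope by simp
  qed
  define \<phi> where "\<phi> = (\<lambda>t. lim (S t))"
  have lim: "S t \<longlonglongrightarrow> \<phi> t" if "t \<in> {0..T}" for t
    using conv[OF that] unfolding \<phi>_def by (simp add: convergent_LIMSEQ_iff)
  show thesis
  proof (rule that)
    fix s t assume st: "0 \<le> s" "s < t" "t \<le> T"
    show "norm (\<phi> t - \<phi> s - \<Xi> s t) \<le> sewing_const \<zeta> C * (t - s) powr \<zeta>"
    proof (rule LIMSEQ_le)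
      show "(\<lambda>N. norm (S t N - S s N - \<Xi> s t)) \<longlonglongrightarrow> norm (\<phi> t - \<phi> s - \<Xi> s t)"
        using st by (intro tendsto_intros lim) auto
      have "(\<lambda>N. sewing_const \<zeta> C * (t - s) powr \<zeta> + C * T powr \<zeta> * q ^ N)
        \<longlonglongrightarrow> sewing_const \<zeta> C * (t - s) powr \<zeta> + C * T powr \<zeta> * 0"
        using q by (intro tendsto_intros LIMSEQ_power_zero) auto
      then show "(\<lambda>N. sewing_const \<zeta> C * (t - s) powr \<zeta> + C * T powr \<zeta> * q ^ N)
        \<longlonglongrightarrow> sewing_const \<zeta> C * (t - s) powr \<zeta>" by simp
      show "\<exists>N. \<forall>n\<ge>N. norm (S t n - S s n - \<Xi> s t)
          \<le> sewing_const \<zeta> C * (t - s) powr \<zeta> + C * T powr \<zeta> * q ^ n"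
        using uniform_sum_local[OF aa assms(2,3), of "2 ^ _" s t] st unfolding S_def qN[symmetric] by auto
    qed
  qed
qed

section \<open>Controlled paths\<close>

lemma bounded_bilinear_vdot: "bounded_bilinear (vdot :: 'e::euclidean_space ^ 'd \<Rightarrow> _)"
  unfolding bilinear_conv_bounded_bilinear[symmetric] bilinear_def vdot_def
  by (auto intro!: linearI simp: algebra_simps sum.distrib scaleR_sum_right)

lemma bounded_bilinear_ddot: "bounded_bilinear (ddot :: 'e::euclidean_space ^ 'd ^ 'd \<Rightarrow> _)"
  unfolding bilinear_conv_bounded_bilinear[symmetric] bilinear_def ddot_def
  by (auto intro!: linearI simp: algebra_simps sum.distrib scaleR_sum_right)

lemma bounded_bilinear_outer: "bounded_bilinear (outer :: real ^ 'd \<Rightarrow> _)"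
  unfolding bilinear_conv_bounded_bilinear[symmetric] bilinear_def outer_def
  by (auto intro!: linearI simp: algebra_simps vec_eq_iff)

lemma bounded_linear_transpose: "bounded_linear (transpose :: 'e::euclidean_space ^ 'd ^ 'd \<Rightarrow> _)"
  unfolding linear_conv_bounded_linear[symmetric]
  by (auto intro!: linearI simp: transpose_def vec_eq_iff)

interpretation vdot: bounded_bilinear "vdot :: 'e::euclidean_space ^ 'd \<Rightarrow> _"
  by (rule bounded_bilinear_vdot)
interpretation ddot: bounded_bilinear "ddot :: 'e::euclidean_space ^ 'd ^ 'd \<Rightarrow> _"
  by (rule bounded_bilinear_ddot)
interpretation outer: bounded_bilinear "outer :: real ^ 'd \<Rightarrow> _"
  by (rule bounded_bilinear_outer)

lemmas transpose_add = linear_add[OF bounded_linear.linear[OF bounded_linear_transpose]]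
  and transpose_diff = linear_diff[OF bounded_linear.linear[OF bounded_linear_transpose]]
  and transpose_zero = linear_0[OF bounded_linear.linear[OF bounded_linear_transpose]]

lemma vdot_vec_nth: "vdot c v $ k = vdot (\<chi> p. c $ p $ k) v"
  by (simp add: vdot_def)

lemma linear_vdot: "linear f \<Longrightarrow> f (vdot c v) = vdot (\<chi> p. f (c $ p)) v"
  by (simp add: vdot_def linear_sum linear_scale)

lemma ddot_transpose_transpose: "ddot (transpose A) (transpose B) = ddot A B"
  unfolding ddot_def transpose_def by (subst sum.swap) simp

lemma ddot_outer: "ddot A (outer u v) = vdot (vdot A u) v"
  by (simp add: ddot_def vdot_def outer_def scaleR_sum_right sum_component)
    (subst sum.swap, simp add: mult.commute)

lemma transpose_outer: "transpose (outer u v) = outer v u"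
  by (simp add: transpose_def outer_def vec_eq_iff)

text \<open>\<open>path_deriv\<close> is a choice that is determined on \<open>{0..T}\<close> only,
  so an explicit formula can replace it only through such a congruence.\<close>

lemma has_path_deriv_cong:
  assumes "\<And>t. t \<in> {0..T} \<Longrightarrow> \<theta> t = \<psi> t" "\<And>t. t \<in> {0..T} \<Longrightarrow> \<theta>' t = \<psi>' t" "\<beta> > 0"
  shows "has_path_deriv T \<alpha> \<beta> \<omega> \<theta> \<theta>' \<longleftrightarrow> has_path_deriv T \<alpha> \<beta> \<omega> \<psi> \<psi>'"
proof -
  have eq: "path_remainder \<omega> \<theta> \<theta>' s t = path_remainder \<omega> \<psi> \<psi>' s t" if "(s, t) \<in> time_simplex T" for s t
    using that assms(1,2) unfolding path_remainder_def time_simplex_def by auto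
  have "hoelder2 T \<gamma> (path_remainder \<omega> \<theta> \<theta>') \<longleftrightarrow> hoelder2 T \<gamma> (path_remainder \<omega> \<psi> \<psi>')" for \<gamma>
    unfolding hoelder2_def
    by (intro arg_cong2[where f = "(\<and>)"] continuous_on_cong arg_cong[where f = bdd_above] image_cong)
      (auto simp: eq)
  then show ?thesis
    unfolding has_path_deriv_def using hoelder_cong[OF assms(1,3)] hoelder_cong[OF assms(2,3)] by simp
qed

text \<open>The outer index of \<open>c'\<close> is the direction of differentiation, as in \<open>path_deriv\<close>.\<close>

definition rough_germ ::
  "(real \<Rightarrow> real ^ 'd) \<Rightarrow> (real \<Rightarrow> real \<Rightarrow> real ^ 'd ^ 'd) \<Rightarrow> (real \<Rightarrow> 'e::euclidean_space ^ 'd)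
    \<Rightarrow> (real \<Rightarrow> 'e ^ 'd ^ 'd) \<Rightarrow> real \<Rightarrow> real \<Rightarrow> 'e" where
  "rough_germ \<omega> W c c' s t = vdot (c s) (\<omega> t - \<omega> s) + ddot (transpose (c' s)) (transpose (area W s t))"

definition bracket_germ ::
  "(real \<Rightarrow> real ^ 'd) \<Rightarrow> (real \<Rightarrow> real \<Rightarrow> real ^ 'd ^ 'd) \<Rightarrow> (real \<Rightarrow> 'e::euclidean_space ^ 'd ^ 'd)
    \<Rightarrow> real \<Rightarrow> real \<Rightarrow> 'e" where
  "bracket_germ \<omega> W b s t = ddot (b s) (bracket \<omega> W t - bracket \<omega> W s)"

text \<open>Isolates the rough integral: the limit for the sum of both germs minus the Young
  integral.\<close>

lemma has_mesh_limit_diff: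
  assumes "has_mesh_limit T A t I" "has_mesh_limit T B t J"
  shows "has_mesh_limit T (\<lambda>u v. A u v - B u v) t (I - J)"
  unfolding has_mesh_limit_def
proof (intro allI impI)
  fix \<epsilon> :: real assume "\<epsilon> > 0"
  then have e: "\<epsilon> / 2 > 0" by simp
  obtain \<delta>1 where d1: "\<delta>1 > 0" "\<And>n p. is_partition T n p \<Longrightarrow> \<forall>i<n. p (Suc i) - p i < \<delta>1 \<Longrightarrow>
        norm ((\<Sum>i<n. A (min (p i) t) (min (p (Suc i)) t)) - I) < \<epsilon> / 2"
    using assms(1) e unfolding has_mesh_limit_def by meson
  obtain \<delta>2 where d2: "\<delta>2 > 0" "\<And>n p. is_partition T n p \<Longrightarrow> \<forall>i<n. p (Suc i) - p i < \<delta>2 \<Longrightarrow>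
        norm ((\<Sum>i<n. B (min (p i) t) (min (p (Suc i)) t)) - J) < \<epsilon> / 2"
    using assms(2) e unfolding has_mesh_limit_def by meson
  have pos: "min \<delta>1 \<delta>2 > 0" using d1(1) d2(1) by simp
  show "\<exists>\<delta>>0. \<forall>n p. is_partition T n p \<and> (\<forall>i<n. p (Suc i) - p i < \<delta>) \<longrightarrow>
    norm ((\<Sum>i<n. A (min (p i) t) (min (p (Suc i)) t) - B (min (p i) t) (min (p (Suc i)) t)) - (I - J)) < \<epsilon>"
  proof (intro exI[of _ "min \<delta>1 \<delta>2"] conjI[OF pos] allI impI, elim conjE)
    fix n p assume p: "is_partition T n p" "\<forall>i<n. p (Suc i) - p i < min \<delta>1 \<delta>2"
    define X Y where "X = (\<Sum>i<n. A (min (p i) t) (min (p (Suc i)) t))"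
      "Y = (\<Sum>i<n. B (min (p i) t) (min (p (Suc i)) t))"
    have "norm (X - I) < \<epsilon> / 2" "norm (Y - J) < \<epsilon> / 2"
      unfolding X_Y_def using d1(2)[OF p(1)] d2(2)[OF p(1)] p(2) by auto
    then have "norm ((X - I) - (Y - J)) < \<epsilon>"
      using norm_triangle_ineq4[of "X - I" "Y - J"] by linarith
    then show "norm ((\<Sum>i<n. A (min (p i) t) (min (p (Suc i)) t) - B (min (p i) t) (min (p (Suc i)) t)) - (I - J)) < \<epsilon>"
      unfolding sum_subtractf X_Y_def by (simp add: algebra_simps)
  qed
qed

section \<open>Calculus of path derivatives for a fixed rough path\<close>

locale rough_setup =
  fixes T \<alpha> \<beta> :: real and \<omega> :: "real \<Rightarrow> real ^ 'd" and W :: "real \<Rightarrow> real \<Rightarrow> real ^ 'd ^ 'd"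
  assumes T_pos: "T > 0" and exponents: "1/3 < \<alpha>" "\<alpha> < 1/2" "1 - 2 * \<alpha> < \<beta>" "\<beta> \<le> \<alpha>"
    and rp: "rough_path0 T \<alpha> \<omega> W" and uniq: "unique_path_deriv T \<alpha> \<beta> \<omega>"
begin

lemma exponents': "\<alpha> > 0" "\<beta> > 0" "2 * \<alpha> + \<beta> > 1" "\<alpha> + \<beta> \<le> 2 * \<alpha>" "\<beta> \<le> \<alpha> + \<beta>" "\<alpha> \<le> \<alpha> + \<beta>"
  using exponents by auto

text \<open>The path does not depend on the index; an arbitrary index set lets the bound be
  multiplied with that of any family.\<close>

lemma omega_O: "incO T \<alpha> I (\<lambda>_ s t. \<omega> t - \<omega> s)"
proof -
  have "incO T \<alpha> {()} (\<lambda>_ s t. \<omega> t - \<omega> s)"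
    using rp hoelder_iff[OF exponents'(1)] unfolding rough_path0_def by blast
  then show ?thesis unfolding incO_def by auto
qed

lemma omega_continuous: "continuous_on {0..T} \<omega>"
  using rp unfolding rough_path0_def hoelder_def by simp

lemma area_O: "incO T (2 * \<alpha>) I (\<lambda>_ s t. area W s t)"
proof -
  have "incO T (2 * \<alpha>) {()} (\<lambda>_. W)"
    using rp unfolding rough_path0_def hoelder2_iff by blast
  then show ?thesis unfolding incO_def area_def by auto
qed

text \<open>Since \<open>area\<close> vanishes on the diagonal, Chen's relation extends to
  degenerate intervals, where a factor of the outer product is zero.\<close>

lemma area_chen:
  assumes "0 \<le> s" "s \<le> r" "r \<le> t" "t \<le> T"
  shows "area W s t = area W s r + area W r t + outer (\<omega> r - \<omega> s) (\<omega> t - \<omega> r)"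
proof (cases "s < r \<and> r < t")
  case True
  then have "W s t - W s r - W r t = outer (\<omega> r - \<omega> s) (\<omega> t - \<omega> r)"
    using rp assms unfolding rough_path0_def by blast
  then show ?thesis using True by (simp add: area_def algebra_simps)
next
  case False
  then show ?thesis using assms by (auto simp: area_def outer.zero_left outer.zero_right)
qed

text \<open>Expanding \<open>\<omega> t - \<omega> 0\<close> at \<open>s\<close> gives two cross
  products; Chen's relation for \<open>area W 0 t\<close> and its transpose removes exactly
  these.\<close>

lemma bracket_increment:
  assumes "0 \<le> s" "s \<le> t" "t \<le> T"
  shows "bracket \<omega> W t - bracket \<omega> W s =
    outer (\<omega> t - \<omega> s) (\<omega> t - \<omega> s) - area W s t - transpose (area W s t)"
proof -
  have e: "\<omega> t - \<omega> 0 = (\<omega> s - \<omega> 0) + (\<omega> t - \<omega> s)" by simp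
  have "outer (\<omega> t - \<omega> 0) (\<omega> t - \<omega> 0) = outer (\<omega> s - \<omega> 0) (\<omega> s - \<omega> 0) + outer (\<omega> s - \<omega> 0) (\<omega> t - \<omega> s)
      + outer (\<omega> t - \<omega> s) (\<omega> s - \<omega> 0) + outer (\<omega> t - \<omega> s) (\<omega> t - \<omega> s)"
    unfolding e outer.add_left outer.add_right by simp
  then show ?thesis
    unfolding bracket_def area_chen[OF order_refl assms] by (simp add: transpose_add transpose_outer)
qed

text \<open>As \<open>2 * \<alpha> + \<beta> > 1\<close>, this order places integrals of
  \<beta>-Hoelder coefficients against the bracket in Young's regime.\<close>

lemma bracket_O: "incO T (2 * \<alpha>) I (\<lambda>_ s t. bracket \<omega> W t - bracket \<omega> W s)"
proof -
  have "incO T (\<alpha> + \<alpha>) I (\<lambda>_ s t. outer (\<omega> t - \<omega> s) (\<omega> t - \<omega> s))"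
    by (rule incO_bilinear[OF bounded_bilinear_outer omega_O omega_O])
  then have "incO T (2 * \<alpha>) I (\<lambda>_ s t. outer (\<omega> t - \<omega> s) (\<omega> t - \<omega> s) - area W s t - transpose (area W s t))"
    by (intro incO_diff area_O incO_bounded_linear[OF bounded_linear_transpose]) simp
  then show ?thesis
    by (rule iffD2[OF incO_cong, rotated]) (simp add: bracket_increment)
qed

lemma incO_imp_bounded:
  assumes "incO T \<gamma> {()} (\<lambda>_ s t. \<phi> t - \<phi> s)" "\<gamma> \<ge> 0"
  shows "incO T 0 {()} (\<lambda>_ s t. \<phi> s)" "incO T 0 {()} (\<lambda>_ s t. \<phi> t)"
  using incO_bounded_paths[OF assms order_refl T_pos] by auto

text \<open>The term \<open>vdot (\<theta>' s) (\<omega> t - \<omega> s)\<close> has order \<alpha>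
  and the remainder a higher one. This gain over the order \<beta> in \<open>has_path_deriv\<close>
  makes the Taylor errors small enough.\<close>

lemma controlled_increment_O:
  assumes "incO T (\<alpha> + \<beta>) I (\<lambda>i s t. path_remainder \<omega> (\<theta> i) (\<theta>' i) s t)"
    and "incO T 0 I (\<lambda>i s t. \<theta>' i s)"
  shows "incO T \<alpha> I (\<lambda>i s t. \<theta> i t - \<theta> i s)"
proof -
  have "incO T \<alpha> I (\<lambda>i s t. path_remainder \<omega> (\<theta> i) (\<theta>' i) s t + vdot (\<theta>' i s) (\<omega> t - \<omega> s))"
    using incO_mono[OF assms(1) exponents'(6) T_pos]
    by (intro incO_add incO_bounded_mult[OF bounded_bilinear_vdot assms(2) omega_O])
  then show ?thesis by (simp add: path_remainder_def)
qed

text \<open>Boundedness of \<open>\<theta>'\<close> turns the remainder bound into a Hoelder bound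
  for \<open>\<theta>\<close>, and the remainder is a continuous combination of continuous paths.
  Path derivatives can thus be verified by counting orders.\<close>

lemma has_path_deriv_iff:
  "has_path_deriv T \<alpha> \<beta> \<omega> \<theta> \<theta>' \<longleftrightarrow>
    incO T \<beta> {()} (\<lambda>_ s t. \<theta>' t - \<theta>' s) \<and> incO T (\<alpha> + \<beta>) {()} (\<lambda>_ s t. path_remainder \<omega> \<theta> \<theta>' s t)"
    (is "?L \<longleftrightarrow> ?A \<and> ?B")
proof
  assume ?L
  then show "?A \<and> ?B"
    unfolding has_path_deriv_def hoelder2_iff using hoelder_iff[OF exponents'(2), of T \<theta>'] by simp
next
  assume ab: "?A \<and> ?B"
  have "incO T \<alpha> {()} (\<lambda>_ s t. \<theta> t - \<theta> s)"
    using ab incO_imp_bounded(1)[of \<beta> \<theta>'] exponents'(2)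
    by (intro controlled_increment_O[where \<theta>' = "\<lambda>_. \<theta>'"]) auto
  then have th: "hoelder T \<beta> \<theta>"
    using incO_mono[OF _ exponents(4) T_pos] hoelder_iff[OF exponents'(2)] by blast
  have th': "hoelder T \<beta> \<theta>'" using ab hoelder_iff[OF exponents'(2)] by blast
  have c: "continuous_on (time_simplex T) (\<lambda>x. \<phi> (fst x))" "continuous_on (time_simplex T) (\<lambda>x. \<phi> (snd x))"
    if "continuous_on {0..T} \<phi>" for \<phi> :: "real \<Rightarrow> 'x::euclidean_space"
    by (rule continuous_on_compose2[OF that]; auto simp: time_simplex_def intro!: continuous_intros)+
  have "continuous_on (time_simplex T) (\<lambda>(s, t). path_remainder \<omega> \<theta> \<theta>' s t)"
    unfolding path_remainder_def split_beta
    using th th' omega_continuous unfolding hoelder_def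
    by (intro continuous_intros c bounded_bilinear.continuous_on[OF bounded_bilinear_vdot]) auto
  then show ?L
    unfolding has_path_deriv_def hoelder2_iff using th th' ab by simp
qed

lemma has_path_deriv_increment_O:
  assumes "has_path_deriv T \<alpha> \<beta> \<omega> \<theta> \<theta>'"
  shows "incO T \<alpha> {()} (\<lambda>_ s t. \<theta> t - \<theta> s)"
  using assms incO_imp_bounded(1)[of \<beta> \<theta>'] exponents'(2) unfolding has_path_deriv_iff
  by (intro controlled_increment_O[where \<theta>' = "\<lambda>_. \<theta>'"]) auto

lemma has_path_deriv_linear:
  assumes "has_path_deriv T \<alpha> \<beta> \<omega> \<theta> \<theta>'" and f: "bounded_linear f"
  shows "has_path_deriv T \<alpha> \<beta> \<omega> (\<lambda>t. f (\<theta> t)) (\<lambda>t. \<chi> p. f (\<theta>' t $ p))"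
proof -
  interpret f: bounded_linear f by fact
  have a: "incO T \<beta> {()} (\<lambda>_ s t. \<theta>' t - \<theta>' s)" "incO T (\<alpha> + \<beta>) {()} (\<lambda>_ s t. path_remainder \<omega> \<theta> \<theta>' s t)"
    using assms(1) unfolding has_path_deriv_iff by auto
  have "path_remainder \<omega> (\<lambda>t. f (\<theta> t)) (\<lambda>t. \<chi> p. f (\<theta>' t $ p)) = (\<lambda>s t. f (path_remainder \<omega> \<theta> \<theta>' s t))"
    unfolding path_remainder_def by (intro ext) (simp add: f.diff linear_vdot[OF f.linear_axioms])
  moreover have "incO T \<beta> {()} (\<lambda>_ s t. f (\<theta>' t $ p) - f (\<theta>' s $ p))" for p
    using incO_bounded_linear[OF f] a(1)[unfolded incO_vec] by (fastforce simp: f.diff[symmetric])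
  ultimately show ?thesis
    unfolding has_path_deriv_iff using incO_bounded_linear[OF f a(2)] by (simp add: incO_vec)
qed

text \<open>Pairing with a fixed vector \<open>b\<close> reduces the claim to real-valued paths, for
  which uniqueness is assumed.\<close>

lemma has_path_deriv_unique:
  assumes "has_path_deriv T \<alpha> \<beta> \<omega> \<theta> \<theta>'" "has_path_deriv T \<alpha> \<beta> \<omega> \<theta> \<theta>''" "t \<in> {0..T}"
  shows "\<theta>' t = \<theta>'' t"
proof -
  have "(\<chi> p. \<theta>' t $ p \<bullet> b) = (\<chi> p. \<theta>'' t $ p \<bullet> b)" for b
    using uniq has_path_deriv_linear[OF assms(1) bounded_linear_inner_left[of b]]
      has_path_deriv_linear[OF assms(2) bounded_linear_inner_left[of b]] assms(3)
    unfolding unique_path_deriv_def by blast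
  then have "\<theta>' t $ p \<bullet> b = \<theta>'' t $ p \<bullet> b" for p b
    by (simp add: vec_eq_iff)
  then show ?thesis
    by (simp add: vec_eq_iff euclidean_eq_iff[where 'a = 'a])
qed

lemma path_deriv_eq:
  assumes "has_path_deriv T \<alpha> \<beta> \<omega> \<theta> \<theta>'" "t \<in> {0..T}"
  shows "path_deriv T \<alpha> \<beta> \<omega> \<theta> t = \<theta>' t"
proof -
  have "has_path_deriv T \<alpha> \<beta> \<omega> \<theta> (path_deriv T \<alpha> \<beta> \<omega> \<theta>)"
    unfolding path_deriv_def using someI_ex[of "has_path_deriv T \<alpha> \<beta> \<omega> \<theta>"] assms(1) by blast
  then show ?thesis using has_path_deriv_unique assms by blast
qed

lemma C1_path_iff:
  "C1_path T \<alpha> \<beta> \<omega> \<theta> \<longleftrightarrow> has_path_deriv T \<alpha> \<beta> \<omega> \<theta> (path_deriv T \<alpha> \<beta> \<omega> \<theta>)"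
  unfolding C1_path_def path_deriv_def using someI_ex[of "has_path_deriv T \<alpha> \<beta> \<omega> \<theta>"] by blast

lemma path_remainder_diff:
  "path_remainder \<omega> (\<lambda>t. \<theta> t - \<psi> t) (\<lambda>t. \<theta>' t - \<psi>' t) s t
    = path_remainder \<omega> \<theta> \<theta>' s t - path_remainder \<omega> \<psi> \<psi>' s t"
  unfolding path_remainder_def by (simp add: vdot.diff_left)

lemma path_remainder_add:
  "path_remainder \<omega> (\<lambda>t. \<theta> t + \<psi> t) (\<lambda>t. \<theta>' t + \<psi>' t) s t
    = path_remainder \<omega> \<theta> \<theta>' s t + path_remainder \<omega> \<psi> \<psi>' s t"
  unfolding path_remainder_def by (simp add: vdot.add_left)

lemma has_path_deriv_diff:
  assumes "has_path_deriv T \<alpha> \<beta> \<omega> \<theta> \<theta>'" "has_path_deriv T \<alpha> \<beta> \<omega> \<psi> \<psi>'"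
  shows "has_path_deriv T \<alpha> \<beta> \<omega> (\<lambda>t. \<theta> t - \<psi> t) (\<lambda>t. \<theta>' t - \<psi>' t)"
proof -
  note a = assms(1)[unfolded has_path_deriv_iff, THEN conjunct1] assms(1)[unfolded has_path_deriv_iff, THEN conjunct2]
  note b = assms(2)[unfolded has_path_deriv_iff, THEN conjunct1] assms(2)[unfolded has_path_deriv_iff, THEN conjunct2]
  have e: "\<theta>' t - \<psi>' t - (\<theta>' s - \<psi>' s) = \<theta>' t - \<theta>' s - (\<psi>' t - \<psi>' s)" for s t by simp
  show ?thesis
    using incO_diff[OF a(1) b(1)] incO_diff[OF a(2) b(2)]
    unfolding has_path_deriv_iff path_remainder_diff e by simp
qed

lemma has_path_deriv_add:
  assumes "has_path_deriv T \<alpha> \<beta> \<omega> \<theta> \<theta>'" "has_path_deriv T \<alpha> \<beta> \<omega> \<psi> \<psi>'"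
  shows "has_path_deriv T \<alpha> \<beta> \<omega> (\<lambda>t. \<theta> t + \<psi> t) (\<lambda>t. \<theta>' t + \<psi>' t)"
proof -
  note a = assms(1)[unfolded has_path_deriv_iff, THEN conjunct1] assms(1)[unfolded has_path_deriv_iff, THEN conjunct2]
  note b = assms(2)[unfolded has_path_deriv_iff, THEN conjunct1] assms(2)[unfolded has_path_deriv_iff, THEN conjunct2]
  have e: "\<theta>' t + \<psi>' t - (\<theta>' s + \<psi>' s) = \<theta>' t - \<theta>' s + (\<psi>' t - \<psi>' s)" for s t by simp
  show ?thesis
    using incO_add[OF a(1) b(1)] incO_add[OF a(2) b(2)]
    unfolding has_path_deriv_iff path_remainder_add e by simp
qed

text \<open>Apart from the two given remainders times bounded factors, the remainder contains only a
  product of two increments, of order \<open>2 * \<alpha>\<close>, which is at least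
  \<open>\<alpha> + \<beta>\<close>.\<close>

lemma has_path_deriv_bilinear:
  assumes u: "has_path_deriv T \<alpha> \<beta> \<omega> u u'" and f: "has_path_deriv T \<alpha> \<beta> \<omega> f f'"
    and bil: "bounded_bilinear bl"
  shows "has_path_deriv T \<alpha> \<beta> \<omega> (\<lambda>t. bl (u t) (f t)) (\<lambda>t. \<chi> p. bl (u' t $ p) (f t) + bl (u t) (f' t $ p))"
    (is "has_path_deriv T \<alpha> \<beta> \<omega> ?F ?F'")
proof -
  interpret bl: bounded_bilinear bl by fact
  have au: "incO T \<beta> {()} (\<lambda>_ s t. u' t - u' s)" "incO T (\<alpha> + \<beta>) {()} (\<lambda>_ s t. path_remainder \<omega> u u' s t)"
    using u unfolding has_path_deriv_iff by auto
  have af: "incO T \<beta> {()} (\<lambda>_ s t. f' t - f' s)" "incO T (\<alpha> + \<beta>) {()} (\<lambda>_ s t. path_remainder \<omega> f f' s t)"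
    using f unfolding has_path_deriv_iff by auto
  note u0 = has_path_deriv_increment_O[OF u] and f0 = has_path_deriv_increment_O[OF f]
  note ub = incO_imp_bounded[OF u0 less_imp_le[OF exponents'(1)]]
  note fb = incO_imp_bounded[OF f0 less_imp_le[OF exponents'(1)]]
  note u'b = incO_imp_bounded[OF au(1) less_imp_le[OF exponents'(2)]]
  note f'b = incO_imp_bounded[OF af(1) less_imp_le[OF exponents'(2)]]
  have "incO T \<beta> {()} (\<lambda>_ s t. (bl (u' t $ p) (f t) - bl (u' s $ p) (f s)) + (bl (u t) (f' t $ p) - bl (u s) (f' s $ p)))" for p
    using au(1) af(1) u'b f'b incO_mono[OF u0 exponents(4) T_pos] incO_mono[OF f0 exponents(4) T_pos] ub fb
    unfolding incO_vec
    by (intro incO_add incO_bilinear_paths[OF bil]) (auto)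
  then have 1: "incO T \<beta> {()} (\<lambda>_ s t. ?F' t - ?F' s)"
    unfolding incO_vec by (simp add: algebra_simps)
  have "path_remainder \<omega> ?F ?F' s t = bl (path_remainder \<omega> u u' s t) (f s) + bl (u s) (path_remainder \<omega> f f' s t)
      + bl (u t - u s) (f t - f s)" for s t
  proof -
    have "vdot (?F' s) x = bl (vdot (u' s) x) (f s) + bl (u s) (vdot (f' s) x)" for x
      by (simp add: vdot_def bl.sum_left bl.sum_right bl.scaleR_left bl.scaleR_right scaleR_add_right sum.distrib)
    then show ?thesis
      by (simp add: path_remainder_def bl.diff_left bl.diff_right)
  qed
  moreover have "incO T (\<alpha> + \<beta>) {()} (\<lambda>_ s t. bl (path_remainder \<omega> u u' s t) (f s))"
    using incO_bilinear[OF bil au(2) fb(1)] by simp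
  moreover have "incO T (\<alpha> + \<beta>) {()} (\<lambda>_ s t. bl (u s) (path_remainder \<omega> f f' s t))"
    using incO_bilinear[OF bil ub(1) af(2)] by simp
  moreover have "incO T (\<alpha> + \<beta>) {()} (\<lambda>_ s t. bl (u t - u s) (f t - f s))"
    using incO_mono[OF incO_bilinear[OF bil u0 f0] _ T_pos] exponents by simp
  ultimately have 2: "incO T (\<alpha> + \<beta>) {()} (\<lambda>_ s t. path_remainder \<omega> ?F ?F' s t)"
    by (simp only:) (intro incO_add)
  show ?thesis unfolding has_path_deriv_iff using 1 2 by blast
qed

lemma has_path_deriv_vec:
  fixes \<theta> :: "real \<Rightarrow> 'e::euclidean_space ^ 'k"
  assumes "\<And>k. has_path_deriv T \<alpha> \<beta> \<omega> (\<lambda>t. \<theta> t $ k) (\<theta>' k)"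
  shows "has_path_deriv T \<alpha> \<beta> \<omega> \<theta> (\<lambda>t. \<chi> p k. \<theta>' k t $ p)"
proof -
  have "path_remainder \<omega> \<theta> (\<lambda>t. \<chi> p k. \<theta>' k t $ p) s t $ k = path_remainder \<omega> (\<lambda>t. \<theta> t $ k) (\<theta>' k) s t" for s t k
    by (simp add: path_remainder_def vdot_def)
  moreover have "incO T \<beta> {()} (\<lambda>_ s t. \<theta>' k t $ p - \<theta>' k s $ p)" for k p
    using assms[of k] unfolding has_path_deriv_iff incO_vec by simp
  ultimately show ?thesis
    using assms unfolding has_path_deriv_iff by (simp add: incO_vec)
qed

section \<open>Rough differentials as local expansions\<close>

text \<open>By Chen's relation the defect reduces to the remainder of \<open>c i\<close> against an
  increment of \<omega> and an increment of \<open>c' i\<close> against the area, both of order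
  \<open>2 * \<alpha> + \<beta>\<close>.\<close>

lemma rough_germ_almost_additive:
  assumes R: "incO T (\<alpha> + \<beta>) I (\<lambda>i s t. path_remainder \<omega> (c i) (c' i) s t)"
    and c': "incO T \<beta> I (\<lambda>i s t. c' i t - c' i s)"
  shows "\<exists>C. \<forall>i\<in>I. almost_additive T (2 * \<alpha> + \<beta>) C (rough_germ \<omega> W (c i) (c' i))"
proof -
  have tr: "incO T \<beta> I (\<lambda>i s t. transpose (c' i t) - transpose (c' i s))"
    using incO_bounded_linear[OF bounded_linear_transpose c'] by (simp add: transpose_diff)
  have Wt: "incO T (2 * \<alpha>) I (\<lambda>i s t. transpose (area W s t))"
    by (rule incO_bounded_linear[OF bounded_linear_transpose area_O])
  obtain C where C: "C \<ge> 0" "\<And>i u r v. \<lbrakk>i \<in> I; 0 \<le> u; u < r; r < v; v \<le> T\<rbrakk> \<Longrightarrow>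
      norm (vdot (path_remainder \<omega> (c i) (c' i) u r) (\<omega> v - \<omega> r)) \<le> C * (v - u) powr (\<alpha> + \<beta> + \<alpha>)"
    using incO_mult_increments[OF bounded_bilinear_vdot R omega_O] exponents' by (auto intro: add_nonneg_nonneg)
  obtain D where D: "D \<ge> 0" "\<And>i u r v. \<lbrakk>i \<in> I; 0 \<le> u; u < r; r < v; v \<le> T\<rbrakk> \<Longrightarrow>
      norm (ddot (transpose (c' i r) - transpose (c' i u)) (transpose (area W r v))) \<le> D * (v - u) powr (\<beta> + 2 * \<alpha>)"
    using incO_mult_increments[OF bounded_bilinear_ddot tr Wt] exponents' by auto
  have "norm (rough_germ \<omega> W (c i) (c' i) u v - rough_germ \<omega> W (c i) (c' i) u r - rough_germ \<omega> W (c i) (c' i) r v)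
      \<le> (C + D) * (v - u) powr (2 * \<alpha> + \<beta>)"
    if a: "i \<in> I" "0 \<le> u" "u < r" "r < v" "v \<le> T" for i u r v
  proof -
    have e: "vdot (c i u) (\<omega> v - \<omega> u) = vdot (c i u) (\<omega> r - \<omega> u) + vdot (c i u) (\<omega> v - \<omega> r)"
      by (simp flip: vdot.add_right)
    have ch: "area W u v = area W u r + area W r v + outer (\<omega> r - \<omega> u) (\<omega> v - \<omega> r)"
      using a by (intro area_chen) auto
    \<comment> \<open>The cross term of Chen's relation becomes the first-order part of
      \<open>c i r - c i u\<close> paired with \<open>\<omega> v - \<omega> r\<close>, and turns
      that increment into a remainder. This is where the transpositions in the germ matter.\<close>
    have x: "ddot (transpose (c' i u)) (transpose (outer (\<omega> r - \<omega> u) (\<omega> v - \<omega> r)))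
        = vdot (vdot (c' i u) (\<omega> r - \<omega> u)) (\<omega> v - \<omega> r)"
      by (simp add: ddot_transpose_transpose ddot_outer)
    have "rough_germ \<omega> W (c i) (c' i) u v - rough_germ \<omega> W (c i) (c' i) u r - rough_germ \<omega> W (c i) (c' i) r v
      = - vdot (path_remainder \<omega> (c i) (c' i) u r) (\<omega> v - \<omega> r)
        - ddot (transpose (c' i r) - transpose (c' i u)) (transpose (area W r v))"
      unfolding rough_germ_def path_remainder_def e ch transpose_add ddot.add_right x vdot.diff_left ddot.diff_left
      by (simp add: algebra_simps)
    also have "norm \<dots> \<le> C * (v - u) powr (\<alpha> + \<beta> + \<alpha>) + D * (v - u) powr (\<beta> + 2 * \<alpha>)"
      using C(2)[OF a] D(2)[OF a] by (intro norm_triangle_le_diff add_mono) auto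
    also have "\<dots> = (C + D) * (v - u) powr (2 * \<alpha> + \<beta>)"
      by (simp add: algebra_simps)
    finally show ?thesis .
  qed
  moreover have "rough_germ \<omega> W (c i) (c' i) u u = 0" for i u
    unfolding rough_germ_def area_def by (simp add: vdot.zero_right ddot.zero_right transpose_zero)
  ultimately show ?thesis
    using C(1) D(1) unfolding almost_additive_def by (intro exI[of _ "C + D"]) auto
qed

text \<open>Bracket increments are additive, so the defect sees only the increments of
  \<open>b i\<close>.\<close>

lemma bracket_germ_almost_additive:
  assumes b: "incO T \<beta> I (\<lambda>i s t. b i t - b i s)"
  shows "\<exists>C. \<forall>i\<in>I. almost_additive T (2 * \<alpha> + \<beta>) C (bracket_germ \<omega> W (b i))"
proof -
  obtain D where D: "D \<ge> 0" "\<And>i u r v. \<lbrakk>i \<in> I; 0 \<le> u; u < r; r < v; v \<le> T\<rbrakk> \<Longrightarrow>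
      norm (ddot (b i r - b i u) (bracket \<omega> W v - bracket \<omega> W r)) \<le> D * (v - u) powr (\<beta> + 2 * \<alpha>)"
    using incO_mult_increments[OF bounded_bilinear_ddot b bracket_O] exponents' by auto
  have "norm (bracket_germ \<omega> W (b i) u v - bracket_germ \<omega> W (b i) u r - bracket_germ \<omega> W (b i) r v)
      \<le> D * (v - u) powr (2 * \<alpha> + \<beta>)"
    if a: "i \<in> I" "0 \<le> u" "u < r" "r < v" "v \<le> T" for i u r v
  proof -
    have "bracket_germ \<omega> W (b i) u v - bracket_germ \<omega> W (b i) u r - bracket_germ \<omega> W (b i) r v
      = - ddot (b i r - b i u) (bracket \<omega> W v - bracket \<omega> W r)"
      unfolding bracket_germ_def by (simp add: ddot.diff_left ddot.diff_right)
    then show ?thesis using D(2)[OF a] by (simp add: add.commute)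
  qed
  moreover have "bracket_germ \<omega> W (b i) u u = 0" for i u
    unfolding bracket_germ_def by (simp add: ddot.zero_right)
  ultimately show ?thesis
    using D(1) unfolding almost_additive_def by (intro exI[of _ D]) auto
qed

text \<open>Both integrals obey the sewing bound separately, with constants common to the family;
  adding the two local bounds expands \<open>\<phi> i\<close>.\<close>

lemma rough_differential_expansion:
  assumes rd: "\<And>i. i \<in> I \<Longrightarrow> rough_differential T \<alpha> \<beta> \<omega> W (\<phi> i) (c i) (b i)"
    and R: "incO T (\<alpha> + \<beta>) I (\<lambda>i s t. path_remainder \<omega> (c i) (path_deriv T \<alpha> \<beta> \<omega> (c i)) s t)"
    and c': "incO T \<beta> I (\<lambda>i s t. path_deriv T \<alpha> \<beta> \<omega> (c i) t - path_deriv T \<alpha> \<beta> \<omega> (c i) s)"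
    and b: "incO T \<beta> I (\<lambda>i s t. b i t - b i s)"
  shows "incO T (2 * \<alpha> + \<beta>) I (\<lambda>i s t. \<phi> i t - \<phi> i s
    - rough_germ \<omega> W (c i) (path_deriv T \<alpha> \<beta> \<omega> (c i)) s t - bracket_germ \<omega> W (b i) s t)"
proof -
  let ?A = "\<lambda>i. rough_germ \<omega> W (c i) (path_deriv T \<alpha> \<beta> \<omega> (c i))" and ?B = "\<lambda>i. bracket_germ \<omega> W (b i)"
  obtain C where C: "\<And>i. i \<in> I \<Longrightarrow> almost_additive T (2 * \<alpha> + \<beta>) C (?A i)"
    using rough_germ_almost_additive[OF R c'] by blast
  obtain D where D: "\<And>i. i \<in> I \<Longrightarrow> almost_additive T (2 * \<alpha> + \<beta>) D (?B i)"
    using bracket_germ_almost_additive[OF b] by blast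
  show ?thesis
  proof (rule incOI)
    fix i s t assume a: "i \<in> I" "0 \<le> s" "s < t" "t \<le> T"
    have "\<exists>I J. has_mesh_limit T (?A i) r I \<and> has_mesh_limit T (?B i) r J \<and> \<phi> i r - \<phi> i 0 = I + J"
      if "r \<in> {0..T}" for r
      using rd[OF a(1)] that
      unfolding rough_differential_def has_rough_integral_def has_bracket_integral_def path_deriv_mat_def
        rough_germ_def bracket_germ_def by blast
    then obtain X Y where XY: "\<And>r. r \<in> {0..T} \<Longrightarrow> has_mesh_limit T (?A i) r (X r) \<and>
        has_mesh_limit T (?B i) r (Y r) \<and> \<phi> i r - \<phi> i 0 = X r + Y r" by metis
    have 1: "norm (X t - X s - ?A i s t) \<le> sewing_const (2 * \<alpha> + \<beta>) C * (t - s) powr (2 * \<alpha> + \<beta>)"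
      using XY[of s] XY[of t] a by (intro mesh_limit_imp_local[OF C[OF a(1)] exponents'(3) T_pos]) auto
    have 2: "norm (Y t - Y s - ?B i s t) \<le> sewing_const (2 * \<alpha> + \<beta>) D * (t - s) powr (2 * \<alpha> + \<beta>)"
      using XY[of s] XY[of t] a by (intro mesh_limit_imp_local[OF D[OF a(1)] exponents'(3) T_pos]) auto
    have "\<phi> i t - \<phi> i s = (\<phi> i t - \<phi> i 0) - (\<phi> i s - \<phi> i 0)" by simp
    also have "\<dots> = X t + Y t - (X s + Y s)" using XY[of s] XY[of t] a by simp
    finally have split: "\<phi> i t - \<phi> i s - ?A i s t - ?B i s t = (X t - X s - ?A i s t) + (Y t - Y s - ?B i s t)"
      by simp
    show "norm (\<phi> i t - \<phi> i s - ?A i s t - ?B i s t)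
        \<le> (sewing_const (2 * \<alpha> + \<beta>) C + sewing_const (2 * \<alpha> + \<beta>) D) * (t - s) powr (2 * \<alpha> + \<beta>)"
      unfolding split distrib_right by (rule norm_triangle_mono[OF 1 2])
  qed
qed

text \<open>The expansion controls only the sum of the two germs. Sewing supplies the Young integral
  on its own, and the rough integral is what remains of \<open>\<phi>\<close>.\<close>

lemma rough_differentialI:
  assumes c: "has_path_deriv T \<alpha> \<beta> \<omega> c c'" and b: "incO T \<beta> {()} (\<lambda>_ s t. b t - b s)"
    and ex: "incO T (2 * \<alpha> + \<beta>) {()} (\<lambda>_ s t. \<phi> t - \<phi> s - rough_germ \<omega> W c c' s t - bracket_germ \<omega> W b s t)"
  shows "rough_differential T \<alpha> \<beta> \<omega> W \<phi> c b"
proof -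
  let ?A = "rough_germ \<omega> W c (path_deriv T \<alpha> \<beta> \<omega> c)" and ?B = "bracket_germ \<omega> W b"
  have C1: "C1_path T \<alpha> \<beta> \<omega> c" using c unfolding C1_path_def by blast
  have "incO T (2 * \<alpha> + \<beta>) {()} (\<lambda>_ s t. \<phi> t - \<phi> s - (?A s t + ?B s t))"
    using ex by (rule iffD2[OF incO_cong, rotated]) (simp add: rough_germ_def path_deriv_eq[OF c])
  then obtain K where K: "K \<ge> 0"
    "\<And>s t. \<lbrakk>0 \<le> s; s < t; t \<le> T\<rbrakk> \<Longrightarrow> norm (\<phi> t - \<phi> s - (?A s t + ?B s t)) \<le> K * (t - s) powr (2 * \<alpha> + \<beta>)"
    by (rule incOE) blast
  obtain D where D: "almost_additive T (2 * \<alpha> + \<beta>) D ?B"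
    using bracket_germ_almost_additive[of "{()}" "\<lambda>_. b"] b by blast
  have D0: "D \<ge> 0" using D unfolding almost_additive_def by simp
  obtain \<psi> where \<psi>: "\<And>s t. \<lbrakk>0 \<le> s; s < t; t \<le> T\<rbrakk> \<Longrightarrow>
      norm (\<psi> t - \<psi> s - ?B s t) \<le> sewing_const (2 * \<alpha> + \<beta>) D * (t - s) powr (2 * \<alpha> + \<beta>)"
    by (rule sewing_exists[OF D exponents'(3) T_pos]) blast
  have zero: "?A u u = 0" "?B u u = 0" for u
    unfolding rough_germ_def bracket_germ_def area_def
    by (simp_all add: vdot.zero_right ddot.zero_right transpose_zero)
  have "\<exists>I J. has_mesh_limit T ?A t I \<and> has_mesh_limit T ?B t J \<and> \<phi> t - \<phi> 0 = I + J" if t: "t \<in> {0..T}" for t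
  proof -
    have J: "has_mesh_limit T ?B t (\<psi> t - \<psi> 0)"
      by (rule local_imp_mesh_limit[OF \<psi> zero(2) exponents'(3) sewing_const(1)[OF exponents'(3) D0] T_pos t])
    have "has_mesh_limit T (\<lambda>u v. ?A u v + ?B u v) t (\<phi> t - \<phi> 0)"
      by (rule local_imp_mesh_limit[OF K(2) _ exponents'(3) K(1) T_pos t]) (simp_all add: zero)
    from has_mesh_limit_diff[OF this J] have "has_mesh_limit T ?A t (\<phi> t - \<phi> 0 - (\<psi> t - \<psi> 0))" by simp
    with J show ?thesis by (intro exI[of _ "\<phi> t - \<phi> 0 - (\<psi> t - \<psi> 0)"] exI[of _ "\<psi> t - \<psi> 0"]) simp
  qed
  then show ?thesis
    unfolding rough_differential_def has_rough_integral_def has_bracket_integral_def path_deriv_mat_def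
        rough_germ_def bracket_germ_def
    using C1 b hoelder_iff[OF exponents'(2)] by blast
qed

section \<open>Locally uniform estimates\<close>

text \<open>Close to \<open>y\<close> the seminorm of the difference to the path at \<open>y\<close>
  is below \<open>1\<close>, so the constant at \<open>y\<close> grows by at most \<open>1\<close>;
  compactness does the rest.\<close>

lemma hoelder_cont_uniform:
  fixes D :: "real \<Rightarrow> real ^ 'm \<Rightarrow> 'e::euclidean_space"
  assumes h: "\<And>y. hoelder T \<beta> (\<lambda>t. D t y)" and "hoelder_cont T \<beta> D" "compact K"
  shows "incO T \<beta> K (\<lambda>y s t. D t y - D s y)"
proof (rule incO_locally_uniform[OF assms(3)])
  fix y
  have inc: "incO T \<beta> {()} (\<lambda>_ s t. D t z - D s z)" for z
    using h[of z] unfolding hoelder_iff[OF exponents'(2)] .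
  have "\<forall>\<^sub>F z in at y. hoelder_norm T \<beta> (\<lambda>t. D t z - D t y) < 1"
    using assms(2) unfolding hoelder_cont_def by (intro order_tendstoD) auto
  then obtain d where d: "d > 0" "\<And>z. \<lbrakk>z \<noteq> y; dist z y < d\<rbrakk> \<Longrightarrow> hoelder_norm T \<beta> (\<lambda>t. D t z - D t y) < 1"
    unfolding eventually_at by blast
  obtain C where C: "\<And>s t. \<lbrakk>0 \<le> s; s < t; t \<le> T\<rbrakk> \<Longrightarrow> norm (D t y - D s y) \<le> C * (t - s) powr \<beta>"
    by (rule incOE[OF inc[of y]]) blast
  have "norm (D t z - D s z) \<le> (C + 1) * (t - s) powr \<beta>"
    if z: "z \<in> ball y d" and st: "0 \<le> s" "s < t" "t \<le> T" for z s t
  \<comment> \<open>The limit in \<open>hoelder_cont\<close> leaves out the point \<open>y\<close>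
    itself.\<close>
  proof (cases "z = y")
    case True
    then show ?thesis using C[OF st] by (simp add: distrib_right add_increasing2)
  next
    case False
    have "incO T \<beta> {()} (\<lambda>_ s t. (D t z - D t y) - (D s z - D s y))"
      using incO_diff[OF inc[of z] inc[of y]] by (simp add: algebra_simps)
    then have "norm ((D t z - D t y) - (D s z - D s y)) \<le> hoelder_norm T \<beta> (\<lambda>t. D t z - D t y) * (t - s) powr \<beta>"
      using incO_norm_leD(1)[OF _ st] unfolding hoelder_norm_def hoelder2_norm_def by blast
    also have "\<dots> \<le> 1 * (t - s) powr \<beta>"
      using d(2)[OF False] z by (intro mult_right_mono) (auto simp: dist_commute less_imp_le)
    finally have "norm ((D t z - D t y) - (D s z - D s y)) \<le> 1 * (t - s) powr \<beta>" .
    from norm_triangle_mono[OF this C[OF st]] show ?thesis by (simp add: algebra_simps)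
  qed
  then show "\<exists>d>0. incO T \<beta> (ball y d) (\<lambda>y s t. D t y - D s y)"
    using d(1) by (intro exI[of _ d] conjI incOI) auto
qed

text \<open>The summands of the controlled norm are nonnegative, so near \<open>y\<close> each of
  them is small when the norm is. Uniqueness identifies the path derivative of a difference with the
  difference of the path derivatives, which relates the norm to the path at
  \<open>y\<close>.\<close>

lemma ctrl_cont_uniform:
  fixes g :: "real \<Rightarrow> real ^ 'm \<Rightarrow> 'e::euclidean_space"
  assumes C1: "\<And>y. C1_path T \<alpha> \<beta> \<omega> (\<lambda>t. g t y)" and cc: "ctrl_cont T \<alpha> \<beta> \<omega> g" and "compact K"
  shows "incO T (\<alpha> + \<beta>) K (\<lambda>y s t. path_remainder \<omega> (\<lambda>t. g t y) (\<lambda>t. d\<omega> T \<alpha> \<beta> \<omega> g t y) s t)" (is ?A)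
    and "incO T \<beta> K (\<lambda>y s t. d\<omega> T \<alpha> \<beta> \<omega> g t y - d\<omega> T \<alpha> \<beta> \<omega> g s y)" (is ?B)
    and "incO T 0 K (\<lambda>y s t. d\<omega> T \<alpha> \<beta> \<omega> g s y)" (is ?C)
proof -
  let ?g' = "\<lambda>t y. d\<omega> T \<alpha> \<beta> \<omega> g t y"
  let ?R = "\<lambda>y s t. path_remainder \<omega> (\<lambda>t. g t y) (\<lambda>t. ?g' t y) s t"
  have hp: "has_path_deriv T \<alpha> \<beta> \<omega> (\<lambda>t. g t y) (\<lambda>t. ?g' t y)" for y
    using C1 unfolding C1_path_iff d\<omega>_def .
  then have inc: "incO T \<beta> {()} (\<lambda>_ s t. ?g' t y - ?g' s y)" "incO T (\<alpha> + \<beta>) {()} (\<lambda>_. ?R y)" for y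
    unfolding has_path_deriv_iff by auto
  have loc: "\<exists>d>0. incO T (\<alpha> + \<beta>) (ball y d) ?R \<and> incO T \<beta> (ball y d) (\<lambda>y s t. ?g' t y - ?g' s y)
      \<and> incO T 0 (ball y d) (\<lambda>y s t. ?g' s y)" for y
  proof -
    have "\<forall>\<^sub>F z in at y. ctrl_norm T \<alpha> \<beta> \<omega> (\<lambda>t. g t z - g t y) < 1"
      using cc unfolding ctrl_cont_def by (intro order_tendstoD) auto
    then obtain d where d: "d > 0" "\<And>z. \<lbrakk>z \<noteq> y; dist z y < d\<rbrakk> \<Longrightarrow> ctrl_norm T \<alpha> \<beta> \<omega> (\<lambda>t. g t z - g t y) < 1"
      unfolding eventually_at by blast
    obtain C where C: "\<And>s t. \<lbrakk>0 \<le> s; s < t; t \<le> T\<rbrakk> \<Longrightarrow> norm (?g' t y - ?g' s y) \<le> C * (t - s) powr \<beta>"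
      by (rule incOE[OF inc(1)[of y]]) blast
    obtain D where D: "\<And>s t. \<lbrakk>0 \<le> s; s < t; t \<le> T\<rbrakk> \<Longrightarrow> norm (?R y s t) \<le> D * (t - s) powr (\<alpha> + \<beta>)"
      by (rule incOE[OF inc(2)[of y]]) blast
    have *: "norm (?g' t z - ?g' s z) \<le> (C + 1) * (t - s) powr \<beta> \<and> norm (?R z s t) \<le> (D + 1) * (t - s) powr (\<alpha> + \<beta>) \<and>
        norm (?g' 0 z) \<le> norm (?g' 0 y) + 1"
      if z: "z \<in> ball y d" and st: "0 \<le> s" "s < t" "t \<le> T" for z s t
    proof (cases "z = y")
      case True
      then show ?thesis using C[OF st] D[OF st] by (simp add: distrib_right add_increasing2)
    next
      case False
      let ?f = "\<lambda>t. g t z - g t y" and ?f' = "path_deriv T \<alpha> \<beta> \<omega> (\<lambda>t. g t z - g t y)"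
      have hf: "has_path_deriv T \<alpha> \<beta> \<omega> ?f (\<lambda>t. ?g' t z - ?g' t y)"
        by (rule has_path_deriv_diff[OF hp hp])
      then have eq: "?f' t = ?g' t z - ?g' t y" if "t \<in> {0..T}" for t
        using path_deriv_eq that by blast
      have "has_path_deriv T \<alpha> \<beta> \<omega> ?f ?f'"
        using hf unfolding C1_path_iff[symmetric] C1_path_def by blast
      then have incf: "incO T \<beta> {()} (\<lambda>_ s t. ?f' t - ?f' s)" "incO T (\<alpha> + \<beta>) {()} (\<lambda>_. path_remainder \<omega> ?f ?f')"
        unfolding has_path_deriv_iff by auto
      note n1 = incO_norm_leD[OF incf(1) st] and n2 = incO_norm_leD[OF incf(2) st]
      have le: "norm (?f' 0) \<le> 1" "hoelder2_norm T \<beta> (\<lambda>s t. ?f' t - ?f' s) \<le> 1" "hoelder2_norm T (\<alpha> + \<beta>) (path_remainder \<omega> ?f ?f') \<le> 1"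
        using d(2)[OF False] z n1(2) n2(2) unfolding ctrl_norm_def hoelder_norm_def hoelder2_norm_def
        by (auto simp: dist_commute) (smt (verit) norm_ge_zero)+
      have "norm ((?g' t z - ?g' s z) - (?g' t y - ?g' s y)) \<le> 1 * (t - s) powr \<beta>"
        using order_trans[OF n1(1) mult_right_mono[OF le(2)]] eq[of s] eq[of t] st
        by (simp add: algebra_simps)
      from norm_triangle_mono[OF this C[OF st]]
      have 1: "norm (?g' t z - ?g' s z) \<le> (C + 1) * (t - s) powr \<beta>" by (simp add: algebra_simps)
      have "norm (?R z s t - ?R y s t) \<le> 1 * (t - s) powr (\<alpha> + \<beta>)"
        using order_trans[OF n2(1) mult_right_mono[OF le(3)]] eq[of s] st
        unfolding path_remainder_diff[symmetric] by (simp add: path_remainder_def)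
      from norm_triangle_mono[OF this D[OF st]]
      have "norm (?R z s t) \<le> (D + 1) * (t - s) powr (\<alpha> + \<beta>)" by (simp add: algebra_simps)
      moreover have "norm (?g' 0 z - ?g' 0 y) \<le> 1" using le(1) eq[of 0] T_pos by simp
      then have "norm (?g' 0 z) \<le> norm (?g' 0 y) + 1"
        using norm_triangle_sub[of "?g' 0 z" "?g' 0 y"] by linarith
      ultimately show ?thesis using 1 by blast
    qed
    have "incO T (\<alpha> + \<beta>) (ball y d) ?R"
      by (rule incOI[where C = "D + 1"]) (rule *[THEN conjunct2, THEN conjunct1])
    moreover have B: "incO T \<beta> (ball y d) (\<lambda>y s t. ?g' t y - ?g' s y)"
      by (rule incOI[where C = "C + 1"]) (rule *[THEN conjunct1])
    moreover have "incO T 0 (ball y d) (\<lambda>y s t. ?g' s y)"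
      by (rule incO_bounded_paths(1)[OF B less_imp_le[OF exponents'(2)] _ T_pos])
        (rule *[THEN conjunct2, THEN conjunct2, OF _ order_refl T_pos order_refl])
    ultimately show ?thesis using d(1) by blast
  qed
  show ?A by (rule incO_locally_uniform[OF assms(3)]) (use loc in blast)
  show ?B by (rule incO_locally_uniform[OF assms(3)]) (use loc in blast)
  show ?C by (rule incO_locally_uniform[OF assms(3)]) (use loc in blast)
qed

end

section \<open>Derivatives in space\<close>

lemma has_derivative_dy:
  assumes "g t differentiable (at y)"
  shows "(g t has_derivative vdot (dy g t y)) (at y)"
proof -
  let ?D = "frechet_derivative (g t) (at y)"
  have D: "(g t has_derivative ?D) (at y)"
    using assms by (rule iffD1[OF frechet_derivative_works])
  interpret D: linear ?D by (rule linear_frechet_derivative[OF assms])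
  have "?D v = vdot (dy g t y) v" for v
  proof -
    have "v = (\<Sum>k\<in>UNIV. v $ k *\<^sub>R axis k 1)"
      using basis_expansion[of v] by (simp add: scalar_mult_eq_scaleR)
    then have "?D v = (\<Sum>k\<in>UNIV. v $ k *\<^sub>R ?D (axis k 1))"
      by (metis (no_types, lifting) D.scale D.sum sum.cong)
    then show ?thesis by (simp add: vdot_def dy_def)
  qed
  then have "?D = vdot (dy g t y)" by (rule ext)
  with D show ?thesis by simp
qed

lemma vdot_norm_bound:
  obtains B where "B \<ge> 0" "\<And>(c :: 'e::euclidean_space ^ 'd) v. norm (vdot c v) \<le> B * norm c * norm v"
proof -
  obtain B where "B \<ge> 0" "\<And>(c :: 'e ^ 'd) v. norm (vdot c v) \<le> norm c * norm v * B"
    using bounded_bilinear.nonneg_bounded[OF bounded_bilinear_vdot] by metis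
  then show thesis using that[of B] by (simp add: mult_ac)
qed

lemma vdot_axis: "vdot c (axis k 1) = c $ k"
  unfolding vdot_def axis_def by (simp add: if_distrib[of "\<lambda>x. x *\<^sub>R _"] cong: if_cong)

section \<open>Taylor bounds on compact convex sets\<close>

lemma C0_loc_continuous_on_line:
  assumes "C0_loc T F" "t \<in> {0..T}"
  shows "continuous_on A (\<lambda>r. F t (y + r *\<^sub>R e))"
proof -
  have "continuous_on A (\<lambda>r. (t, y + r *\<^sub>R e))"
    by (intro continuous_intros)
  from continuous_on_compose2[OF assms(1)[unfolded C0_loc_def] this] show ?thesis
    using assms(2) by (simp add: image_subset_iff)
qed

lemma C0_loc_bounded:
  assumes "C0_loc T F" "compact K"
  obtains B where "B \<ge> 0" "\<And>t y. \<lbrakk>t \<in> {0..T}; y \<in> K\<rbrakk> \<Longrightarrow> norm (F t y) \<le> B"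
proof -
  have "compact ((\<lambda>(t, y). F t y) ` ({0..T} \<times> K))"
    using assms unfolding C0_loc_def
    by (intro compact_continuous_image compact_Times compact_Icc) (auto elim: continuous_on_subset)
  from compact_imp_bounded[OF this] obtain B where B: "\<forall>x\<in>(\<lambda>(t, y). F t y) ` ({0..T} \<times> K). norm x \<le> B"
    unfolding bounded_iff by blast
  have "norm (F t y) \<le> max B 0" if "t \<in> {0..T}" "y \<in> K" for t y
    using bspec[OF B, of "F t y"] that by (force simp: le_max_iff_disj)
  then show thesis using that[of "max B 0"] by simp
qed

lemma C1_loc_lipschitz:
  fixes F :: "real \<Rightarrow> real ^ 'm \<Rightarrow> 'e::euclidean_space"
  assumes "C1_loc T F" "compact K" "convex K"
  obtains L where "L \<ge> 0" "\<And>t y z. \<lbrakk>t \<in> {0..T}; y \<in> K; z \<in> K\<rbrakk> \<Longrightarrow> norm (F t z - F t y) \<le> L * norm (z - y)"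
proof -
  obtain B where B: "B \<ge> 0" "\<And>t y. \<lbrakk>t \<in> {0..T}; y \<in> K\<rbrakk> \<Longrightarrow> norm (dy F t y) \<le> B"
    using C0_loc_bounded[of T "dy F" K] assms(1,2) unfolding C1_loc_def by metis
  obtain V where V: "V \<ge> 0" "\<And>(c :: 'e ^ 'm) v. norm (vdot c v) \<le> V * norm c * norm v"
    by (rule vdot_norm_bound) (rule that)
  have "norm (F t z - F t y) \<le> (V * B) * norm (z - y)" if a: "t \<in> {0..T}" "y \<in> K" "z \<in> K" for t y z
  proof (rule differentiable_bound[where S = K and f' = "\<lambda>x. vdot (dy F t x)"])
    show "convex K" "z \<in> K" "y \<in> K" using assms(3) a by auto
    fix x assume x: "x \<in> K"
    show "(F t has_derivative (\<lambda>v. vdot (dy F t x) v)) (at x within K)"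
      using assms(1) a(1) unfolding C1_loc_def
      by (intro has_derivative_at_withinI[OF has_derivative_dy]) auto
    have "norm (vdot (dy F t x) v) \<le> (V * B) * norm v" for v
      by (rule order_trans[OF V(2)]) (intro mult_right_mono mult_left_mono B(2)[OF a(1) x] V norm_ge_zero)
    then show "onorm (\<lambda>v. vdot (dy F t x) v) \<le> V * B"
      by (rule onorm_le)
  qed
  then show thesis using that[of "V * B"] B(1) V(1) by simp
qed

text \<open>On the segment the gradient deviates from its value at \<open>y\<close> by at most
  \<open>L * norm (z - y)\<close>; integrating along the segment supplies the second factor.\<close>

lemma C2_loc_taylor1:
  fixes g :: "real \<Rightarrow> real ^ 'm \<Rightarrow> 'e::euclidean_space"
  assumes g: "C2_loc T g" and K: "compact K" "convex K"
  obtains C where "C \<ge> 0"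
    "\<And>t y z. \<lbrakk>t \<in> {0..T}; y \<in> K; z \<in> K\<rbrakk> \<Longrightarrow> norm (g t z - g t y - vdot (dy g t y) (z - y)) \<le> C * norm (z - y) ^ 2"
proof -
  obtain L where L: "L \<ge> 0" "\<And>t y z. \<lbrakk>t \<in> {0..T}; y \<in> K; z \<in> K\<rbrakk> \<Longrightarrow> norm (dy g t z - dy g t y) \<le> L * norm (z - y)"
    using C1_loc_lipschitz[OF _ K, of T "dy g"] g unfolding C2_loc_def by metis
  obtain V where V: "V \<ge> 0" "\<And>(c :: 'e ^ 'm) v. norm (vdot c v) \<le> V * norm c * norm v"
    by (rule vdot_norm_bound) (rule that)
  have "norm (g t z - g t y - vdot (dy g t y) (z - y)) \<le> (V * L) * norm (z - y) ^ 2"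
    if a: "t \<in> {0..T}" "y \<in> K" "z \<in> K" for t y z
  proof -
    have sub: "closed_segment y z \<subseteq> K" using a K(2) by (simp add: closed_segment_subset)
    have "norm (g t z - g t y - vdot (dy g t y) (z - y)) \<le> norm (z - y) * (V * L * norm (z - y))"
    proof (rule differentiable_bound_linearization[where S = "closed_segment y z" and f' = "\<lambda>x. vdot (dy g t x)"])
      show "y + r *\<^sub>R (z - y) \<in> closed_segment y z" if "r \<in> {0..1}" for r
        using that unfolding closed_segment_def by (auto intro!: exI[of _ r] simp: algebra_simps)
      show "(g t has_derivative vdot (dy g t x)) (at x within closed_segment y z)" for x
        using g a(1) unfolding C2_loc_def C1_loc_def
        by (intro has_derivative_at_withinI[OF has_derivative_dy]) auto
      show "y \<in> closed_segment y z" by simp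
      fix x assume x: "x \<in> closed_segment y z"
      have "norm ((vdot (dy g t x) - vdot (dy g t y)) v) \<le> (V * L * norm (z - y)) * norm v" for v
      proof -
        have "norm (vdot (dy g t x - dy g t y) v) \<le> V * norm (dy g t x - dy g t y) * norm v" by (rule V)
        also have "\<dots> \<le> V * (L * norm (z - y)) * norm v"
        proof (intro mult_right_mono mult_left_mono V norm_ge_zero)
          have "norm (dy g t x - dy g t y) \<le> L * norm (x - y)" using L(2) a x sub by blast
          also have "\<dots> \<le> L * norm (z - y)"
            using segment_bound(1)[OF x] L(1) by (intro mult_left_mono) auto
          finally show "norm (dy g t x - dy g t y) \<le> L * norm (z - y)" .
        qed
        finally show ?thesis by (simp add: vdot.diff_left mult.assoc)
      qed
      then show "onorm (vdot (dy g t x) - vdot (dy g t y)) \<le> V * L * norm (z - y)"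
        by (rule onorm_le)
    qed
    then show ?thesis by (simp add: power2_eq_square mult_ac)
  qed
  then show thesis using that[of "V * L"] L(1) V(1) by simp
qed

text \<open>Along the segment the derivative of the Taylor error of \<open>g\<close> is the
  first-order Taylor error of \<open>dy g\<close> applied to the direction, hence cubic in
  \<open>z - y\<close>.\<close>

lemma C3_loc_taylor2:
  fixes g :: "real \<Rightarrow> real ^ 'm \<Rightarrow> 'e::euclidean_space"
  assumes g: "C1_loc T g" "C2_loc T (dy g)" and K: "compact K" "convex K"
  obtains C where "C \<ge> 0"
    "\<And>t y z. \<lbrakk>t \<in> {0..T}; y \<in> K; z \<in> K\<rbrakk> \<Longrightarrow>
      norm (g t z - g t y - vdot (dy g t y) (z - y) - (1/2) *\<^sub>R vdot (vdot (dy (dy g) t y) (z - y)) (z - y))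
        \<le> C * norm (z - y) ^ 3"
proof -
  obtain L where L: "L \<ge> 0" "\<And>t y z. \<lbrakk>t \<in> {0..T}; y \<in> K; z \<in> K\<rbrakk> \<Longrightarrow>
      norm (dy g t z - dy g t y - vdot (dy (dy g) t y) (z - y)) \<le> L * norm (z - y) ^ 2"
    using C2_loc_taylor1[OF g(2) K] by metis
  obtain V where V: "V \<ge> 0" "\<And>(c :: 'e ^ 'm) v. norm (vdot c v) \<le> V * norm c * norm v"
    by (rule vdot_norm_bound) (rule that)
  have "norm (g t z - g t y - vdot (dy g t y) (z - y) - (1/2) *\<^sub>R vdot (vdot (dy (dy g) t y) (z - y)) (z - y))
        \<le> (V * L) * norm (z - y) ^ 3"
    if a: "t \<in> {0..T}" "y \<in> K" "z \<in> K" for t y z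
  proof -
    define v where "v = z - y"
    define D2 where "D2 = dy (dy g) t y"
    \<comment> \<open>\<open>\<phi> 1 - \<phi> 0\<close> is the error to be bounded.\<close>
    define \<phi> where "\<phi> = (\<lambda>r. g t (y + r *\<^sub>R v) - r *\<^sub>R vdot (dy g t y) v - (r\<^sup>2 / 2) *\<^sub>R vdot (vdot D2 v) v)"
    define \<phi>' where "\<phi>' = (\<lambda>r. vdot (dy g t (y + r *\<^sub>R v) - dy g t y - vdot D2 (r *\<^sub>R v)) v)"
    have inK: "y + r *\<^sub>R v \<in> K" if "r \<in> {0..1}" for r
    proof -
      have "y + r *\<^sub>R v = (1 - r) *\<^sub>R y + r *\<^sub>R z" unfolding v_def by (simp add: algebra_simps)
      then show ?thesis using K(2) a that by (simp add: convex_alt)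
    qed
    have "norm (\<phi> 1 - \<phi> 0) \<le> (V * L * norm v ^ 3) * norm (1 - 0 :: real)"
    proof (rule differentiable_bound[where S = "{0..1}" and f' = "\<lambda>r h. h *\<^sub>R \<phi>' r"])
      fix r :: real assume r: "r \<in> {0..1}"
      have dg: "(g t has_derivative vdot (dy g t x)) (at x)" for x
        using g(1) a(1) unfolding C1_loc_def by (intro has_derivative_dy) auto
      have 1: "((\<lambda>r. y + r *\<^sub>R v) has_derivative (\<lambda>h. h *\<^sub>R v)) (at r within {0..1})"
        by (auto intro!: derivative_eq_intros)
      have "((\<lambda>r. g t (y + r *\<^sub>R v)) has_derivative (\<lambda>h. vdot (dy g t (y + r *\<^sub>R v)) (h *\<^sub>R v))) (at r within {0..1})"
        using has_derivative_compose[OF 1 dg] by simp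
      then have "(\<phi> has_derivative (\<lambda>h. vdot (dy g t (y + r *\<^sub>R v)) (h *\<^sub>R v) - h *\<^sub>R vdot (dy g t y) v
          - (r * h) *\<^sub>R vdot (vdot D2 v) v)) (at r within {0..1})"
        unfolding \<phi>_def by (auto intro!: derivative_eq_intros simp: power2_eq_square)
      also have "(\<lambda>h. vdot (dy g t (y + r *\<^sub>R v)) (h *\<^sub>R v) - h *\<^sub>R vdot (dy g t y) v
          - (r * h) *\<^sub>R vdot (vdot D2 v) v) = (\<lambda>h. h *\<^sub>R \<phi>' r)"
        unfolding \<phi>'_def
        by (simp add: vdot.scaleR_left vdot.scaleR_right vdot.diff_left scaleR_diff_right mult.commute)
      finally show "(\<phi> has_derivative (\<lambda>h. h *\<^sub>R \<phi>' r)) (at r within {0..1})" .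
      have "norm (\<phi>' r) \<le> V * (L * norm v ^ 2) * norm v"
        unfolding \<phi>'_def
      proof (rule order_trans[OF V(2)], intro mult_right_mono mult_left_mono V norm_ge_zero)
        have "norm (dy g t (y + r *\<^sub>R v) - dy g t y - vdot D2 (r *\<^sub>R v)) \<le> L * norm (r *\<^sub>R v) ^ 2"
          using L(2)[OF a(1,2) inK[OF r]] unfolding D2_def by simp
        also have "\<dots> \<le> L * norm v ^ 2"
          using r L(1) by (intro mult_left_mono power_mono) (auto simp: mult_left_le_one_le)
        finally show "norm (dy g t (y + r *\<^sub>R v) - dy g t y - vdot D2 (r *\<^sub>R v)) \<le> L * norm v ^ 2" .
      qed
      also have "\<dots> = V * L * norm v ^ 3" by (simp add: power2_eq_square power3_eq_cube)
      finally show "onorm (\<lambda>h. h *\<^sub>R \<phi>' r) \<le> V * L * norm v ^ 3"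
        by (intro onorm_le) (simp add: mult.commute mult_left_mono)
    qed auto
    then show ?thesis
      unfolding \<phi>_def v_def D2_def by (simp add: algebra_simps)
  qed
  then show thesis using that[of "V * L"] L(1) V(1) by simp
qed

section \<open>Symmetry of the second space derivative\<close>

text \<open>Both iterated derivatives are the limit of the second difference
  \<open>G (y + \<epsilon> u + \<epsilon> v) - G (y + \<epsilon> u) - G (y + \<epsilon> v) + G y\<close> divided by \<open>\<epsilon>\<^sup>2\<close>.\<close>

lemma second_difference_bound:
  fixes G :: "real ^ 'm \<Rightarrow> 'e::euclidean_space"
  assumes G: "\<And>x. (G has_derivative vdot (G1 x)) (at x)"
    and G1: "\<And>x. x \<in> cball y 1 \<Longrightarrow> norm (G1 x - G1 y - vdot D2 (x - y)) \<le> C * norm (x - y) ^ 2"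
  obtains K where "\<And>\<epsilon>. \<lbrakk>0 < \<epsilon>; \<epsilon> * (norm u + norm v) \<le> 1\<rbrakk> \<Longrightarrow>
    norm (G (y + \<epsilon> *\<^sub>R u + \<epsilon> *\<^sub>R v) - G (y + \<epsilon> *\<^sub>R u) - G (y + \<epsilon> *\<^sub>R v) + G y - \<epsilon>\<^sup>2 *\<^sub>R vdot (vdot D2 v) u) \<le> K * \<epsilon> ^ 3"
proof -
  obtain V where V: "V \<ge> 0" "\<And>(c :: 'e ^ 'm) v. norm (vdot c v) \<le> V * norm c * norm v"
    by (rule vdot_norm_bound) (rule that)
  define M where "M = norm u + norm v"
  show thesis
  proof (rule that)
    fix \<epsilon> :: real assume \<epsilon>: "0 < \<epsilon>" "\<epsilon> * (norm u + norm v) \<le> 1"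
    \<comment> \<open>Only the shift by \<open>u\<close> is interpolated.
      \<open>\<psi> 1 - \<psi> 0\<close> is the second difference minus its claimed leading
      term.\<close>
    define \<psi> where "\<psi> = (\<lambda>r. G (y + (r * \<epsilon>) *\<^sub>R u + \<epsilon> *\<^sub>R v) - G (y + (r * \<epsilon>) *\<^sub>R u) - (r * \<epsilon>\<^sup>2) *\<^sub>R vdot (vdot D2 v) u)"
    define \<psi>' where "\<psi>' = (\<lambda>r. \<epsilon> *\<^sub>R vdot (G1 (y + (r * \<epsilon>) *\<^sub>R u + \<epsilon> *\<^sub>R v) - G1 (y + (r * \<epsilon>) *\<^sub>R u) - vdot D2 (\<epsilon> *\<^sub>R v)) u)"
    have "norm (\<psi> 1 - \<psi> 0) \<le> (\<epsilon> * (V * (\<bar>C\<bar> * (\<epsilon> * M)\<^sup>2 + \<bar>C\<bar> * (\<epsilon> * M)\<^sup>2) * norm u)) * norm (1 - 0 :: real)"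
    proof (rule differentiable_bound[where S = "{0..1}" and f' = "\<lambda>r h. h *\<^sub>R \<psi>' r"])
      fix r :: real assume r: "r \<in> {0..1}"
      have 1: "((\<lambda>r. y + (r * \<epsilon>) *\<^sub>R u + \<epsilon> *\<^sub>R v) has_derivative (\<lambda>h. (h * \<epsilon>) *\<^sub>R u)) (at r within {0..1})"
        "((\<lambda>r. y + (r * \<epsilon>) *\<^sub>R u) has_derivative (\<lambda>h. (h * \<epsilon>) *\<^sub>R u)) (at r within {0..1})"
        by (auto intro!: derivative_eq_intros)
      have "(\<psi> has_derivative (\<lambda>h. vdot (G1 (y + (r * \<epsilon>) *\<^sub>R u + \<epsilon> *\<^sub>R v)) ((h * \<epsilon>) *\<^sub>R u)
          - vdot (G1 (y + (r * \<epsilon>) *\<^sub>R u)) ((h * \<epsilon>) *\<^sub>R u) - (h * \<epsilon>\<^sup>2) *\<^sub>R vdot (vdot D2 v) u)) (at r within {0..1})"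
        unfolding \<psi>_def
        by (intro has_derivative_diff has_derivative_compose[OF 1(1) G] has_derivative_compose[OF 1(2) G])
          (auto intro!: derivative_eq_intros)
      also have "(\<lambda>h. vdot (G1 (y + (r * \<epsilon>) *\<^sub>R u + \<epsilon> *\<^sub>R v)) ((h * \<epsilon>) *\<^sub>R u)
          - vdot (G1 (y + (r * \<epsilon>) *\<^sub>R u)) ((h * \<epsilon>) *\<^sub>R u) - (h * \<epsilon>\<^sup>2) *\<^sub>R vdot (vdot D2 v) u) = (\<lambda>h. h *\<^sub>R \<psi>' r)"
        unfolding \<psi>'_def
        by (simp add: vdot.scaleR_left vdot.scaleR_right vdot.diff_left scaleR_diff_right mult.commute power2_eq_square mult.left_commute)
      finally show "(\<psi> has_derivative (\<lambda>h. h *\<^sub>R \<psi>' r)) (at r within {0..1})" .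
      define x1 x2 where "x1 = y + (r * \<epsilon>) *\<^sub>R u + \<epsilon> *\<^sub>R v" "x2 = y + (r * \<epsilon>) *\<^sub>R u"
      have re: "r * \<epsilon> \<le> \<epsilon>" "0 \<le> r * \<epsilon>" using r \<epsilon> by (auto simp: mult_left_le_one_le)
      have n1: "norm (x1 - y) \<le> \<epsilon> * M"
      proof -
        have "norm (x1 - y) \<le> norm ((r * \<epsilon>) *\<^sub>R u) + norm (\<epsilon> *\<^sub>R v)"
          unfolding x1_x2_def using norm_triangle_ineq[of "(r * \<epsilon>) *\<^sub>R u" "\<epsilon> *\<^sub>R v"] by (simp add: algebra_simps)
        also have "\<dots> \<le> \<epsilon> * norm u + \<epsilon> * norm v"
          using re \<epsilon> r by (intro add_mono) (auto intro: mult_right_mono mult_left_le_one_le)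
        finally show ?thesis unfolding M_def by (simp add: distrib_left)
      qed
      have n2: "norm (x2 - y) \<le> \<epsilon> * M"
      proof -
        have "norm (x2 - y) \<le> \<epsilon> * norm u"
          unfolding x1_x2_def using re \<epsilon> r by (auto intro: mult_right_mono mult_left_le_one_le)
        then show ?thesis unfolding M_def using \<epsilon> by (simp add: distrib_left add_increasing2)
      qed
      have b: "norm (G1 x - G1 y - vdot D2 (x - y)) \<le> \<bar>C\<bar> * (\<epsilon> * M)\<^sup>2" if "norm (x - y) \<le> \<epsilon> * M" for x
      proof -
        have "norm (G1 x - G1 y - vdot D2 (x - y)) \<le> C * norm (x - y) ^ 2"
          using that \<epsilon>(2) unfolding M_def by (intro G1) (simp add: dist_norm norm_minus_commute)
        also have "\<dots> \<le> \<bar>C\<bar> * (\<epsilon> * M)\<^sup>2"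
          using that by (intro mult_mono power_mono) auto
        finally show ?thesis .
      qed
      \<comment> \<open>Both gradients are compared with the one at \<open>y\<close>; the linear
        parts differ exactly by the shift along \<open>v\<close>.\<close>
      have eq: "G1 x1 - G1 x2 - vdot D2 (\<epsilon> *\<^sub>R v) = (G1 x1 - G1 y - vdot D2 (x1 - y)) - (G1 x2 - G1 y - vdot D2 (x2 - y))"
      proof -
        have "\<epsilon> *\<^sub>R v = (x1 - y) - (x2 - y)" unfolding x1_x2_def by simp
        then have "vdot D2 (\<epsilon> *\<^sub>R v) = vdot D2 (x1 - y) - vdot D2 (x2 - y)" by (simp only: vdot.diff_right)
        then show ?thesis by simp
      qed
      have "norm (G1 x1 - G1 x2 - vdot D2 (\<epsilon> *\<^sub>R v)) \<le> \<bar>C\<bar> * (\<epsilon> * M)\<^sup>2 + \<bar>C\<bar> * (\<epsilon> * M)\<^sup>2"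
        unfolding eq by (rule norm_triangle_le_diff[OF add_mono[OF b[OF n1] b[OF n2]]])
      then have "norm (vdot (G1 x1 - G1 x2 - vdot D2 (\<epsilon> *\<^sub>R v)) u) \<le> V * (\<bar>C\<bar> * (\<epsilon> * M)\<^sup>2 + \<bar>C\<bar> * (\<epsilon> * M)\<^sup>2) * norm u"
        by (intro order_trans[OF V(2)] mult_right_mono mult_left_mono V norm_ge_zero)
      then have "norm (\<psi>' r) \<le> \<epsilon> * (V * (\<bar>C\<bar> * (\<epsilon> * M)\<^sup>2 + \<bar>C\<bar> * (\<epsilon> * M)\<^sup>2) * norm u)"
        unfolding \<psi>'_def x1_x2_def using \<epsilon>(1) by simp
      then show "onorm (\<lambda>h. h *\<^sub>R \<psi>' r) \<le> \<epsilon> * (V * (\<bar>C\<bar> * (\<epsilon> * M)\<^sup>2 + \<bar>C\<bar> * (\<epsilon> * M)\<^sup>2) * norm u)"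
        by (intro onorm_le) (simp add: mult.commute mult_left_mono)
    qed auto
    then show "norm (G (y + \<epsilon> *\<^sub>R u + \<epsilon> *\<^sub>R v) - G (y + \<epsilon> *\<^sub>R u) - G (y + \<epsilon> *\<^sub>R v) + G y - \<epsilon>\<^sup>2 *\<^sub>R vdot (vdot D2 v) u)
        \<le> (2 * V * \<bar>C\<bar> * M\<^sup>2 * norm u) * \<epsilon> ^ 3"
      unfolding \<psi>_def by (simp add: algebra_simps power2_eq_square power3_eq_cube)
  qed
qed

text \<open>The second difference is symmetric in \<open>u\<close> and \<open>v\<close>, so both
  contractions are its leading coefficient. Their difference is independent of \<epsilon> and yet
  bounded by a multiple of \<epsilon>, hence zero.\<close>

lemma second_derivative_symmetric:
  fixes G :: "real ^ 'm \<Rightarrow> 'e::euclidean_space"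
  assumes G: "\<And>x. (G has_derivative vdot (G1 x)) (at x)"
    and G1: "\<And>x. x \<in> cball y 1 \<Longrightarrow> norm (G1 x - G1 y - vdot D2 (x - y)) \<le> C * norm (x - y) ^ 2"
  shows "vdot (vdot D2 u) v = vdot (vdot D2 v) u"
proof -
  let ?d = "vdot (vdot D2 u) v - vdot (vdot D2 v) u"
  let ?\<Delta> = "\<lambda>\<epsilon>. G (y + \<epsilon> *\<^sub>R u + \<epsilon> *\<^sub>R v) - G (y + \<epsilon> *\<^sub>R u) - G (y + \<epsilon> *\<^sub>R v) + G y"
  define M where "M = norm u + norm v"
  obtain K where K: "\<And>\<epsilon>. \<lbrakk>0 < \<epsilon>; \<epsilon> * M \<le> 1\<rbrakk> \<Longrightarrow> norm (?\<Delta> \<epsilon> - \<epsilon>\<^sup>2 *\<^sub>R vdot (vdot D2 v) u) \<le> K * \<epsilon> ^ 3"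
    unfolding M_def by (rule second_difference_bound[OF G G1, where u = u and v = v]) auto
  obtain K' where K': "\<And>\<epsilon>. \<lbrakk>0 < \<epsilon>; \<epsilon> * M \<le> 1\<rbrakk> \<Longrightarrow> norm (?\<Delta> \<epsilon> - \<epsilon>\<^sup>2 *\<^sub>R vdot (vdot D2 u) v) \<le> K' * \<epsilon> ^ 3"
    unfolding M_def by (rule second_difference_bound[OF G G1, where u = v and v = u]) (auto simp: algebra_simps)
  have bound: "norm ?d \<le> (K + K') * \<epsilon>" if \<epsilon>: "0 < \<epsilon>" "\<epsilon> * M \<le> 1" for \<epsilon>
  proof -
    have "\<epsilon>\<^sup>2 *\<^sub>R ?d = (?\<Delta> \<epsilon> - \<epsilon>\<^sup>2 *\<^sub>R vdot (vdot D2 v) u) - (?\<Delta> \<epsilon> - \<epsilon>\<^sup>2 *\<^sub>R vdot (vdot D2 u) v)"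
      by (simp add: algebra_simps)
    then have "norm (\<epsilon>\<^sup>2 *\<^sub>R ?d) \<le> K * \<epsilon> ^ 3 + K' * \<epsilon> ^ 3"
      using norm_triangle_le_diff[OF add_mono[OF K[OF \<epsilon>] K'[OF \<epsilon>]]] by simp
    moreover have "norm (\<epsilon>\<^sup>2 *\<^sub>R ?d) = \<epsilon>\<^sup>2 * norm ?d" by simp
    moreover have "K * \<epsilon> ^ 3 + K' * \<epsilon> ^ 3 = \<epsilon>\<^sup>2 * ((K + K') * \<epsilon>)"
      by (simp add: algebra_simps power2_eq_square power3_eq_cube)
    ultimately have "\<epsilon>\<^sup>2 * norm ?d \<le> \<epsilon>\<^sup>2 * ((K + K') * \<epsilon>)" by simp
    then show ?thesis using \<epsilon>(1) by (simp add: mult_le_cancel_left)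
  qed
  have "((\<lambda>\<epsilon>. (K + K') * \<epsilon>) \<longlongrightarrow> (K + K') * 0) (at_right 0)"
    by (intro tendsto_intros)
  moreover have "\<forall>\<^sub>F \<epsilon> in at_right 0. norm ?d \<le> (K + K') * \<epsilon>"
  proof -
    \<comment> \<open>Below \<open>1 / (M + 1)\<close> the requirement
      \<open>\<epsilon> * M \<le> 1\<close> holds, also for \<open>M = 0\<close>.\<close>
    have M1: "1 / (M + 1) > 0" "M \<ge> 0" unfolding M_def by (auto simp: add_nonneg_pos)
    have "norm ?d \<le> (K + K') * \<epsilon>" if "0 < \<epsilon>" "\<epsilon> < 1 / (M + 1)" for \<epsilon>
    proof (rule bound[OF that(1)])
      have "\<epsilon> * M \<le> \<epsilon> * (M + 1)" using that by simp
      also have "\<dots> \<le> 1" using that M1 by (simp add: field_simps)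
      finally show "\<epsilon> * M \<le> 1" .
    qed
    then show ?thesis unfolding eventually_at_right_field using M1(1) by blast
  qed
  ultimately have "norm ?d \<le> (K + K') * 0"
    by (rule tendsto_lowerbound) (simp add: trivial_limit_at_right_real)
  then show ?thesis by simp
qed

section \<open>Composition of space-time functions with a controlled path\<close>

context rough_setup
begin

text \<open>A ball is chosen because the mean value and Taylor bounds ask for convexity as well as
  compactness.\<close>

lemma path_in_cball:
  fixes \<theta> :: "real \<Rightarrow> real ^ 'm"
  assumes "incO T \<alpha> {()} (\<lambda>_ s t. \<theta> t - \<theta> s)"
  obtains M where "\<theta> ` {0..T} \<subseteq> cball 0 M"
proof -
  have "bounded (\<theta> ` {0..T})"
    using incO_imp_continuous[OF exponents'(1) assms]
    by (intro compact_imp_bounded compact_continuous_image compact_Icc)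
  then obtain M where "\<forall>x\<in>\<theta> ` {0..T}. norm x \<le> M" unfolding bounded_iff by blast
  then show thesis using that[of M] by (simp add: image_subset_iff)
qed

lemma compose_bounded:
  assumes "C0_loc T F" and "\<theta> ` {0..T} \<subseteq> cball 0 M"
  shows "incO T 0 {()} (\<lambda>_ s t. F s (\<theta> s))" "incO T 0 {()} (\<lambda>_ s t. F t (\<theta> s))" "incO T 0 {()} (\<lambda>_ s t. F t (\<theta> t))"
proof -
  obtain B where B: "B \<ge> 0" "\<And>t y. \<lbrakk>t \<in> {0..T}; y \<in> cball 0 M\<rbrakk> \<Longrightarrow> norm (F t y) \<le> B"
    using C0_loc_bounded[OF assms(1) compact_cball] by metis
  show "incO T 0 {()} (\<lambda>_ s t. F s (\<theta> s))" "incO T 0 {()} (\<lambda>_ s t. F t (\<theta> s))" "incO T 0 {()} (\<lambda>_ s t. F t (\<theta> t))"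
    by (rule incOI[where C = B], use B assms(2) in \<open>simp add: image_subset_iff\<close>)+
qed

lemma incO_power_bound:
  assumes "incO T \<gamma> {()} (\<lambda>_ s t. \<theta> t - \<theta> s)"
    and "\<And>s t. \<lbrakk>0 \<le> s; s < t; t \<le> T\<rbrakk> \<Longrightarrow> norm (R s t) \<le> C * norm (\<theta> t - \<theta> s) ^ n" and "C \<ge> 0"
  shows "incO T (real n * \<gamma>) {()} (\<lambda>_. R)"
proof -
  obtain D where D: "D \<ge> 0" "\<And>s t. \<lbrakk>0 \<le> s; s < t; t \<le> T\<rbrakk> \<Longrightarrow> norm (\<theta> t - \<theta> s) \<le> D * (t - s) powr \<gamma>"
    by (rule incOE[OF assms(1)]) blast
  show ?thesis
  proof (rule incOI)
    fix i s t assume a: "0 \<le> s" "s < t" "t \<le> T"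
    have "norm (R s t) \<le> C * (D * (t - s) powr \<gamma>) ^ n"
      using assms(2)[OF a] mult_left_mono[OF power_mono[OF D(2)[OF a] norm_ge_zero] assms(3)] by (rule order_trans)
    also have "\<dots> = (C * D ^ n) * (t - s) powr (real n * \<gamma>)"
      using a by (simp add: power_mult_distrib powr_powr mult.commute flip: powr_realpow)
    finally show "norm (R s t) \<le> (C * D ^ n) * (t - s) powr (real n * \<gamma>)" .
  qed
qed

lemma compose_lipschitz:
  fixes \<theta> :: "real \<Rightarrow> real ^ 'm"
  assumes "C1_loc T F" "\<theta> ` {0..T} \<subseteq> cball 0 M" "incO T \<gamma> {()} (\<lambda>_ s t. \<theta> t - \<theta> s)"
  shows "incO T \<gamma> {()} (\<lambda>_ s t. F t (\<theta> t) - F t (\<theta> s))"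
proof -
  obtain L where L: "L \<ge> 0" "\<And>t y z. \<lbrakk>t \<in> {0..T}; y \<in> cball 0 M; z \<in> cball 0 M\<rbrakk> \<Longrightarrow> norm (F t z - F t y) \<le> L * norm (z - y)"
    using C1_loc_lipschitz[OF assms(1) compact_cball convex_cball] by metis
  have "norm (F t (\<theta> t) - F t (\<theta> s)) \<le> L * norm (\<theta> t - \<theta> s) ^ 1" if "0 \<le> s" "s < t" "t \<le> T" for s t
    using L(2)[of t "\<theta> s" "\<theta> t"] assms(2) that by (simp add: image_subset_iff)
  from incO_power_bound[OF assms(3) this L(1)] show ?thesis by simp
qed

lemma compose_taylor1:
  fixes \<theta> :: "real \<Rightarrow> real ^ 'm"
  assumes "C2_loc T g" "\<theta> ` {0..T} \<subseteq> cball 0 M" "incO T \<gamma> {()} (\<lambda>_ s t. \<theta> t - \<theta> s)"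
  shows "incO T (2 * \<gamma>) {()} (\<lambda>_ s t. g t (\<theta> t) - g t (\<theta> s) - vdot (dy g t (\<theta> s)) (\<theta> t - \<theta> s))"
proof -
  obtain C where C: "C \<ge> 0" "\<And>t y z. \<lbrakk>t \<in> {0..T}; y \<in> cball 0 M; z \<in> cball 0 M\<rbrakk> \<Longrightarrow>
      norm (g t z - g t y - vdot (dy g t y) (z - y)) \<le> C * norm (z - y) ^ 2"
    using C2_loc_taylor1[OF assms(1) compact_cball convex_cball] by metis
  have "norm (g t (\<theta> t) - g t (\<theta> s) - vdot (dy g t (\<theta> s)) (\<theta> t - \<theta> s)) \<le> C * norm (\<theta> t - \<theta> s) ^ 2"
    if "0 \<le> s" "s < t" "t \<le> T" for s t
    using that by (intro C(2) assms(2)[THEN subsetD] imageI) auto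
  from incO_power_bound[OF assms(3) this C(1)] show ?thesis by simp
qed

lemma compose_taylor2:
  fixes \<theta> :: "real \<Rightarrow> real ^ 'm"
  assumes "C1_loc T g" "C2_loc T (dy g)" "\<theta> ` {0..T} \<subseteq> cball 0 M" "incO T \<gamma> {()} (\<lambda>_ s t. \<theta> t - \<theta> s)"
  shows "incO T (3 * \<gamma>) {()} (\<lambda>_ s t. g t (\<theta> t) - g t (\<theta> s) - vdot (dy g t (\<theta> s)) (\<theta> t - \<theta> s)
    - (1/2) *\<^sub>R vdot (vdot (dy (dy g) t (\<theta> s)) (\<theta> t - \<theta> s)) (\<theta> t - \<theta> s))"
proof -
  obtain C where C: "C \<ge> 0" "\<And>t y z. \<lbrakk>t \<in> {0..T}; y \<in> cball 0 M; z \<in> cball 0 M\<rbrakk> \<Longrightarrow>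
      norm (g t z - g t y - vdot (dy g t y) (z - y) - (1/2) *\<^sub>R vdot (vdot (dy (dy g) t y) (z - y)) (z - y))
        \<le> C * norm (z - y) ^ 3"
    using C3_loc_taylor2[OF assms(1,2) compact_cball convex_cball] by metis
  have "norm (g t (\<theta> t) - g t (\<theta> s) - vdot (dy g t (\<theta> s)) (\<theta> t - \<theta> s)
    - (1/2) *\<^sub>R vdot (vdot (dy (dy g) t (\<theta> s)) (\<theta> t - \<theta> s)) (\<theta> t - \<theta> s)) \<le> C * norm (\<theta> t - \<theta> s) ^ 3"
    if "0 \<le> s" "s < t" "t \<le> T" for s t
    using that by (intro C(2) assms(3)[THEN subsetD] imageI) auto
  from incO_power_bound[OF assms(4) this C(1)] show ?thesis by simp
qed

lemma compose_hoelder: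
  fixes \<theta> :: "real \<Rightarrow> real ^ 'm"
  assumes "C1_beta_loc T \<beta> F" "\<theta> ` {0..T} \<subseteq> cball 0 M" "incO T \<alpha> {()} (\<lambda>_ s t. \<theta> t - \<theta> s)"
  shows "incO T \<beta> {()} (\<lambda>_ s t. F t (\<theta> t) - F s (\<theta> s))"
proof -
  have "incO T \<beta> (cball 0 M) (\<lambda>y s t. F t y - F s y)"
    using assms(1) unfolding C1_beta_loc_def by (intro hoelder_cont_uniform compact_cball) auto
  from incO_subst[OF this, of "{()}" "\<lambda>_ s t. \<theta> s"] have "incO T \<beta> {()} (\<lambda>_ s t. F t (\<theta> s) - F s (\<theta> s))"
    using assms(2) by (simp add: image_subset_iff)
  moreover have "incO T \<beta> {()} (\<lambda>_ s t. F t (\<theta> t) - F t (\<theta> s))"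
    using assms unfolding C1_beta_loc_def
    by (intro incO_mono[OF compose_lipschitz exponents(4) T_pos]) auto
  ultimately have "incO T \<beta> {()} (\<lambda>_ s t. (F t (\<theta> s) - F s (\<theta> s)) + (F t (\<theta> t) - F t (\<theta> s)))"
    by (rule incO_add)
  then show ?thesis by simp
qed

text \<open>Freezing the space argument at \<open>\<theta> s\<close> turns the uniform controlled
  expansion into a rule that moves a coefficient from time \<open>t\<close> to time
  \<open>s\<close>.\<close>

lemma C12_loc_base_point:
  fixes \<theta> :: "real \<Rightarrow> real ^ 'm"
  assumes C1: "\<And>y. C1_path T \<alpha> \<beta> \<omega> (\<lambda>t. F t y)" and cc: "ctrl_cont T \<alpha> \<beta> \<omega> F"
    and K: "\<theta> ` {0..T} \<subseteq> cball 0 M"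
  shows "incO T (\<alpha> + \<beta>) {()} (\<lambda>_ s t. F t (\<theta> s) - F s (\<theta> s) - vdot (d\<omega> T \<alpha> \<beta> \<omega> F s (\<theta> s)) (\<omega> t - \<omega> s))"
    and "incO T \<alpha> {()} (\<lambda>_ s t. F t (\<theta> s) - F s (\<theta> s))"
proof -
  note u = ctrl_cont_uniform[OF C1 cc compact_cball[of 0 M]]
  show "incO T (\<alpha> + \<beta>) {()} (\<lambda>_ s t. F t (\<theta> s) - F s (\<theta> s) - vdot (d\<omega> T \<alpha> \<beta> \<omega> F s (\<theta> s)) (\<omega> t - \<omega> s))"
    using incO_subst[OF u(1), of "{()}" "\<lambda>_ s t. \<theta> s"] K by (simp add: path_remainder_def image_subset_iff)
  show "incO T \<alpha> {()} (\<lambda>_ s t. F t (\<theta> s) - F s (\<theta> s))"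
    using incO_subst[OF controlled_increment_O[OF u(1,3)], of "{()}" "\<lambda>_ s t. \<theta> s"] K by (simp add: image_subset_iff)
qed

text \<open>In time the bound comes from \<open>dy g\<close> being controlled at each frozen point,
  in space from its Lipschitz bound; both have order \<alpha>.\<close>

lemma compose_dy_hoelder:
  fixes \<theta> :: "real \<Rightarrow> real ^ 'm"
  assumes "C12_loc T \<alpha> \<beta> \<omega> g" and M: "\<theta> ` {0..T} \<subseteq> cball 0 M" and \<theta>: "incO T \<alpha> {()} (\<lambda>_ s t. \<theta> t - \<theta> s)"
  shows "incO T \<beta> {()} (\<lambda>_ s t. dy g t (\<theta> t) - dy g s (\<theta> s))"
proof -
  have C1: "C1_loc T (dy g)" and "\<And>y. C1_path T \<alpha> \<beta> \<omega> (\<lambda>t. dy g t y)" "ctrl_cont T \<alpha> \<beta> \<omega> (dy g)"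
    using assms(1) unfolding C12_loc_def C2_loc_def by auto
  from incO_mono[OF incO_add[OF C12_loc_base_point(2)[OF this(2,3) M] compose_lipschitz[OF C1 M \<theta>]] exponents(4) T_pos]
  show ?thesis by simp
qed

lemma has_path_deriv_compose:
  fixes \<theta> :: "real \<Rightarrow> real ^ 'm" and g :: "real \<Rightarrow> real ^ 'm \<Rightarrow> 'e::euclidean_space"
  assumes g: "C12_loc T \<alpha> \<beta> \<omega> g" and \<theta>: "has_path_deriv T \<alpha> \<beta> \<omega> \<theta> a"
  shows "has_path_deriv T \<alpha> \<beta> \<omega> (\<lambda>t. g t (\<theta> t))
    (\<lambda>t. d\<omega> T \<alpha> \<beta> \<omega> g t (\<theta> t) + (\<chi> p. vdot (dy g t (\<theta> t)) (a t $ p)))"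
    (is "has_path_deriv T \<alpha> \<beta> \<omega> ?F ?F'")
proof -
  note \<theta>\<alpha> = has_path_deriv_increment_O[OF \<theta>]
  obtain M where M: "\<theta> ` {0..T} \<subseteq> cball 0 M"
    using path_in_cball[OF \<theta>\<alpha>] by blast
  have C1: "C1_loc T (dy g)" "C0_loc T (dy g)" and C1': "C1_beta_loc T \<beta> (d\<omega> T \<alpha> \<beta> \<omega> g)"
    and C2: "C2_loc T g"
    and cp: "\<And>y. C1_path T \<alpha> \<beta> \<omega> (\<lambda>t. g t y)" "\<And>y. C1_path T \<alpha> \<beta> \<omega> (\<lambda>t. dy g t y)"
    and cc: "ctrl_cont T \<alpha> \<beta> \<omega> g" "ctrl_cont T \<alpha> \<beta> \<omega> (dy g)"
    using g unfolding C12_loc_def C2_loc_def C1_loc_def by auto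
  have a: "incO T \<beta> {()} (\<lambda>_ s t. a t - a s)" "incO T (\<alpha> + \<beta>) {()} (\<lambda>_ s t. path_remainder \<omega> \<theta> a s t)"
    using \<theta> unfolding has_path_deriv_iff by auto
  note ab = incO_imp_bounded[OF a(1) less_imp_le[OF exponents'(2)]]
  note base = C12_loc_base_point[OF cp(1) cc(1) M] and dbase = C12_loc_base_point[OF cp(2) cc(2) M]
  have dyg: "incO T \<beta> {()} (\<lambda>_ s t. dy g t (\<theta> t) - dy g s (\<theta> s))"
    by (rule compose_dy_hoelder[OF g M \<theta>\<alpha>])
  have "incO T \<beta> {()} (\<lambda>_ s t. (\<chi> p. vdot (dy g t (\<theta> t)) (a t $ p)) - (\<chi> p. vdot (dy g s (\<theta> s)) (a s $ p)))"
    unfolding incO_vec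
  proof
    fix p
    have "incO T \<beta> {()} (\<lambda>_ s t. a t $ p - a s $ p)" "incO T 0 {()} (\<lambda>_ s t. a s $ p)"
      using a(1) ab(1) unfolding incO_vec by auto
    from incO_bilinear_paths[OF bounded_bilinear_vdot dyg this(1) compose_bounded(3)[OF C1(2) M] this(2)]
    show "incO T \<beta> {()} (\<lambda>_ s t. ((\<chi> p. vdot (dy g t (\<theta> t)) (a t $ p)) - (\<chi> p. vdot (dy g s (\<theta> s)) (a s $ p))) $ p)"
      by simp
  qed
  from incO_add[OF compose_hoelder[OF C1' M \<theta>\<alpha>] this] have 1: "incO T \<beta> {()} (\<lambda>_ s t. ?F' t - ?F' s)"
    by (simp add: algebra_simps)
  have "path_remainder \<omega> ?F ?F' s t =
      (g t (\<theta> s) - g s (\<theta> s) - vdot (d\<omega> T \<alpha> \<beta> \<omega> g s (\<theta> s)) (\<omega> t - \<omega> s))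
      + (g t (\<theta> t) - g t (\<theta> s) - vdot (dy g t (\<theta> s)) (\<theta> t - \<theta> s))
      + vdot (dy g t (\<theta> s) - dy g s (\<theta> s)) (\<theta> t - \<theta> s)
      + vdot (dy g s (\<theta> s)) (path_remainder \<omega> \<theta> a s t)" for s t
  proof -
    have "vdot (\<chi> p. vdot (dy g s (\<theta> s)) (a s $ p)) x = vdot (dy g s (\<theta> s)) (vdot (a s) x)" for x
      by (rule linear_vdot[symmetric, OF bounded_linear.linear[OF vdot.bounded_linear_right]])
    then show ?thesis
      by (simp add: path_remainder_def vdot.add_left vdot.diff_left vdot.diff_right)
  qed
  moreover have "incO T (\<alpha> + \<beta>) {()} (\<lambda>_ s t. g t (\<theta> t) - g t (\<theta> s) - vdot (dy g t (\<theta> s)) (\<theta> t - \<theta> s))"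
    by (rule incO_mono[OF compose_taylor1[OF C2 M \<theta>\<alpha>] exponents'(4) T_pos])
  moreover have "incO T (\<alpha> + \<beta>) {()} (\<lambda>_ s t. vdot (dy g t (\<theta> s) - dy g s (\<theta> s)) (\<theta> t - \<theta> s))"
    using incO_mono[OF incO_bilinear[OF bounded_bilinear_vdot dbase(2) \<theta>\<alpha>] _ T_pos] exponents by simp
  moreover have "incO T (\<alpha> + \<beta>) {()} (\<lambda>_ s t. vdot (dy g s (\<theta> s)) (path_remainder \<omega> \<theta> a s t))"
    by (rule incO_bounded_mult[OF bounded_bilinear_vdot compose_bounded(1)[OF C1(2) M] a(2)])
  ultimately have 2: "incO T (\<alpha> + \<beta>) {()} (\<lambda>_ s t. path_remainder \<omega> ?F ?F' s t)"
    using base(1) by (simp only:) (intro incO_add)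
  show ?thesis unfolding has_path_deriv_iff using 1 2 by blast
qed

section \<open>Commutation of path and space derivatives\<close>

text \<open>Path derivatives commute with space derivatives: integrating the controlled expansion of
  \<open>\<partial>\<^sub>y\<^sub>kg\<close> along the \<open>k\<close>-th axis yields a path derivative of an increment of \<open>g\<close>, which is unique.\<close>

lemma path_deriv_dy_commute:
  fixes g :: "real \<Rightarrow> real ^ 'm \<Rightarrow> 'e::euclidean_space"
  assumes g: "C12_loc T \<alpha> \<beta> \<omega> g" and c0: "C0_loc T (d\<omega> T \<alpha> \<beta> \<omega> (dy g))" and s: "s \<in> {0..T}"
  shows "d\<omega> T \<alpha> \<beta> \<omega> (dy g) s y = transpose (dy (d\<omega> T \<alpha> \<beta> \<omega> g) s y)"
proof -
  let ?h = "d\<omega> T \<alpha> \<beta> \<omega> g" and ?k = "d\<omega> T \<alpha> \<beta> \<omega> (dy g)"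
  have C1: "C1_loc T g" "C0_loc T (dy g)" "C1_loc T ?h"
    and cp: "\<And>y. C1_path T \<alpha> \<beta> \<omega> (\<lambda>t. g t y)" "\<And>y. C1_path T \<alpha> \<beta> \<omega> (\<lambda>t. dy g t y)"
    and cc: "ctrl_cont T \<alpha> \<beta> \<omega> (dy g)"
    using g unfolding C12_loc_def C2_loc_def C1_loc_def C1_beta_loc_def by auto
  have "dy ?h s y $ k = (\<chi> p. ?k s y $ p $ k)" for k
  proof -
    define e :: "real ^ 'm" where "e = axis k 1"
    define K where "K = cball y 1"
    define P where "P = (\<lambda>s z. \<chi> p. ?k s z $ p $ k)"
    have e: "y + r *\<^sub>R e \<in> K" if "r \<in> {0..1}" for r
      using that unfolding K_def e_def by (simp add: dist_norm)
    have ve: "vdot c e = c $ k" for c :: "'e ^ 'm"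
      unfolding e_def by (rule vdot_axis)
    have ve': "vdot c e = c $ k" for c :: "('e ^ 'd) ^ 'm"
      unfolding e_def by (rule vdot_axis)
    note cont = C0_loc_continuous_on_line[where y = y and e = e]
    have contP: "continuous_on {0..1} (\<lambda>r. P t (y + r *\<^sub>R e))" if "t \<in> {0..T}" for t
      unfolding P_def using cont[OF c0 that] by (intro continuous_intros)
    have contD: "continuous_on {0..1} (\<lambda>r. dy g t (y + r *\<^sub>R e) $ k)" if "t \<in> {0..T}" for t
      using cont[OF C1(2) that] by (intro continuous_intros)
    have ftc: "integral {0..\<epsilon>} (\<lambda>r. dy g t (y + r *\<^sub>R e) $ k) = g t (y + \<epsilon> *\<^sub>R e) - g t y"
      if t: "t \<in> {0..T}" and \<epsilon>: "\<epsilon> \<in> {0..1}" for t \<epsilon>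
    proof -
      have "((\<lambda>r. g t (y + r *\<^sub>R e)) has_vector_derivative dy g t (y + r *\<^sub>R e) $ k) (at r within {0..\<epsilon>})" for r
      proof -
        have 1: "((\<lambda>r. y + r *\<^sub>R e) has_derivative (\<lambda>h. h *\<^sub>R e)) (at r within {0..\<epsilon>})"
          by (auto intro!: derivative_eq_intros)
        have "(g t has_derivative vdot (dy g t (y + r *\<^sub>R e))) (at (y + r *\<^sub>R e))"
          using C1(1) t unfolding C1_loc_def by (intro has_derivative_dy) auto
        from has_derivative_compose[OF 1 this] show ?thesis
          unfolding has_vector_derivative_def by (simp add: vdot.scaleR_right ve)
      qed
      from fundamental_theorem_of_calculus[of 0 \<epsilon>, OF _ this] show ?thesis
        using \<epsilon> by (simp add: integral_unique)
    qed
    \<comment> \<open>Bounds uniform over the unit ball hold along the whole axis segment and so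
      survive integration in \<open>r\<close>.\<close>
    note u = ctrl_cont_uniform[OF cp(2) cc compact_cball[of y 1], folded K_def]
    obtain A where A: "A \<ge> 0" "\<And>z s t. \<lbrakk>z \<in> K; 0 \<le> s; s < t; t \<le> T\<rbrakk> \<Longrightarrow>
        norm (path_remainder \<omega> (\<lambda>t. dy g t z) (\<lambda>t. ?k t z) s t) \<le> A * (t - s) powr (\<alpha> + \<beta>)"
      by (rule incOE[OF u(1)]) blast
    have "incO T \<beta> K (\<lambda>z s t. P t z - P s z)"
      using u(2) unfolding P_def incO_vec by simp
    then obtain B where B: "B \<ge> 0" "\<And>z s t. \<lbrakk>z \<in> K; 0 \<le> s; s < t; t \<le> T\<rbrakk> \<Longrightarrow>
        norm (P t z - P s z) \<le> B * (t - s) powr \<beta>"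
      by (rule incOE) blast
    have eq: "?h t (y + \<epsilon> *\<^sub>R e) - ?h t y = integral {0..\<epsilon>} (\<lambda>r. P t (y + r *\<^sub>R e))"
      if t: "t \<in> {0..T}" and \<epsilon>: "\<epsilon> \<in> {0..1}" for t \<epsilon>
    proof -
      let ?H = "\<lambda>t. integral {0..\<epsilon>} (\<lambda>r. P t (y + r *\<^sub>R e))"
      have iP: "(\<lambda>r. P t (y + r *\<^sub>R e)) integrable_on {0..\<epsilon>}" if "t \<in> {0..T}" for t
        using continuous_on_subset[OF contP[OF that]] \<epsilon> by (intro integrable_continuous_interval) auto
      have iD: "(\<lambda>r. dy g t (y + r *\<^sub>R e) $ k) integrable_on {0..\<epsilon>}" if "t \<in> {0..T}" for t
        using continuous_on_subset[OF contD[OF that]] \<epsilon> by (intro integrable_continuous_interval) auto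
      have "incO T \<beta> {()} (\<lambda>_ s t. ?H t - ?H s)"
      proof (rule incOI)
        fix i s t assume st: "0 \<le> s" "s < t" "t \<le> T"
        then have "?H t - ?H s = integral {0..\<epsilon>} (\<lambda>r. P t (y + r *\<^sub>R e) - P s (y + r *\<^sub>R e))"
          by (intro integral_diff[symmetric] iP) auto
        also have "norm \<dots> \<le> (B * (t - s) powr \<beta>) * (\<epsilon> - 0)"
          using \<epsilon> st e contP[of s] contP[of t]
          by (intro integral_bound B(2)) (auto intro!: continuous_intros elim: continuous_on_subset)
        finally show "norm (?H t - ?H s) \<le> (B * \<epsilon>) * (t - s) powr \<beta>" by (simp add: mult_ac)
      qed
      moreover have "incO T (\<alpha> + \<beta>) {()} (\<lambda>_ s t. path_remainder \<omega> (\<lambda>t. g t (y + \<epsilon> *\<^sub>R e) - g t y) ?H s t)"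
      proof (rule incOI)
        fix i s t assume st: "0 \<le> s" "s < t" "t \<le> T"
        then have T: "s \<in> {0..T}" "t \<in> {0..T}" by auto
        let ?\<rho> = "\<lambda>r. path_remainder \<omega> (\<lambda>t. dy g t (y + r *\<^sub>R e)) (\<lambda>t. ?k t (y + r *\<^sub>R e)) s t $ k"
        have \<rho>: "?\<rho> r = dy g t (y + r *\<^sub>R e) $ k - dy g s (y + r *\<^sub>R e) $ k - vdot (P s (y + r *\<^sub>R e)) (\<omega> t - \<omega> s)" for r
          unfolding P_def path_remainder_def by (simp add: vdot_vec_nth)
        have iV: "((\<lambda>r. vdot (P s (y + r *\<^sub>R e)) (\<omega> t - \<omega> s)) has_integral vdot (?H s) (\<omega> t - \<omega> s)) {0..\<epsilon>}"
          using has_integral_linear[OF integrable_integral[OF iP[OF T(1)]] vdot.bounded_linear_left]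
          by (simp add: o_def)
        have "(?\<rho> has_integral integral {0..\<epsilon>} (\<lambda>r. dy g t (y + r *\<^sub>R e) $ k)
            - integral {0..\<epsilon>} (\<lambda>r. dy g s (y + r *\<^sub>R e) $ k) - vdot (?H s) (\<omega> t - \<omega> s)) {0..\<epsilon>}"
          unfolding \<rho> by (intro has_integral_diff iV integrable_integral iD T)
        then have "path_remainder \<omega> (\<lambda>t. g t (y + \<epsilon> *\<^sub>R e) - g t y) ?H s t = integral {0..\<epsilon>} ?\<rho>"
          unfolding path_remainder_def[of _ _ ?H] ftc[OF T(1) \<epsilon>] ftc[OF T(2) \<epsilon>] by (simp add: integral_unique)
        also have "norm \<dots> \<le> (A * (t - s) powr (\<alpha> + \<beta>)) * (\<epsilon> - 0)"
        proof (rule integral_bound)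
          show "0 \<le> \<epsilon>" using \<epsilon> by simp
          show "continuous_on {0..\<epsilon>} ?\<rho>"
            unfolding \<rho> using \<epsilon> contP[OF T(1)] cont[OF C1(2) T(1), of "{0..\<epsilon>}"] cont[OF C1(2) T(2), of "{0..\<epsilon>}"]
            by (intro continuous_intros bounded_bilinear.continuous_on[OF bounded_bilinear_vdot])
              (auto elim: continuous_on_subset)
          show "norm (?\<rho> r) \<le> A * (t - s) powr (\<alpha> + \<beta>)" if "r \<in> {0..\<epsilon>}" for r
            using that \<epsilon> by (intro order_trans[OF Finite_Cartesian_Product.norm_nth_le] A(2) e st) auto
        qed
        finally show "norm (path_remainder \<omega> (\<lambda>t. g t (y + \<epsilon> *\<^sub>R e) - g t y) ?H s t) \<le> (A * \<epsilon>) * (t - s) powr (\<alpha> + \<beta>)"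
          by (simp add: mult_ac)
      qed
      ultimately have H: "has_path_deriv T \<alpha> \<beta> \<omega> (\<lambda>t. g t (y + \<epsilon> *\<^sub>R e) - g t y) ?H"
        unfolding has_path_deriv_iff by blast
      have "has_path_deriv T \<alpha> \<beta> \<omega> (\<lambda>t. g t (y + \<epsilon> *\<^sub>R e) - g t y) (\<lambda>t. ?h t (y + \<epsilon> *\<^sub>R e) - ?h t y)"
        using cp(1) unfolding C1_path_iff d\<omega>_def by (intro has_path_deriv_diff) auto
      from has_path_deriv_unique[OF this H t] show ?thesis .
    qed
    \<comment> \<open>A one-sided derivative at \<open>0\<close> is enough: \<open>?h s\<close> is
      differentiable, so its partial derivative can be read off from the right.\<close>
    have I: "((\<lambda>\<epsilon>. integral {0..\<epsilon>} (\<lambda>r. P s (y + r *\<^sub>R e))) has_vector_derivative P s (y + 0 *\<^sub>R e)) (at 0 within {0..1})"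
      by (rule integral_has_vector_derivative[OF contP[OF s]]) simp
    have "((\<lambda>\<epsilon>. ?h s (y + \<epsilon> *\<^sub>R e) - ?h s y) has_vector_derivative P s y) (at 0 within {0..1})"
    proof (rule has_vector_derivative_transform)
      show "?h s (y + \<epsilon> *\<^sub>R e) - ?h s y = integral {0..\<epsilon>} (\<lambda>r. P s (y + r *\<^sub>R e))" if "\<epsilon> \<in> {0..1}" for \<epsilon>
        by (rule eq[OF s that])
    qed (use I in simp_all)
    moreover have "((\<lambda>\<epsilon>. ?h s (y + \<epsilon> *\<^sub>R e) - ?h s y) has_vector_derivative dy ?h s y $ k) (at 0 within {0..1})"
    proof -
      have 1: "((\<lambda>r. y + r *\<^sub>R e) has_derivative (\<lambda>h. h *\<^sub>R e)) (at 0 within {0..1})"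
        by (auto intro!: derivative_eq_intros)
      have "(?h s has_derivative vdot (dy ?h s (y + 0 *\<^sub>R e))) (at (y + 0 *\<^sub>R e))"
        using C1(3) s unfolding C1_loc_def by (intro has_derivative_dy) auto
      from has_derivative_compose[OF 1 this]
      have "((\<lambda>\<epsilon>. ?h s (y + \<epsilon> *\<^sub>R e)) has_vector_derivative dy ?h s y $ k) (at 0 within {0..1})"
        unfolding has_vector_derivative_def by (simp add: vdot.scaleR_right ve')
      then show ?thesis by (auto intro!: derivative_eq_intros)
    qed
    ultimately have "P s y = dy ?h s y $ k"
      by (rule vector_derivative_unique_within_closed_interval[of 0 1 0, unfolded box_real, rotated 2]) simp_all
    then show ?thesis unfolding P_def by simp
  qed
  then show ?thesis by (simp add: vec_eq_iff transpose_def)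
qed

end

section \<open>The composition of a path family with a path\<close>

lemma half_add_half:
  fixes x y :: "'a::real_vector"
  shows "(1/2) *\<^sub>R x + (1/2) *\<^sub>R x = x" "(1/2) *\<^sub>R x + ((1/2) *\<^sub>R x + y) = x + y"
  by (simp_all flip: scaleR_add_left add.assoc)

section \<open>Contractions with outer products\<close>

lemma vdot_contract: "vdot (\<chi> p. vdot c (A $ p)) x = vdot c (vdot A x)"
  by (rule linear_vdot[symmetric, OF bounded_linear.linear[OF vdot.bounded_linear_right]])

lemma ddot_contract: "ddot (\<chi> p q. vdot c (A $ p $ q)) B = vdot c (ddot A B)"
  by (simp add: ddot_def vdot.sum_right vdot.scaleR_right)

lemma vdot_transpose: "vdot (vdot (transpose A) u) v = vdot (vdot A v) u"
  unfolding vdot_def transpose_def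
  by (simp add: sum_component scaleR_sum_right) (subst sum.swap, simp add: mult.commute)

lemma ddot_outer_rows: "ddot A (outer u v) = (\<Sum>p\<in>UNIV. u $ p *\<^sub>R vdot (A $ p) v)"
  by (simp add: ddot_def vdot_def outer_def scaleR_sum_right)

text \<open>The column index contracts \<open>a\<close> with \<open>x\<close>, the row index
  contracts the value with \<open>x\<close>; this evaluates the mixed coefficient on a squared
  increment.\<close>

lemma ddot_outer_mixed:
  "ddot (\<chi> p q. vdot A (a $ q) $ p) (outer x x) = vdot (vdot A (vdot a x)) x"
proof -
  have "vdot (\<chi> q. vdot A (a $ q) $ p) x = vdot A (vdot a x) $ p" for p
    by (simp add: vdot_vec_nth vdot_contract)
  then show ?thesis unfolding ddot_outer_rows by (simp add: vdot_def)
qed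

text \<open>By bilinearity \<open>x\<close> is contracted with \<open>a\<close> in both slots, which
  yields the Taylor term of second order for the displacement \<open>vdot a x\<close>.\<close>

lemma ddot_outer_quadratic:
  "ddot (\<chi> p q. vdot (vdot A (a $ q)) (a $ p)) (outer x x) = vdot (vdot A (vdot a x)) (vdot a x)"
proof -
  have "vdot (\<chi> q. vdot (vdot A (a $ q)) (a $ p)) x = vdot (vdot A (vdot a x)) (a $ p)" for p
    by (rule linear_vdot[symmetric, of "\<lambda>u. vdot (vdot A u) (a $ p)"])
      (auto intro!: linearI simp: vdot.add_left vdot.add_right vdot.scaleR_left vdot.scaleR_right)
  then have "ddot (\<chi> p q. vdot (vdot A (a $ q)) (a $ p)) (outer x x) = vdot (\<chi> p. vdot (vdot A (vdot a x)) (a $ p)) x"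
    unfolding ddot_outer_rows by (simp add: vdot_def)
  then show ?thesis by (simp add: vdot_contract)
qed

section \<open>The composition and its second-order expansion\<close>

locale path_composition = rough_setup T \<alpha> \<beta> \<omega> W
  for T \<alpha> \<beta> :: real and \<omega> :: "real \<Rightarrow> real ^ 'd" and W :: "real \<Rightarrow> real \<Rightarrow> real ^ 'd ^ 'd" +
  fixes \<theta> :: "real \<Rightarrow> real ^ 'm"
    and D\<theta> b :: "real \<Rightarrow> (real ^ 'm) ^ 'd ^ 'd"
    and a :: "real \<Rightarrow> (real ^ 'm) ^ 'd"
    and g :: "real \<Rightarrow> real ^ 'm \<Rightarrow> 'e::euclidean_space"
    and Dg f :: "real \<Rightarrow> real ^ 'm \<Rightarrow> 'e ^ 'd ^ 'd"
    and h :: "real \<Rightarrow> real ^ 'm \<Rightarrow> 'e ^ 'd"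
  assumes theta: "C2_path T \<alpha> \<beta> \<omega> W \<theta>" "has_time_deriv T \<alpha> \<beta> \<omega> W \<theta> D\<theta>"
    and g: "C23_loc T \<alpha> \<beta> \<omega> W g" "has_time_deriv_loc T \<alpha> \<beta> \<omega> W g Dg"
    and a_eq: "a = path_deriv T \<alpha> \<beta> \<omega> \<theta>"
    and b_eq: "b = (\<lambda>t. D\<theta> t + (1/2) *\<^sub>R path_deriv_mat T \<alpha> \<beta> \<omega> a t)"
    and h_eq: "h = d\<omega> T \<alpha> \<beta> \<omega> g"
    and f_eq: "f = (\<lambda>t y. Dg t y + (1/2) *\<^sub>R d\<omega>_mat T \<alpha> \<beta> \<omega> h t y)"
begin

definition a' :: "real \<Rightarrow> (real ^ 'm) ^ 'd ^ 'd" where "a' = path_deriv T \<alpha> \<beta> \<omega> a"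

definition h' :: "real \<Rightarrow> real ^ 'm \<Rightarrow> 'e ^ 'd ^ 'd" where "h' = d\<omega> T \<alpha> \<beta> \<omega> h"

definition \<eta>' :: "real \<Rightarrow> 'e ^ 'd" where
  "\<eta>' = (\<lambda>t. h t (\<theta> t) + (\<chi> p. vdot (dy g t (\<theta> t)) (a t $ p)))"

text \<open>The row index belongs to \<open>h\<close>, the column index to \<open>a\<close>. In
  general the matrix is not symmetric, and its antisymmetric part is what separates the two bracket
  coefficients.\<close>

definition mixed :: "real \<Rightarrow> 'e ^ 'd ^ 'd" where
  "mixed = (\<lambda>t. \<chi> p q. vdot (dy h t (\<theta> t)) (a t $ q) $ p)"

definition quadratic :: "real \<Rightarrow> 'e ^ 'd ^ 'd" where
  "quadratic = (\<lambda>t. \<chi> p q. vdot (vdot (dy (dy g) t (\<theta> t)) (a t $ q)) (a t $ p))"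

text \<open>The outer index is the direction of differentiation. \<open>transpose (mixed t)\<close>
  stems from differentiating \<open>h\<close> along \<open>\<theta>\<close>, \<open>mixed t\<close>
  from the path derivative of \<open>dy g\<close>.\<close>

definition \<eta>'' :: "real \<Rightarrow> 'e ^ 'd ^ 'd" where
  "\<eta>'' = (\<lambda>t. h' t (\<theta> t) + transpose (mixed t) + mixed t + transpose (quadratic t)
     + (\<chi> p q. vdot (dy g t (\<theta> t)) (a' t $ p $ q)))"

definition D\<eta> :: "real \<Rightarrow> 'e ^ 'd ^ 'd" where
  "D\<eta> = (\<lambda>t. Dg t (\<theta> t) + (\<chi> p q. vdot (dy g t (\<theta> t)) (D\<theta> t $ p $ q)))"

definition ventzell_coeff :: "real \<Rightarrow> 'e ^ 'd ^ 'd" where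
  "ventzell_coeff = (\<lambda>t. f t (\<theta> t) + (\<chi> p q. vdot (dy g t (\<theta> t)) (b t $ p $ q)) + (1/2) *\<^sub>R quadratic t + mixed t)"

lemma C12: "C12_loc T \<alpha> \<beta> \<omega> g" "C12_loc T \<alpha> \<beta> \<omega> h" "C12_loc T \<alpha> \<beta> \<omega> (dy g)"
  using g(1) unfolding C23_loc_def h_eq by auto

lemma a_deriv: "has_path_deriv T \<alpha> \<beta> \<omega> \<theta> a" and a'_deriv: "has_path_deriv T \<alpha> \<beta> \<omega> a a'"
  using theta(1) unfolding C2_path_def C1_path_iff a_eq[symmetric] a'_def[symmetric] by auto

lemma path_deriv_mat_a: "path_deriv_mat T \<alpha> \<beta> \<omega> a t = transpose (a' t)"
  unfolding path_deriv_mat_def a'_def ..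

lemma d\<omega>_mat_h: "d\<omega>_mat T \<alpha> \<beta> \<omega> h t y = transpose (h' t y)"
  unfolding d\<omega>_mat_def path_deriv_mat_def h'_def d\<omega>_def ..

lemma theta_differential: "rough_differential T \<alpha> \<beta> \<omega> W \<theta> a b"
  using theta(2) unfolding has_time_deriv_def a_eq b_eq path_deriv2_def by blast

lemma g_differential: "rough_differential T \<alpha> \<beta> \<omega> W (\<lambda>t. g t y) (\<lambda>t. h t y) (\<lambda>t. f t y)"
  using g(2) unfolding has_time_deriv_loc_def has_time_deriv_def h_eq f_eq path_deriv2_def d\<omega>_def d\<omega>_mat_def by simp

lemma theta_increment: "incO T \<alpha> {()} (\<lambda>_ s t. \<theta> t - \<theta> s)"
  by (rule has_path_deriv_increment_O[OF a_deriv])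

lemma a_hoelder: "incO T \<beta> {()} (\<lambda>_ s t. a t - a s)" and a'_hoelder: "incO T \<beta> {()} (\<lambda>_ s t. a' t - a' s)"
  using a_deriv a'_deriv unfolding has_path_deriv_iff by auto

lemma b_hoelder: "incO T \<beta> {()} (\<lambda>_ s t. b t - b s)"
  using theta_differential hoelder_iff[OF exponents'(2), of T b] unfolding rough_differential_def by blast

lemma a_bounded: "incO T 0 {()} (\<lambda>_ s t. a s)"
  by (rule incO_imp_bounded(1)[OF a_hoelder less_imp_le[OF exponents'(2)]])

lemma theta_expansion:
  "incO T (2 * \<alpha> + \<beta>) {()} (\<lambda>_ s t. \<theta> t - \<theta> s - rough_germ \<omega> W a a' s t - bracket_germ \<omega> W b s t)"
  using theta_differential a'_deriv b_hoelder a'_hoelder unfolding has_path_deriv_iff a'_def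
  by (intro rough_differential_expansion[of "{()}" "\<lambda>_. \<theta>" "\<lambda>_. a" "\<lambda>_. b"]) auto

lemma theta_controlled: "incO T (\<alpha> + \<beta>) {()} (\<lambda>_ s t. \<theta> t - \<theta> s - vdot (a s) (\<omega> t - \<omega> s))"
  using a_deriv unfolding has_path_deriv_iff path_remainder_def by blast

lemma g_expansion:
  assumes M: "\<theta> ` {0..T} \<subseteq> cball 0 M"
  shows "incO T (2 * \<alpha> + \<beta>) {()} (\<lambda>_ s t. g t (\<theta> s) - g s (\<theta> s)
    - rough_germ \<omega> W (\<lambda>r. h r (\<theta> s)) (\<lambda>r. h' r (\<theta> s)) s t - bracket_germ \<omega> W (\<lambda>r. f r (\<theta> s)) s t)"
proof -
  have cp: "\<And>y. C1_path T \<alpha> \<beta> \<omega> (\<lambda>t. h t y)" and cc: "ctrl_cont T \<alpha> \<beta> \<omega> h"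
    using C12(2) unfolding C12_loc_def by auto
  note u = ctrl_cont_uniform[OF cp cc compact_cball[of 0 M], folded h'_def]
  have h'e: "(\<lambda>t. h' t y) = path_deriv T \<alpha> \<beta> \<omega> (\<lambda>t. h t y)" for y
    unfolding h'_def d\<omega>_def ..
  have Dg: "incO T \<beta> (cball 0 M) (\<lambda>y s t. Dg t y - Dg s y)"
    using g(2) unfolding has_time_deriv_loc_def C1_beta_loc_def by (intro hoelder_cont_uniform compact_cball) auto
  \<comment> \<open>\<open>Dg\<close> is uniformly Hoelder by continuity in the Hoelder norm, the
    path derivative of \<open>h\<close> by continuity in the controlled norm.\<close>
  have fe: "f t y - f s y = (Dg t y - Dg s y) + (1/2) *\<^sub>R transpose (h' t y - h' s y)" for t s y
    unfolding f_eq d\<omega>_mat_h by (simp add: transpose_diff scaleR_diff_right)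
  have "incO T \<beta> (cball 0 M) (\<lambda>y s t. f t y - f s y)"
    unfolding fe by (intro incO_add Dg incO_bounded_linear[OF bounded_linear_scaleR_right]
      incO_bounded_linear[OF bounded_linear_transpose] u(2))
  from rough_differential_expansion[OF g_differential, OF u(1)[unfolded h'e] u(2)[folded h'e, unfolded h'_def d\<omega>_def] this]
  have "incO T (2 * \<alpha> + \<beta>) (cball 0 M) (\<lambda>y s t. g t y - g s y
    - rough_germ \<omega> W (\<lambda>r. h r y) (\<lambda>r. h' r y) s t - bracket_germ \<omega> W (\<lambda>r. f r y) s t)"
    unfolding h'e .
  from incO_subst[OF this, of "{()}" "\<lambda>_ s t. \<theta> s"] show ?thesis
    using M by (simp add: image_subset_iff)
qed

text \<open>The continuity demanded by the general statement holds because \<open>dy g\<close> is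
  itself of class \<open>C12_loc\<close>.\<close>

lemma commute: "t \<in> {0..T} \<Longrightarrow> d\<omega> T \<alpha> \<beta> \<omega> (dy g) t y = transpose (dy h t y)"
  using C12(1,3) unfolding h_eq
  by (intro path_deriv_dy_commute) (auto simp: C12_loc_def C1_beta_loc_def C1_loc_def)

lemma dyg_loc: "C1_loc T (dy g)" "C0_loc T (dy g)" "C0_loc T (dy (dy g))" "C0_loc T (d\<omega> T \<alpha> \<beta> \<omega> (dy g))"
  "C2_loc T (dy g)" "C1_loc T g" "C0_loc T (dy h)"
  using C12 unfolding C12_loc_def C2_loc_def C1_loc_def C1_beta_loc_def by auto

text \<open>\<open>dy g\<close> satisfies \<open>C2_loc\<close>, so its first-order Taylor error is
  quadratic, as the symmetry argument requires.\<close>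

lemma second_derivative_sym:
  assumes "t \<in> {0..T}"
  shows "vdot (vdot (dy (dy g) t y) u) v = vdot (vdot (dy (dy g) t y) v) u"
proof -
  obtain C where "C \<ge> 0" "\<And>r x z. \<lbrakk>r \<in> {0..T}; x \<in> cball y 1; z \<in> cball y 1\<rbrakk> \<Longrightarrow>
      norm (dy g r z - dy g r x - vdot (dy (dy g) r x) (z - x)) \<le> C * norm (z - x) ^ 2"
    using C2_loc_taylor1[OF dyg_loc(5) compact_cball convex_cball] by metis
  then have C: "norm (dy g t z - dy g t y - vdot (dy (dy g) t y) (z - y)) \<le> C * norm (z - y) ^ 2" if "z \<in> cball y 1" for z
    using assms that by simp
  have G: "(g t has_derivative vdot (dy g t x)) (at x)" for x
    using dyg_loc(6) assms unfolding C1_loc_def by (intro has_derivative_dy) auto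
  show ?thesis by (rule second_derivative_symmetric[OF G C])
qed

lemma \<eta>_deriv: "has_path_deriv T \<alpha> \<beta> \<omega> (\<lambda>t. g t (\<theta> t)) \<eta>'"
  using has_path_deriv_compose[OF C12(1) a_deriv] unfolding \<eta>'_def h_eq[symmetric] .

text \<open>The second summand of \<open>\<eta>'\<close> is a product of controlled paths:
  \<open>dy g\<close> along \<open>\<theta>\<close>, differentiated as a composition, and the
  entries of \<open>a\<close>.\<close>

lemma \<eta>_deriv2: "has_path_deriv T \<alpha> \<beta> \<omega> \<eta>' \<eta>''"
proof -
  define U where "U = (\<lambda>t. d\<omega> T \<alpha> \<beta> \<omega> (dy g) t (\<theta> t) + (\<chi> p. vdot (dy (dy g) t (\<theta> t)) (a t $ p)))"
  have U: "has_path_deriv T \<alpha> \<beta> \<omega> (\<lambda>t. dy g t (\<theta> t)) U"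
    using has_path_deriv_compose[OF C12(3) a_deriv] unfolding U_def .
  have "has_path_deriv T \<alpha> \<beta> \<omega> (\<lambda>t. vdot (dy g t (\<theta> t)) (a t $ p))
      (\<lambda>t. \<chi> q. vdot (U t $ q) (a t $ p) + vdot (dy g t (\<theta> t)) ((\<chi> q. a' t $ q $ p) $ q))" for p
    by (rule has_path_deriv_bilinear[OF U has_path_deriv_linear[OF a'_deriv bounded_linear_vec_nth] bounded_bilinear_vdot])
  then have "has_path_deriv T \<alpha> \<beta> \<omega> (\<lambda>t. \<chi> p. vdot (dy g t (\<theta> t)) (a t $ p))
      (\<lambda>t. \<chi> q p. (\<chi> q. vdot (U t $ q) (a t $ p) + vdot (dy g t (\<theta> t)) ((\<chi> q. a' t $ q $ p) $ q)) $ q)"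
    by (intro has_path_deriv_vec) simp
  from has_path_deriv_add[OF has_path_deriv_compose[OF C12(2) a_deriv] this]
  have *: "has_path_deriv T \<alpha> \<beta> \<omega> \<eta>' (\<lambda>t. (h' t (\<theta> t) + (\<chi> q. vdot (dy h t (\<theta> t)) (a t $ q)))
      + (\<chi> q p. vdot (U t $ q) (a t $ p) + vdot (dy g t (\<theta> t)) (a' t $ q $ p)))"
    unfolding \<eta>'_def h'_def by simp
  show ?thesis
  proof (rule iffD1[OF has_path_deriv_cong[OF refl _ exponents'(2)] *])
    fix t assume t: "t \<in> {0..T}"
    \<comment> \<open>Commutation rewrites the path derivative of \<open>dy g\<close> by
      \<open>dy h\<close>, which gives the second occurrence of the mixed term.\<close>
    have "vdot (U t $ q) (a t $ p) = vdot (dy h t (\<theta> t)) (a t $ p) $ q + vdot (vdot (dy (dy g) t (\<theta> t)) (a t $ q)) (a t $ p)" for p q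
      unfolding U_def commute[OF t] by (simp add: vdot.add_left vdot_vec_nth transpose_def)
    then show "h' t (\<theta> t) + (\<chi> q. vdot (dy h t (\<theta> t)) (a t $ q))
      + (\<chi> q p. vdot (U t $ q) (a t $ p) + vdot (dy g t (\<theta> t)) (a' t $ q $ p)) = \<eta>'' t"
      unfolding \<eta>''_def mixed_def quadratic_def by (simp add: vec_eq_iff transpose_def)
  qed
qed

lemma transpose_quadratic: "t \<in> {0..T} \<Longrightarrow> transpose (quadratic t) = quadratic t"
  unfolding quadratic_def using second_derivative_sym by (simp add: vec_eq_iff transpose_def)

text \<open>The contributions of \<open>area W s t\<close> paired with \<open>mixed\<close> and \<open>quadratic\<close> cancel between the two germs;
  for \<open>quadratic\<close> this uses the symmetry of the second derivative.\<close>

lemma germ_identity: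
  assumes st: "0 \<le> s" "s < t" "t \<le> T"
  defines "x \<equiv> \<omega> t - \<omega> s"
  shows "rough_germ \<omega> W \<eta>' \<eta>'' s t + bracket_germ \<omega> W ventzell_coeff s t =
    (rough_germ \<omega> W (\<lambda>r. h r (\<theta> s)) (\<lambda>r. h' r (\<theta> s)) s t + bracket_germ \<omega> W (\<lambda>r. f r (\<theta> s)) s t)
    + vdot (dy g s (\<theta> s)) (rough_germ \<omega> W a a' s t + bracket_germ \<omega> W b s t)
    + vdot (vdot (dy h s (\<theta> s)) (vdot (a s) x)) x
    + (1/2) *\<^sub>R vdot (vdot (dy (dy g) s (\<theta> s)) (vdot (a s) x)) (vdot (a s) x)"
proof -
  define A where "A = area W s t"
  define B where "B = bracket \<omega> W t - bracket \<omega> W s"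
  have B: "B = outer x x - A - transpose A"
    unfolding B_def A_def x_def using st by (intro bracket_increment) auto
  have s: "s \<in> {0..T}" using st by auto
  have tr: "transpose (\<chi> p q. vdot (dy g s (\<theta> s)) (a' s $ p $ q)) = (\<chi> p q. vdot (dy g s (\<theta> s)) (transpose (a' s) $ p $ q))"
    by (simp add: transpose_def vec_eq_iff)
  \<comment> \<open>\<open>B\<close> contains the area and its transpose with negative sign; they
    cancel the two area pairings of the rough germ, and \<open>outer x x\<close> remains.\<close>
  have m: "ddot (mixed s) (transpose A) + ddot (transpose (mixed s)) (transpose A) + ddot (mixed s) B
      = vdot (vdot (dy h s (\<theta> s)) (vdot (a s) x)) x"
    unfolding B ddot_transpose_transpose ddot.diff_right
    using ddot_outer_mixed[of "dy h s (\<theta> s)" "a s" x] by (simp add: mixed_def)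
  \<comment> \<open>By symmetry of \<open>quadratic\<close>, half of the pairing with
    \<open>A + transpose A\<close> equals the pairing with \<open>transpose A\<close>, so the factor
    \<open>1/2\<close> in the coefficient is the right one.\<close>
  have "ddot (quadratic s) (transpose A) = ddot (quadratic s) A"
    using ddot_transpose_transpose[of "quadratic s" A] transpose_quadratic[OF s] by simp
  then have q: "ddot (quadratic s) (transpose A) + (1/2) *\<^sub>R ddot (quadratic s) B
      = (1/2) *\<^sub>R vdot (vdot (dy (dy g) s (\<theta> s)) (vdot (a s) x)) (vdot (a s) x)"
    unfolding B ddot.diff_right
    using ddot_outer_quadratic[of "dy (dy g) s (\<theta> s)" "a s" x]
    by (simp add: quadratic_def scaleR_diff_right diff_diff_eq half_add_half)
  have 1: "rough_germ \<omega> W \<eta>' \<eta>'' s t = vdot (h s (\<theta> s)) x + vdot (dy g s (\<theta> s)) (vdot (a s) x)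
      + ddot (transpose (h' s (\<theta> s))) (transpose A) + ddot (mixed s) (transpose A) + ddot (transpose (mixed s)) (transpose A)
      + ddot (quadratic s) (transpose A) + vdot (dy g s (\<theta> s)) (ddot (transpose (a' s)) (transpose A))"
    unfolding rough_germ_def A_def[symmetric] x_def[symmetric] \<eta>'_def \<eta>''_def
    by (simp add: vdot.add_left vdot_contract transpose_add ddot.add_left tr ddot_contract)
  have 2: "bracket_germ \<omega> W ventzell_coeff s t = ddot (f s (\<theta> s)) B + vdot (dy g s (\<theta> s)) (ddot (b s) B)
      + (1/2) *\<^sub>R ddot (quadratic s) B + ddot (mixed s) B"
    unfolding bracket_germ_def B_def[symmetric] ventzell_coeff_def
    by (simp add: ddot.add_left ddot.scaleR_left ddot_contract)
  show ?thesis
    unfolding 1 2 m[symmetric] q[symmetric]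
    unfolding rough_germ_def bracket_germ_def A_def[symmetric] x_def[symmetric] B_def[symmetric] vdot.add_right
    by (simp add: algebra_simps)
qed

text \<open>The gradient of \<open>g\<close> multiplies one increment and therefore needs its
  controlled expansion; the Hessian multiplies two, so an error of order \<alpha> in it is
  affordable.\<close>

lemma \<eta>_expansion:
  "incO T (2 * \<alpha> + \<beta>) {()} (\<lambda>_ s t. g t (\<theta> t) - g s (\<theta> s) - rough_germ \<omega> W \<eta>' \<eta>'' s t
    - bracket_germ \<omega> W ventzell_coeff s t)"
proof -
  obtain M where M: "\<theta> ` {0..T} \<subseteq> cball 0 M"
    using path_in_cball[OF theta_increment] by blast
  have cp: "\<And>y. C1_path T \<alpha> \<beta> \<omega> (\<lambda>t. dy g t y)" "ctrl_cont T \<alpha> \<beta> \<omega> (dy g)"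
    "\<And>y. C1_path T \<alpha> \<beta> \<omega> (\<lambda>t. dy (dy g) t y)" "ctrl_cont T \<alpha> \<beta> \<omega> (dy (dy g))"
    using C12(1,3) unfolding C12_loc_def by auto
  note dbase = C12_loc_base_point[OF cp(1,2) M] and ddbase = C12_loc_base_point[OF cp(3,4) M]
  let ?\<zeta> = "2 * \<alpha> + \<beta>"
  let ?v = "\<lambda>s t. \<theta> t - \<theta> s" and ?x = "\<lambda>s t. \<omega> t - \<omega> s"
  let ?k = "\<lambda>s. d\<omega> T \<alpha> \<beta> \<omega> (dy g) s (\<theta> s)" and ?H = "\<lambda>t s. dy (dy g) t (\<theta> s)"
  let ?ax = "\<lambda>s t. vdot (a s) (?x s t)"
  note bv = bounded_bilinear_vdot
  note half = incO_bounded_linear[OF bounded_linear_scaleR_right[of "1/2"]]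
  have ax: "incO T \<alpha> {()} (\<lambda>_ s t. ?ax s t)"
    by (rule incO_bounded_mult[OF bv a_bounded omega_O])
  define E0 where "E0 = (\<lambda>s t. g t (\<theta> s) - g s (\<theta> s)
    - rough_germ \<omega> W (\<lambda>r. h r (\<theta> s)) (\<lambda>r. h' r (\<theta> s)) s t - bracket_germ \<omega> W (\<lambda>r. f r (\<theta> s)) s t)"
  define E1 where "E1 = (\<lambda>s t. g t (\<theta> t) - g t (\<theta> s) - vdot (dy g t (\<theta> s)) (?v s t)
    - (1/2) *\<^sub>R vdot (vdot (?H t s) (?v s t)) (?v s t))"
  define E2 where "E2 = (\<lambda>s t. vdot (dy g s (\<theta> s)) (?v s t - rough_germ \<omega> W a a' s t - bracket_germ \<omega> W b s t))"
  define E3 where "E3 = (\<lambda>s t. vdot (dy g t (\<theta> s) - dy g s (\<theta> s) - vdot (?k s) (?x s t)) (?v s t))"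
  define E4 where "E4 = (\<lambda>s t. vdot (vdot (?k s) (?x s t)) (?v s t - ?ax s t))"
  define E5 where "E5 = (\<lambda>s t. (1/2) *\<^sub>R vdot (vdot (?H t s - ?H s s) (?v s t)) (?v s t))"
  define E6 where "E6 = (\<lambda>s t. (1/2) *\<^sub>R (vdot (vdot (?H s s) (?v s t - ?ax s t)) (?v s t)
    + vdot (vdot (?H s s) (?ax s t)) (?v s t - ?ax s t)))"
  have O0: "incO T ?\<zeta> {()} (\<lambda>_ s t. E0 s t)"
    unfolding E0_def by (rule g_expansion[OF M])
  have O1: "incO T ?\<zeta> {()} (\<lambda>_ s t. E1 s t)"
    unfolding E1_def using exponents
    by (intro incO_mono[OF compose_taylor2[OF dyg_loc(6,5) M theta_increment] _ T_pos]) simp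
  have O2: "incO T ?\<zeta> {()} (\<lambda>_ s t. E2 s t)"
    unfolding E2_def by (rule incO_bounded_mult[OF bv compose_bounded(1)[OF dyg_loc(2) M] theta_expansion])
  have O3: "incO T ?\<zeta> {()} (\<lambda>_ s t. E3 s t)"
    unfolding E3_def using incO_bilinear[OF bv dbase(1) theta_increment] by (simp add: algebra_simps)
  have O4: "incO T ?\<zeta> {()} (\<lambda>_ s t. E4 s t)"
    unfolding E4_def
    using incO_bilinear[OF bv incO_bounded_mult[OF bv compose_bounded(1)[OF dyg_loc(4) M] omega_O] theta_controlled]
    by (simp add: algebra_simps)
  have O5: "incO T ?\<zeta> {()} (\<lambda>_ s t. E5 s t)"
    unfolding E5_def using exponents
    by (intro half incO_mono[OF incO_bilinear[OF bv incO_bilinear[OF bv ddbase(2) theta_increment] theta_increment] _ T_pos]) simp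
  have O6: "incO T ?\<zeta> {()} (\<lambda>_ s t. E6 s t)"
    unfolding E6_def
  proof (intro half incO_add)
    show "incO T ?\<zeta> {()} (\<lambda>_ s t. vdot (vdot (?H s s) (?v s t - ?ax s t)) (?v s t))"
      using incO_bilinear[OF bv incO_bounded_mult[OF bv compose_bounded(1)[OF dyg_loc(3) M] theta_controlled] theta_increment]
      by (simp add: algebra_simps)
    show "incO T ?\<zeta> {()} (\<lambda>_ s t. vdot (vdot (?H s s) (?ax s t)) (?v s t - ?ax s t))"
      using incO_bilinear[OF bv incO_bounded_mult[OF bv compose_bounded(1)[OF dyg_loc(3) M] ax] theta_controlled]
      by (simp add: algebra_simps)
  qed
  have sum: "g t (\<theta> t) - g s (\<theta> s) - rough_germ \<omega> W \<eta>' \<eta>'' s t - bracket_germ \<omega> W ventzell_coeff s t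
    = E0 s t + E1 s t + E2 s t + E3 s t + E4 s t + E5 s t + E6 s t" if st: "0 \<le> s" "s < t" "t \<le> T" for s t
  proof -
    \<comment> \<open>Commutation, together with exchanging the order of contraction, produces the
      mixed term of \<open>germ_identity\<close>.\<close>
    have k: "vdot (vdot (?k s) (?x s t)) (?ax s t) = vdot (vdot (dy h s (\<theta> s)) (?ax s t)) (?x s t)"
      using st by (subst commute) (auto simp: vdot_transpose)
    have "g t (\<theta> t) - g s (\<theta> s) - rough_germ \<omega> W \<eta>' \<eta>'' s t - bracket_germ \<omega> W ventzell_coeff s t
      = g t (\<theta> t) - g s (\<theta> s) - (rough_germ \<omega> W \<eta>' \<eta>'' s t + bracket_germ \<omega> W ventzell_coeff s t)" by simp
    also have "\<dots> = E0 s t + E1 s t + E2 s t + E3 s t + E4 s t + E5 s t + E6 s t"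
      unfolding germ_identity[OF st] E0_def E1_def E2_def E3_def E4_def E5_def E6_def k[symmetric]
      by (simp only: vdot.diff_left vdot.diff_right vdot.add_right scaleR_add_right scaleR_diff_right)
        (simp add: algebra_simps)
    finally show ?thesis .
  qed
  show ?thesis
    by (rule iffD2[OF incO_cong[OF sum]]) (auto intro!: incO_add O0 O1 O2 O3 O4 O5 O6)
qed

section \<open>From the expansion to the two formulas\<close>

lemma D\<eta>_hoelder: "incO T \<beta> {()} (\<lambda>_ s t. D\<eta> t - D\<eta> s)"
  and mixed_hoelder: "incO T \<beta> {()} (\<lambda>_ s t. mixed t - mixed s)"
proof -
  obtain M where M: "\<theta> ` {0..T} \<subseteq> cball 0 M"
    using path_in_cball[OF theta_increment] by blast
  have Dth: "incO T \<beta> {()} (\<lambda>_ s t. D\<theta> t - D\<theta> s)"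
    using theta(2) unfolding has_time_deriv_def hoelder_iff[OF exponents'(2)] by blast
  note Dthb = incO_imp_bounded(1)[OF Dth less_imp_le[OF exponents'(2)]]
  have "incO T \<beta> {()} (\<lambda>_ s t. vdot (dy g t (\<theta> t)) (D\<theta> t $ p $ q) - vdot (dy g s (\<theta> s)) (D\<theta> s $ p $ q))" for p q
    using Dth Dthb unfolding incO_vec
    by (intro incO_bilinear_paths[OF bounded_bilinear_vdot compose_dy_hoelder[OF C12(1) M theta_increment] _
      compose_bounded(3)[OF dyg_loc(2) M]]) (auto simp: incO_vec)
  then have "incO T \<beta> {()} (\<lambda>_ s t. (\<chi> p q. vdot (dy g t (\<theta> t)) (D\<theta> t $ p $ q)) - (\<chi> p q. vdot (dy g s (\<theta> s)) (D\<theta> s $ p $ q)))"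
    unfolding incO_vec by simp
  moreover have "incO T \<beta> {()} (\<lambda>_ s t. Dg t (\<theta> t) - Dg s (\<theta> s))"
    using g(2) unfolding has_time_deriv_loc_def by (intro compose_hoelder[OF _ M theta_increment]) auto
  ultimately show "incO T \<beta> {()} (\<lambda>_ s t. D\<eta> t - D\<eta> s)"
    unfolding D\<eta>_def using incO_add by (fastforce simp: algebra_simps)
  have "incO T \<beta> {()} (\<lambda>_ s t. vdot (dy h t (\<theta> t)) (a t $ q) - vdot (dy h s (\<theta> s)) (a s $ q))" for q
    using incO_bilinear_paths[OF bounded_bilinear_vdot compose_dy_hoelder[OF C12(2) M theta_increment] _
        compose_bounded(3)[OF dyg_loc(7) M], of "\<lambda>_ t. a t $ q"]
      iffD1[OF incO_vec a_hoelder, THEN spec, of q] iffD1[OF incO_vec a_bounded, THEN spec, of q] by simp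
  then show "incO T \<beta> {()} (\<lambda>_ s t. mixed t - mixed s)"
    unfolding mixed_def by (simp add: incO_vec)
qed

text \<open>Half of the transposed \<open>\<eta>''\<close> contains the mixed term in symmetrized
  form, while the Ito--Ventzell coefficient contains it as it stands; the discrepancy is the
  antisymmetric last summand.\<close>

lemma ventzell_coeff_eq:
  assumes t: "t \<in> {0..T}"
  shows "ventzell_coeff t = D\<eta> t + (1/2) *\<^sub>R transpose (\<eta>'' t) + (1/2) *\<^sub>R (mixed t - transpose (mixed t))"
  unfolding ventzell_coeff_def D\<eta>_def \<eta>''_def
  unfolding f_eq b_eq path_deriv_mat_a d\<omega>_mat_h transpose_add transpose_quadratic[OF t]
  by (simp add: vec_eq_iff transpose_def vdot.add_right vdot.scaleR_right algebra_simps half_add_half)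

lemma ito_ventzell_differential: "rough_differential T \<alpha> \<beta> \<omega> W (\<lambda>t. g t (\<theta> t)) \<eta>' ventzell_coeff"
proof (rule rough_differentialI[OF \<eta>_deriv2 _ \<eta>_expansion])
  have e: "incO T \<beta> {()} (\<lambda>_ s t. \<eta>'' t - \<eta>'' s)"
    using \<eta>_deriv2 unfolding has_path_deriv_iff by blast
  \<comment> \<open>The coefficient is estimated through its decomposition: \<open>\<eta>''\<close>
    is Hoelder as a path derivative, which covers \<open>quadratic\<close> as well.\<close>
  have "incO T \<beta> {()} (\<lambda>_ s t. (D\<eta> t - D\<eta> s) + (1/2) *\<^sub>R transpose (\<eta>'' t - \<eta>'' s)
      + (1/2) *\<^sub>R ((mixed t - mixed s) - transpose (mixed t - mixed s)))"
    by (rule incO_add[OF incO_add[OF D\<eta>_hoelder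
          incO_bounded_linear[OF bounded_linear_scaleR_right incO_bounded_linear[OF bounded_linear_transpose e]]]
        incO_bounded_linear[OF bounded_linear_scaleR_right
          incO_diff[OF mixed_hoelder incO_bounded_linear[OF bounded_linear_transpose mixed_hoelder]]]])
  then show "incO T \<beta> {()} (\<lambda>_ s t. ventzell_coeff t - ventzell_coeff s)"
    by (rule iffD2[OF incO_cong, rotated]) (simp add: ventzell_coeff_eq transpose_diff algebra_simps)
qed

lemma path_deriv_\<eta>: "t \<in> {0..T} \<Longrightarrow> path_deriv T \<alpha> \<beta> \<omega> (\<lambda>t. g t (\<theta> t)) t = \<eta>' t"
  by (rule path_deriv_eq[OF \<eta>_deriv])

lemma \<eta>_deriv2': "has_path_deriv T \<alpha> \<beta> \<omega> (path_deriv T \<alpha> \<beta> \<omega> (\<lambda>t. g t (\<theta> t))) \<eta>''"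
  by (rule iffD2[OF has_path_deriv_cong[OF path_deriv_\<eta> refl exponents'(2)] \<eta>_deriv2])

lemma path_deriv2_\<eta>: "t \<in> {0..T} \<Longrightarrow> path_deriv2 T \<alpha> \<beta> \<omega> (\<lambda>t. g t (\<theta> t)) t = transpose (\<eta>'' t)"
  unfolding path_deriv2_def path_deriv_mat_def by (simp add: path_deriv_eq[OF \<eta>_deriv2'])

lemma ddot_antisymmetric_bracket:
  assumes "0 \<le> s" "s \<le> t" "t \<le> T"
  shows "ddot (A - transpose A) (bracket \<omega> W t - bracket \<omega> W s) = 0"
proof -
  let ?B = "bracket \<omega> W t - bracket \<omega> W s"
  have "transpose ?B = ?B"
    unfolding bracket_increment[OF assms] transpose_diff by (simp add: transpose_outer)
  then have "ddot (transpose A) ?B = ddot A ?B"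
    using ddot_transpose_transpose[of A ?B] by simp
  then show ?thesis by (simp add: ddot.diff_left)
qed

lemma time_derivs_symmetric:
  assumes "t \<in> {0..T}"
  shows "Dg t y $ q $ p = Dg t y $ p $ q" "D\<theta> t $ q $ p = D\<theta> t $ p $ q"
proof -
  have "transpose (Dg t y) = Dg t y" "transpose (D\<theta> t) = D\<theta> t"
    using theta(2) g(2) assms unfolding has_time_deriv_def has_time_deriv_loc_def by auto
  then have "transpose (Dg t y) $ p $ q = Dg t y $ p $ q" "transpose (D\<theta> t) $ p $ q = D\<theta> t $ p $ q"
    by (simp_all only:)
  then show "Dg t y $ q $ p = Dg t y $ p $ q" "D\<theta> t $ q $ p = D\<theta> t $ p $ q"
    unfolding transpose_def by (simp_all only: vec_lambda_beta)
qed

text \<open>The expansion already proved is reused: exchanging the bracket coefficient for the one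
  with \<open>D\<eta>\<close> leaves every bracket germ unchanged.\<close>

lemma \<eta>_time_deriv: "has_time_deriv T \<alpha> \<beta> \<omega> W (\<lambda>t. g t (\<theta> t)) D\<eta>"
  unfolding has_time_deriv_def
proof (intro conjI)
  let ?\<eta> = "\<lambda>t. g t (\<theta> t)"
  let ?c = "\<lambda>t. D\<eta> t + (1/2) *\<^sub>R path_deriv2 T \<alpha> \<beta> \<omega> ?\<eta> t"
  show "hoelder T \<beta> D\<eta>"
    using D\<eta>_hoelder hoelder_iff[OF exponents'(2)] by blast
  show "\<forall>t\<in>{0..T}. transpose (D\<eta> t) = D\<eta> t"
    unfolding D\<eta>_def by (simp add: vec_eq_iff transpose_def time_derivs_symmetric)
  show "rough_differential T \<alpha> \<beta> \<omega> W ?\<eta> (path_deriv T \<alpha> \<beta> \<omega> ?\<eta>) ?c"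
  proof (rule rough_differentialI[OF \<eta>_deriv2'])
    have e: "incO T \<beta> {()} (\<lambda>_ s t. \<eta>'' t - \<eta>'' s)"
      using \<eta>_deriv2 unfolding has_path_deriv_iff by blast
    have "incO T \<beta> {()} (\<lambda>_ s t. (D\<eta> t - D\<eta> s) + (1/2) *\<^sub>R transpose (\<eta>'' t - \<eta>'' s))"
      by (rule incO_add[OF D\<eta>_hoelder
          incO_bounded_linear[OF bounded_linear_scaleR_right incO_bounded_linear[OF bounded_linear_transpose e]]])
    then show "incO T \<beta> {()} (\<lambda>_ s t. ?c t - ?c s)"
      by (rule iffD2[OF incO_cong, rotated]) (simp add: path_deriv2_\<eta> transpose_diff algebra_simps)
    \<comment> \<open>The coefficients differ by a multiple of
      \<open>mixed s - transpose (mixed s)\<close>, which the symmetric bracket increment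
      annihilates.\<close>
    have germ: "rough_germ \<omega> W (path_deriv T \<alpha> \<beta> \<omega> ?\<eta>) \<eta>'' s t = rough_germ \<omega> W \<eta>' \<eta>'' s t"
      "bracket_germ \<omega> W ?c s t = bracket_germ \<omega> W ventzell_coeff s t" if st: "0 \<le> s" "s < t" "t \<le> T" for s t
    proof -
      have s: "s \<in> {0..T}" using st by auto
      show "rough_germ \<omega> W (path_deriv T \<alpha> \<beta> \<omega> ?\<eta>) \<eta>'' s t = rough_germ \<omega> W \<eta>' \<eta>'' s t"
        unfolding rough_germ_def path_deriv_\<eta>[OF s] ..
      show "bracket_germ \<omega> W ?c s t = bracket_germ \<omega> W ventzell_coeff s t"
        unfolding bracket_germ_def ventzell_coeff_eq[OF s] path_deriv2_\<eta>[OF s]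
        using ddot_antisymmetric_bracket[of s t "mixed s"] st
        by (simp add: ddot.add_left ddot.scaleR_left)
    qed
    show "incO T (2 * \<alpha> + \<beta>) {()} (\<lambda>_ s t. ?\<eta> t - ?\<eta> s
        - rough_germ \<omega> W (path_deriv T \<alpha> \<beta> \<omega> ?\<eta>) \<eta>'' s t - bracket_germ \<omega> W ?c s t)"
      by (rule iffD2[OF incO_cong \<eta>_expansion]) (simp add: germ)
  qed
qed

lemma \<eta>_C2: "C2_path T \<alpha> \<beta> \<omega> W (\<lambda>t. g t (\<theta> t))"
  unfolding C2_path_def using \<eta>_deriv \<eta>_deriv2' \<eta>_time_deriv by (auto simp: C1_path_def)

lemma ventzell_coeff_entries:
  "ventzell_coeff t = (\<chi> p q. f t (\<theta> t) $ p $ q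
          + (\<Sum>k\<in>UNIV. b t $ p $ q $ k *\<^sub>R dy g t (\<theta> t) $ k)
          + (1/2) *\<^sub>R (\<Sum>k\<in>UNIV. \<Sum>l\<in>UNIV.
              (a t $ p $ k * a t $ q $ l) *\<^sub>R dy (dy g) t (\<theta> t) $ l $ k)
          + (\<Sum>k\<in>UNIV. a t $ q $ k *\<^sub>R dy h t (\<theta> t) $ k $ p))"
  unfolding ventzell_coeff_def quadratic_def mixed_def vdot_def
  by (simp add: vec_eq_iff sum_component scaleR_sum_right)

lemma path_deriv2_entries:
  assumes "t \<in> {0..T}"
  shows "path_deriv2 T \<alpha> \<beta> \<omega> (\<lambda>t. g t (\<theta> t)) t $ p $ q =
        d\<omega>_mat T \<alpha> \<beta> \<omega> h t (\<theta> t) $ p $ q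
        + (\<Sum>k\<in>UNIV. a t $ q $ k *\<^sub>R dy h t (\<theta> t) $ k $ p)
        + (\<Sum>k\<in>UNIV. a t $ p $ k *\<^sub>R dy h t (\<theta> t) $ k $ q)
        + (\<Sum>k\<in>UNIV. \<Sum>l\<in>UNIV. (a t $ p $ k * a t $ q $ l) *\<^sub>R dy (dy g) t (\<theta> t) $ l $ k)
        + (\<Sum>k\<in>UNIV. path_deriv_mat T \<alpha> \<beta> \<omega> a t $ p $ q $ k *\<^sub>R dy g t (\<theta> t) $ k)"
  unfolding path_deriv2_\<eta>[OF assms] d\<omega>_mat_h path_deriv_mat_a \<eta>''_def quadratic_def mixed_def vdot_def
  by (simp add: transpose_def sum_component scaleR_sum_right)

lemma \<eta>'_entries: "\<eta>' = (\<lambda>t. h t (\<theta> t) + (\<chi> p. \<Sum>k\<in>UNIV. a t $ p $ k *\<^sub>R dy g t (\<theta> t) $ k))"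
  unfolding \<eta>'_def vdot_def ..

lemma D\<eta>_entries: "D\<eta> = (\<lambda>t. Dg t (\<theta> t) + (\<chi> p q. \<Sum>k\<in>UNIV. D\<theta> t $ p $ q $ k *\<^sub>R dy g t (\<theta> t) $ k))"
  unfolding D\<eta>_def vdot_def ..

text \<open>Subtracting the halved path derivatives from \<open>f\<close> and \<open>b\<close>
  recovers \<open>Dg\<close> and \<open>D\<theta>\<close>, which are symmetric on
  \<open>{0..T}\<close>, so symmetrization reproduces them.\<close>

lemma D\<eta>_symmetrized:
  assumes "t \<in> {0..T}"
  shows "D\<eta> t = (let F = f t (\<theta> t) - (1/2) *\<^sub>R d\<omega>_mat T \<alpha> \<beta> \<omega> h t (\<theta> t);
             B = b t - (1/2) *\<^sub>R path_deriv_mat T \<alpha> \<beta> \<omega> a t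
         in (1/2) *\<^sub>R (F + transpose F
              + (\<chi> p q. \<Sum>k\<in>UNIV. (B + transpose B) $ p $ q $ k *\<^sub>R dy g t (\<theta> t) $ k)))"
proof -
  have F: "f t (\<theta> t) - (1/2) *\<^sub>R d\<omega>_mat T \<alpha> \<beta> \<omega> h t (\<theta> t) = Dg t (\<theta> t)"
    and B: "b t - (1/2) *\<^sub>R path_deriv_mat T \<alpha> \<beta> \<omega> a t = D\<theta> t"
    unfolding f_eq b_eq by simp_all
  have tr: "transpose (Dg t (\<theta> t)) = Dg t (\<theta> t)" "transpose (D\<theta> t) = D\<theta> t"
    using time_derivs_symmetric[OF assms] by (simp_all add: vec_eq_iff transpose_def)
  have e: "vdot c ((D\<theta> t + D\<theta> t) $ p $ q) = vdot c (D\<theta> t $ p $ q) + vdot c (D\<theta> t $ p $ q)" for c :: "'e ^ 'm" and p q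
    by (simp only: vector_add_component vdot.add_right)
  show ?thesis
    unfolding Let_def F B tr vdot_def[symmetric] e D\<eta>_def
    by (simp add: vec_eq_iff scaleR_add_right half_add_half)
qed

lemma ito_ventzell_formula: "ito_ventzell T \<alpha> \<beta> \<omega> W \<theta> a b g h f"
  using ito_ventzell_differential
  unfolding ito_ventzell_def \<eta>'_entries ventzell_coeff_entries[abs_def] .

lemma chain_rule: "path_chain_rule T \<alpha> \<beta> \<omega> W \<theta> D\<theta> g Dg"
  unfolding path_chain_rule_def D\<eta>_entries[symmetric]
proof (intro conjI ballI \<eta>_C2 \<eta>_time_deriv)
  fix t assume "t \<in> {0..T}"
  from path_deriv_\<eta>[OF this] show "path_deriv T \<alpha> \<beta> \<omega> (\<lambda>t. g t (\<theta> t)) t = d\<omega> T \<alpha> \<beta> \<omega> g t (\<theta> t)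
        + (\<chi> p. \<Sum>k\<in>UNIV. path_deriv T \<alpha> \<beta> \<omega> \<theta> t $ p $ k *\<^sub>R dy g t (\<theta> t) $ k)"
    unfolding \<eta>'_entries by (simp only: h_eq a_eq)
qed

end

theorem mainTheorem2:
  fixes T \<alpha> \<beta> :: real
    and \<omega> :: "real \<Rightarrow> real ^ 'd"
    and W :: "real \<Rightarrow> real \<Rightarrow> real ^ 'd ^ 'd"
    and \<theta> :: "real \<Rightarrow> real ^ 'm"
    and D\<theta> b :: "real \<Rightarrow> (real ^ 'm) ^ 'd ^ 'd"
    and a :: "real \<Rightarrow> (real ^ 'm) ^ 'd"
    and g :: "real \<Rightarrow> real ^ 'm \<Rightarrow> 'e::euclidean_space"
    and Dg f :: "real \<Rightarrow> real ^ 'm \<Rightarrow> 'e ^ 'd ^ 'd"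
    and h :: "real \<Rightarrow> real ^ 'm \<Rightarrow> 'e ^ 'd"
    and \<eta> :: "real \<Rightarrow> 'e"
    and D\<eta> :: "real \<Rightarrow> 'e ^ 'd ^ 'd"
  assumes "T > 0"
    and "1/3 < \<alpha>" and "\<alpha> < 1/2" and "1 - 2 * \<alpha> < \<beta>" and "\<beta> \<le> \<alpha>"
    and "rough_path T \<alpha> \<omega> W"
    and "unique_path_deriv T \<alpha> \<beta> \<omega>"
    and "C2_path T \<alpha> \<beta> \<omega> W \<theta>" and "has_time_deriv T \<alpha> \<beta> \<omega> W \<theta> D\<theta>"
    and "C23_loc T \<alpha> \<beta> \<omega> W g" and "has_time_deriv_loc T \<alpha> \<beta> \<omega> W g Dg"
    and \<eta>_eq: "\<eta> = (\<lambda>t. g t (\<theta> t))"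
    and a_eq: "a = path_deriv T \<alpha> \<beta> \<omega> \<theta>"
    and b_eq: "b = (\<lambda>t. D\<theta> t + (1/2) *\<^sub>R path_deriv_mat T \<alpha> \<beta> \<omega> a t)"
    and h_eq: "h = d\<omega> T \<alpha> \<beta> \<omega> g"
    and f_eq: "f = (\<lambda>t y. Dg t y + (1/2) *\<^sub>R d\<omega>_mat T \<alpha> \<beta> \<omega> h t y)"
    and D\<eta>_eq: "D\<eta> = (\<lambda>t. Dg t (\<theta> t)
               + (\<chi> p q. \<Sum>k\<in>UNIV. D\<theta> t $ p $ q $ k *\<^sub>R dy g t (\<theta> t) $ k))"
  shows
    "rough_differential T \<alpha> \<beta> \<omega> W \<theta> a b \<and>
     (\<forall>y. rough_differential T \<alpha> \<beta> \<omega> W (\<lambda>t. g t y) (\<lambda>t. h t y) (\<lambda>t. f t y)) \<and>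
     (path_chain_rule T \<alpha> \<beta> \<omega> W \<theta> D\<theta> g Dg \<longleftrightarrow> ito_ventzell T \<alpha> \<beta> \<omega> W \<theta> a b g h f) \<and>
     path_chain_rule T \<alpha> \<beta> \<omega> W \<theta> D\<theta> g Dg \<and>
     (\<forall>t\<in>{0..T}. \<forall>y. d\<omega> T \<alpha> \<beta> \<omega> (dy g) t y = transpose (dy h t y)) \<and>
     C2_path T \<alpha> \<beta> \<omega> W \<eta> \<and>
     (\<forall>t\<in>{0..T}. \<forall>p. path_deriv T \<alpha> \<beta> \<omega> \<eta> t $ p =
        h t (\<theta> t) $ p + (\<Sum>k\<in>UNIV. a t $ p $ k *\<^sub>R dy g t (\<theta> t) $ k)) \<and>
     (\<forall>t\<in>{0..T}. \<forall>p q. path_deriv2 T \<alpha> \<beta> \<omega> \<eta> t $ p $ q =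
        d\<omega>_mat T \<alpha> \<beta> \<omega> h t (\<theta> t) $ p $ q
        + (\<Sum>k\<in>UNIV. a t $ q $ k *\<^sub>R dy h t (\<theta> t) $ k $ p)
        + (\<Sum>k\<in>UNIV. a t $ p $ k *\<^sub>R dy h t (\<theta> t) $ k $ q)
        + (\<Sum>k\<in>UNIV. \<Sum>l\<in>UNIV. (a t $ p $ k * a t $ q $ l) *\<^sub>R dy (dy g) t (\<theta> t) $ l $ k)
        + (\<Sum>k\<in>UNIV. path_deriv_mat T \<alpha> \<beta> \<omega> a t $ p $ q $ k *\<^sub>R dy g t (\<theta> t) $ k)) \<and>
     has_time_deriv T \<alpha> \<beta> \<omega> W \<eta> D\<eta> \<and>
     (\<forall>t\<in>{0..T}. D\<eta> t =
        (let F = f t (\<theta> t) - (1/2) *\<^sub>R d\<omega>_mat T \<alpha> \<beta> \<omega> h t (\<theta> t);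
             B = b t - (1/2) *\<^sub>R path_deriv_mat T \<alpha> \<beta> \<omega> a t
         in (1/2) *\<^sub>R (F + transpose F
              + (\<chi> p q. \<Sum>k\<in>UNIV. (B + transpose B) $ p $ q $ k *\<^sub>R dy g t (\<theta> t) $ k)))) \<and>
     ito_ventzell T \<alpha> \<beta> \<omega> W \<theta> a b g h f"
proof -
  have "rough_path0 T \<alpha> \<omega> W" using assms(6) unfolding rough_path_def by blast
  then interpret C: path_composition T \<alpha> \<beta> \<omega> W \<theta> D\<theta> b a g Dg f h
    using assms by unfold_locales
  have D\<eta>: "D\<eta> = C.D\<eta>"
    unfolding D\<eta>_eq C.D\<eta>_entries ..
  show ?thesis
    unfolding \<eta>_eq D\<eta>
  \<comment> \<open>Both directions of the equivalence are closed by the unconditional proofs of its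
    two sides.\<close>
  proof (intro conjI allI ballI iffI C.theta_differential C.g_differential C.chain_rule
      C.ito_ventzell_formula C.commute C.\<eta>_C2 C.path_deriv2_entries C.\<eta>_time_deriv C.D\<eta>_symmetrized)
    fix t p assume "t \<in> {0..T}"
    from C.path_deriv_\<eta>[OF this]
    show "path_deriv T \<alpha> \<beta> \<omega> (\<lambda>t. g t (\<theta> t)) t $ p
        = h t (\<theta> t) $ p + (\<Sum>k\<in>UNIV. a t $ p $ k *\<^sub>R dy g t (\<theta> t) $ k)"
      unfolding C.\<eta>'_entries by simp
  qed
qed

end
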